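(* There exists an integer $n_0\ge1$ such that \[ \rho(\mathbf{H}^\varepsilon_{n_0})\le(1-\varepsilon^2)\,\rho(\mathbf{H})+o(\varepsilon^2),\qquad\text{as }\varepsilon\searrow0 . \] In particular, since each $\mathbf{H}^\varepsilon_{n_0}$ is a simply connected planar open set with finite inradius, $\mathbf{H}$ does not attain \[ C_{MH}=\inf\{\rho(\Omega):\Omega\subseteq\mathbb{R}^2\text{ open, simply connected, }r_\Omega<+\infty\}. \]
   Context: Hersch's pipe is $\mathbf{H}=\{(x_1,x_2):x_1^2+x_2^2<1,\ x_1<0\}\cup\{(x_1,x_2):0<|x_2|<1,\ x_1\ge0\}\subseteq\mathbb{R}^2$. For $n\ge1$, $0<\varepsilon<1/(2n)$ and $i=0,\dots,n$: $T^\varepsilon_i=(2+\tfrac in-\varepsilon,2+\tfrac in+\varepsilon)\times[1,2)$ and $\mathbf{H}^\varepsilon_n=\mathbf{H}\cup\bigcup_{i=0}^nT^\varepsilon_i$. For an open set $\Omega$, the inradius is $r_\Omega=\sup\{r>0:\exists x\in\Omega,\ B_r(x)\subseteq\Omega\}$, $\lambda_1(\Omega)=\inf\{\int_\Omega|\nabla\varphi|^2:\varphi\in W^{1,2}_0(\Omega),\|\varphi\|_{L^2(\Omega)}=1\}$, and $\rho(\Omega)=r_\Omega^2\,\lambda_1(\Omega)$. *)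

theory Defs
  imports "HOL-Analysis.Analysis"
begin

type_synonym pt = "real \<times> real"

definition H_pipe :: "pt set" where
  "H_pipe = {(x1, x2). x1^2 + x2^2 < 1 \<and> x1 < 0} \<union> {(x1, x2). 0 < \<bar>x2\<bar> \<and> \<bar>x2\<bar> < 1 \<and> x1 \<ge> 0}"

definition T_tube :: "real \<Rightarrow> nat \<Rightarrow> nat \<Rightarrow> pt set" where
  "T_tube \<epsilon> n i = {(x1, x2). 2 + real i / real n - \<epsilon> < x1 \<and> x1 < 2 + real i / real n + \<epsilon>
                                  \<and> 1 \<le> x2 \<and> x2 < 2}"

definition H_pert :: "real \<Rightarrow> nat \<Rightarrow> pt set" where
  "H_pert \<epsilon> n = H_pipe \<union> (\<Union>i\<in>{0..n}. T_tube \<epsilon> n i)"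

definition inradius :: "pt set \<Rightarrow> real" where
  "inradius \<Omega> = Sup {r. r > 0 \<and> (\<exists>x\<in>\<Omega>. ball x r \<subseteq> \<Omega>)}"

definition finite_inradius :: "pt set \<Rightarrow> bool" where
  "finite_inradius \<Omega> \<longleftrightarrow> bdd_above {r. r > 0 \<and> (\<exists>x\<in>\<Omega>. ball x r \<subseteq> \<Omega>)}"

definition dx1 :: "(pt \<Rightarrow> real) \<Rightarrow> pt \<Rightarrow> real" where
  "dx1 f x = frechet_derivative f (at x) (1, 0)"

definition dx2 :: "(pt \<Rightarrow> real) \<Rightarrow> pt \<Rightarrow> real" where
  "dx2 f x = frechet_derivative f (at x) (0, 1)"

definition grad :: "(pt \<Rightarrow> real) \<Rightarrow> pt \<Rightarrow> pt" where
  "grad f x = (dx1 f x, dx2 f x)"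

fun Ck :: "nat \<Rightarrow> (pt \<Rightarrow> real) \<Rightarrow> bool" where
  "Ck 0 f = continuous_on UNIV f"
| "Ck (Suc k) f = ((\<forall>x. f differentiable (at x)) \<and> Ck k (dx1 f) \<and> Ck k (dx2 f))"

definition smooth :: "(pt \<Rightarrow> real) \<Rightarrow> bool" where
  "smooth f \<longleftrightarrow> (\<forall>k. Ck k f)"

definition test_fun :: "pt set \<Rightarrow> (pt \<Rightarrow> real) \<Rightarrow> bool" where
  "test_fun \<Omega> f \<longleftrightarrow> smooth f \<and> compact (closure {x. f x \<noteq> 0}) \<and> closure {x. f x \<noteq> 0} \<subseteq> \<Omega>"

text \<open>u (with weak gradient g) belongs to W^{1,2}_0(Omega): the closure of C_c^infinity(Omega)
  in the W^{1,2} norm. Functions are extended by zero outside Omega.\<close>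
definition W120 :: "pt set \<Rightarrow> (pt \<Rightarrow> real) \<Rightarrow> (pt \<Rightarrow> pt) \<Rightarrow> bool" where
  "W120 \<Omega> u g \<longleftrightarrow>
     u \<in> borel_measurable lebesgue \<and> integrable lebesgue (\<lambda>x. (u x)^2) \<and>
     g \<in> borel_measurable lebesgue \<and> integrable lebesgue (\<lambda>x. (norm (g x))^2) \<and>
     (\<exists>\<phi> :: nat \<Rightarrow> pt \<Rightarrow> real. (\<forall>k. test_fun \<Omega> (\<phi> k)) \<and>
        (\<lambda>k. integral\<^sup>L lebesgue (\<lambda>x. (\<phi> k x - u x)^2)) \<longlonglongrightarrow> 0 \<and>
        (\<lambda>k. integral\<^sup>L lebesgue (\<lambda>x. (norm (grad (\<phi> k) x - g x))^2)) \<longlonglongrightarrow> 0)"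

definition lambda1 :: "pt set \<Rightarrow> real" where
  "lambda1 \<Omega> = Inf {integral\<^sup>L lebesgue (\<lambda>x. (norm (g x))^2) | u g.
                       W120 \<Omega> u g \<and> integral\<^sup>L lebesgue (\<lambda>x. (u x)^2) = 1}"

definition rho :: "pt set \<Rightarrow> real" where
  "rho \<Omega> = (inradius \<Omega>)^2 * lambda1 \<Omega>"

definition C_MH :: real where
  "C_MH = Inf {rho \<Omega> | \<Omega>. open \<Omega> \<and> \<Omega> \<noteq> {} \<and> simply_connected \<Omega> \<and> finite_inradius \<Omega>}"

end

theory Submission
  imports Defs "HOL-Complex_Analysis.Complex_Analysis"
begin

text \<open>
  Write \<open>\<lambda> = \<lambda>\<^sub>1(H)\<close>. Opening a tube of width \<open>2\<epsilon>\<close> raises the squared inradius only by a factor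
  \<open>(1 + \<epsilon>\<^sup>2)\<^sup>2\<close>, whatever the number of tubes, whereas each tube lowers \<open>\<lambda>\<^sub>1\<close> by at least a fixed multiple
  of \<open>\<epsilon>\<^sup>2\<close>; so many tubes win. Neither a ground state nor its regularity is used. Take a nonnegative
  test function \<open>u\<close> on the pipe whose Rayleigh quotient is very close to \<open>\<lambda>\<close>, and let \<open>h\<close> be a bump of
  height and energy of order one across an opening. Adding to \<open>h\<close> the function \<open>\<theta>\<epsilon>\<phi>\<close>, where
  \<open>\<phi>\<close> is a truncated dipole sitting at the opening, gives a function that is subharmonic in the pipe.
  As \<open>\<phi>\<close> is a test function on the pipe, it is almost orthogonal to \<open>u\<close> for the form
  \<open>\<integral>\<nabla>u\<cdot>\<nabla>v - \<lambda>\<integral>uv\<close>, and integration by parts bounds the value of this form at \<open>(u, h)\<close> by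
  \<open>-\<theta>\<epsilon>\<lambda>\<integral>u\<phi>\<close>. Perturbing \<open>u\<close> by a multiple of \<open>\<epsilon>h\<close> then gains order \<open>\<epsilon>\<^sup>2\<close>, provided that
  \<open>\<integral>u\<phi>\<close> is bounded below uniformly in \<open>u\<close>. That bound holds because \<open>\<lambda> < \<pi>\<^sup>2\<close> (the trial function
  \<open>sin (\<pi>\<rho>)\<close>, with \<open>\<rho>\<close> the distance to the slit, sits exactly at the threshold and is no eigenfunction),
  so that mass cannot escape into the arms, and a weak Harnack argument spreads it over the whole pipe.
\<close>

subsection \<open>Partial derivatives and local smoothness\<close>

text \<open>For a true ground state \<open>u\<close>, the form at \<open>(u, h)\<close> would be the
  integral of \<open>h\<close> times the outward normal derivative of \<open>u\<close> over the
  opening, hence negative of order \<epsilon>. Up to a factor the dipole y / r^2 is the Poisson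
  kernel of a half plane: it expresses that normal derivative by values of \<open>u\<close> inside,
  so that a Hopf lemma at the wall is replaced by a lower bound for the mass of \<open>u\<close> on
  one fixed ball. For a near-minimiser with defect \<eta>, the error against a test function v is
  sqrt (E(v)) sqrt \<eta>, by Cauchy-Schwarz for the semidefinite form E. For the dipole, E(v) may
  grow as \<epsilon> tends to 0; this is harmless, because \<eta> is chosen after \<epsilon>. Only
  \<theta> and the mass bound must be independent of \<epsilon>. Dirichlet energy is scale invariant
  in the plane, so a bump of width \<epsilon> gains no more than order \<epsilon>^2, exactly the
  order of the loss in the inradius; the number of tubes has to tip the balance. The tubes that
  carry bumps all lie over the segment from 2 to 21/10, so that one ball serves them all.\<close>

fun CkOn :: "nat \<Rightarrow> pt set \<Rightarrow> (pt \<Rightarrow> real) \<Rightarrow> bool" where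
  "CkOn 0 U f = continuous_on U f"
| "CkOn (Suc k) U f = ((\<forall>x\<in>U. f differentiable (at x)) \<and> CkOn k U (dx1 f) \<and> CkOn k U (dx2 f))"

definition smoothOn :: "pt set \<Rightarrow> (pt \<Rightarrow> real) \<Rightarrow> bool" where
  "smoothOn U f \<longleftrightarrow> (\<forall>k. CkOn k U f)"

lemma Ck_eq_CkOn: "Ck k f = CkOn k UNIV f"
  by (induction k arbitrary: f) auto

lemma smooth_iff_smoothOn: "smooth f \<longleftrightarrow> smoothOn UNIV f"
  by (simp add: smooth_def smoothOn_def Ck_eq_CkOn)

text \<open>\<open>dx1\<close> and \<open>dx2\<close> come from \<open>frechet_derivative\<close>, a
  choice operator that says nothing where no derivative exists. \<open>pd\<close> ties both partials
  to an actual derivative, so the rules of calculus are proved once and transferred by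
  \<open>pdD\<close> and \<open>pdI\<close>.\<close>

definition pd :: "(pt \<Rightarrow> real) \<Rightarrow> real \<Rightarrow> real \<Rightarrow> pt \<Rightarrow> bool" where
  "pd f a b x \<longleftrightarrow> (f has_derivative (\<lambda>h. a * fst h + b * snd h)) (at x)"

lemma pdD:
  assumes "pd f a b x"
  shows "dx1 f x = a" "dx2 f x = b" "f differentiable (at x)"
proof -
  have d: "(f has_derivative (\<lambda>h. a * fst h + b * snd h)) (at x)" using assms by (simp add: pd_def)
  note e = frechet_derivative_at[OF d, symmetric]
  show "dx1 f x = a" "dx2 f x = b" by (simp_all add: dx1_def dx2_def e)
  show "f differentiable (at x)" using d by (auto simp: differentiable_def)
qed

lemma pdI:
  assumes "f differentiable (at x)"
  shows "pd f (dx1 f x) (dx2 f x) x"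
proof -
  have d: "(f has_derivative frechet_derivative f (at x)) (at x)"
    using assms by (simp add: frechet_derivative_works)
  interpret linear "frechet_derivative f (at x)"
    using d has_derivative_linear by blast
  have "frechet_derivative f (at x) = (\<lambda>h. dx1 f x * fst h + dx2 f x * snd h)"
  proof
    fix h :: pt
    have "h = fst h *\<^sub>R (1,0) + snd h *\<^sub>R (0,1)" by (cases h) simp
    then have "frechet_derivative f (at x) h = fst h *\<^sub>R frechet_derivative f (at x) (1,0)
        + snd h *\<^sub>R frechet_derivative f (at x) (0,1)"
      by (metis add scale)
    then show "frechet_derivative f (at x) h = dx1 f x * fst h + dx2 f x * snd h"
      by (simp add: dx1_def dx2_def)
  qed
  with d show ?thesis by (simp add: pd_def)
qed

lemma pd_eq: "pd f a b x \<Longrightarrow> a = a' \<Longrightarrow> b = b' \<Longrightarrow> pd f a' b' x" by simp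

lemma pd_const: "pd (\<lambda>x. c) 0 0 x" by (simp add: pd_def)
lemma pd_fst: "pd fst 1 0 x" and pd_snd: "pd snd 0 1 x"
  by (auto simp: pd_def intro!: derivative_eq_intros)

lemma pd_add:
  assumes "pd f a b x" "pd g c d x"
  shows "pd (\<lambda>x. f x + g x) (a + c) (b + d) x"
proof -
  have "(\<lambda>h. (a * fst h + b * snd h) + (c * fst h + d * snd h))
      = (\<lambda>h. (a + c) * fst h + (b + d) * snd h)"
    by (rule ext) (simp only: distrib_left distrib_right add_ac)
  with has_derivative_add[OF assms[unfolded pd_def]] show ?thesis unfolding pd_def by (simp only:)
qed

lemma pd_mult:
  assumes "pd f a b x" "pd g c d x"
  shows "pd (\<lambda>x. f x * g x) (a * g x + f x * c) (b * g x + f x * d) x"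
proof -
  have "(\<lambda>h. f x * (c * fst h + d * snd h) + (a * fst h + b * snd h) * g x)
      = (\<lambda>h. (a * g x + f x * c) * fst h + (b * g x + f x * d) * snd h)"
    by (rule ext) (simp only: distrib_left distrib_right mult.assoc mult.commute mult.left_commute add_ac)
  with has_derivative_mult[OF assms[unfolded pd_def]] show ?thesis unfolding pd_def by (simp only:)
qed

lemma pd_comp:
  assumes "(F has_real_derivative d) (at (f x))" "pd f a b x"
  shows "pd (\<lambda>x. F (f x)) (d * a) (d * b) x"
proof -
  have "(F has_derivative (\<lambda>h. d * h)) (at (f x))"
    using assms(1) by (simp add: has_field_derivative_def)
  then have "((\<lambda>x. F (f x)) has_derivative (\<lambda>h. d * (a * fst h + b * snd h))) (at x)"
    using assms(2) unfolding pd_def by (rule has_derivative_compose[rotated])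
  then show ?thesis unfolding pd_def by (simp only: distrib_left mult.assoc)
qed

lemma pd_cong:
  assumes "open U" "x \<in> U" "\<And>y. y \<in> U \<Longrightarrow> f y = g y" "pd f a b x"
  shows "pd g a b x"
  using has_derivative_transform_within_open[OF assms(4)[unfolded pd_def] assms(1-3)] by (simp only: pd_def)

lemma dx_cong:
  assumes "open U" "x \<in> U" "\<And>y. y \<in> U \<Longrightarrow> f y = g y" "f differentiable (at x)"
  shows "dx1 g x = dx1 f x" "dx2 g x = dx2 f x" "g differentiable (at x)"
  by (rule pdD[OF pd_cong[OF assms(1-3) pdI[OF assms(4)]]], assumption)+

lemma CkOn_cong:
  assumes "open U" "\<And>y. y \<in> U \<Longrightarrow> f y = g y" "CkOn k U f"
  shows "CkOn k U g"
  using assms(2,3)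
proof (induction k arbitrary: f g)
  case 0
  then show ?case by (metis CkOn.simps(1) continuous_on_cong)
next
  case (Suc k)
  have d: "f differentiable at x" if "x \<in> U" for x
    using Suc.prems(2) that by simp
  note e = dx_cong[OF assms(1) _ Suc.prems(1) d]
  have "CkOn k U (dx1 g)"
    by (rule Suc.IH[of "dx1 f"]) (use e(1) Suc.prems(2) in simp_all)
  moreover have "CkOn k U (dx2 g)"
    by (rule Suc.IH[of "dx2 f"]) (use e(2) Suc.prems(2) in simp_all)
  ultimately show ?case using e(3) by simp
qed

lemma CkOn_SucD: "CkOn (Suc k) U f \<Longrightarrow> CkOn k U f"
proof (induction k arbitrary: f)
  case 0
  then show ?case
    by (auto intro!: continuous_at_imp_continuous_on differentiable_imp_continuous_within)
next
  case (Suc k)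
  note p = Suc.prems[unfolded CkOn.simps(2)[of "Suc k"]]
  show ?case unfolding CkOn.simps(2)[of k] using p Suc.IH by blast
qed

lemma CkOn_Un: "open U \<Longrightarrow> open V \<Longrightarrow> CkOn k U f \<Longrightarrow> CkOn k V f \<Longrightarrow> CkOn k (U \<union> V) f"
  by (induction k arbitrary: f) (auto intro: continuous_on_open_Un)

lemma CkOn_subset: "CkOn k U f \<Longrightarrow> V \<subseteq> U \<Longrightarrow> CkOn k V f"
  by (induction k arbitrary: f) (auto intro: continuous_on_subset)

lemma CkOn_const: "CkOn k U (\<lambda>x. c)"
proof (induction k arbitrary: c)
  case (Suc k)
  have "dx1 (\<lambda>x::pt. c) = (\<lambda>x. 0)" "dx2 (\<lambda>x::pt. c) = (\<lambda>x. 0)" using pdD[OF pd_const] by auto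
  then show ?case using Suc by simp
qed simp

lemma CkOn_fst: "CkOn k U fst"
proof (cases k)
  case 0 then show ?thesis by (simp add: continuous_on_fst continuous_on_id)
next
  case (Suc k)
  have "dx1 fst = (\<lambda>x. 1)" "dx2 fst = (\<lambda>x. 0)" using pdD[OF pd_fst] by auto
  then show ?thesis using Suc pdD(3)[OF pd_fst] by (simp add: CkOn_const)
qed

lemma CkOn_snd: "CkOn k U snd"
proof (cases k)
  case 0 then show ?thesis by (simp add: continuous_on_snd continuous_on_id)
next
  case (Suc k)
  have "dx1 snd = (\<lambda>x. 0)" "dx2 snd = (\<lambda>x. 1)" using pdD[OF pd_snd] by auto
  then show ?thesis using Suc pdD(3)[OF pd_snd] by (simp add: CkOn_const)
qed

text \<open>\<open>CkOn\<close> sees only values on the open set \<open>U\<close>, so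
  \<open>a\<close> and \<open>b\<close> may differ from the partials elsewhere. Closure of C^k under
  an operation thus reduces to a derivative formula on \<open>U\<close>.\<close>

lemma CkOn_SucI:
  assumes "open U" "\<And>x. x \<in> U \<Longrightarrow> pd f (a x) (b x) x" "CkOn k U a" "CkOn k U b"
  shows "CkOn (Suc k) U f"
proof -
  have "CkOn k U (dx1 f)" by (rule CkOn_cong[OF assms(1) _ assms(3)]) (rule pdD(1)[OF assms(2), symmetric])
  moreover have "CkOn k U (dx2 f)" by (rule CkOn_cong[OF assms(1) _ assms(4)]) (rule pdD(2)[OF assms(2), symmetric])
  moreover have "\<forall>x\<in>U. f differentiable at x" using pdD(3)[OF assms(2)] by blast
  ultimately show ?thesis unfolding CkOn.simps(2) by blast
qed

lemma CkOn_SucE: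
  assumes "CkOn (Suc k) U f"
  shows "CkOn k U f" "CkOn k U (dx1 f)" "CkOn k U (dx2 f)" "\<And>x. x \<in> U \<Longrightarrow> pd f (dx1 f x) (dx2 f x) x"
  using CkOn_SucD[OF assms] assms[unfolded CkOn.simps(2)] pdI by blast+

lemma CkOn_add:
  assumes "open U" shows "CkOn k U f \<Longrightarrow> CkOn k U g \<Longrightarrow> CkOn k U (\<lambda>x. f x + g x)"
proof (induction k arbitrary: f g)
  case 0 then show ?case by (simp add: continuous_on_add)
next
  case (Suc k)
  note f = CkOn_SucE[OF Suc.prems(1)] and g = CkOn_SucE[OF Suc.prems(2)]
  show ?case
    by (rule CkOn_SucI[OF assms pd_add[OF f(4) g(4)] Suc.IH[OF f(2) g(2)] Suc.IH[OF f(3) g(3)]])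
qed

lemma CkOn_mult:
  assumes "open U" shows "CkOn k U f \<Longrightarrow> CkOn k U g \<Longrightarrow> CkOn k U (\<lambda>x. f x * g x)"
proof (induction k arbitrary: f g)
  case 0 then show ?case by (simp add: continuous_on_mult)
next
  case (Suc k)
  note f = CkOn_SucE[OF Suc.prems(1)] and g = CkOn_SucE[OF Suc.prems(2)]
  show ?case
    by (rule CkOn_SucI[OF assms pd_mult[OF f(4) g(4)]
          CkOn_add[OF assms Suc.IH[OF f(2) g(1)] Suc.IH[OF f(1) g(2)]]
          CkOn_add[OF assms Suc.IH[OF f(3) g(1)] Suc.IH[OF f(1) g(3)]]])
qed

text \<open>The chain rule produces the next member of the tower \<open>D\<close> with the same
  inner function, so the induction on \<open>k\<close> must cover all \<open>n\<close> at
  once.\<close>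

lemma CkOn_comp:
  assumes U: "open U" and D: "\<And>n t. t \<in> V \<Longrightarrow> (D n has_real_derivative D (Suc n) t) (at t)"
    and f: "\<And>x. x \<in> U \<Longrightarrow> f x \<in> V"
  shows "CkOn k U f \<Longrightarrow> CkOn k U (\<lambda>x. D n (f x))"
proof (induction k arbitrary: n)
  case 0
  have "continuous_on V (D n)"
    by (metis D DERIV_isCont continuous_at_imp_continuous_on)
  then show ?case using 0 f continuous_on_compose2 by (metis CkOn.simps(1) image_subset_iff)
next
  case (Suc k)
  note g = CkOn_SucE[OF Suc.prems(1)]
  note k = Suc.IH[OF g(1), of "Suc n"]
  show ?case
    by (rule CkOn_SucI[OF U pd_comp[OF D[OF f] g(4)] CkOn_mult[OF U k g(2)] CkOn_mult[OF U k g(3)]])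
qed

lemma smoothOn_const: "smoothOn U (\<lambda>x. c)"
  and smoothOn_fst: "smoothOn U fst"
  and smoothOn_snd: "smoothOn U snd"
  by (simp_all add: smoothOn_def CkOn_const CkOn_fst CkOn_snd)

lemma smoothOn_add: "open U \<Longrightarrow> smoothOn U f \<Longrightarrow> smoothOn U g \<Longrightarrow> smoothOn U (\<lambda>x. f x + g x)"
  and smoothOn_mult: "open U \<Longrightarrow> smoothOn U f \<Longrightarrow> smoothOn U g \<Longrightarrow> smoothOn U (\<lambda>x. f x * g x)"
  by (simp_all add: smoothOn_def CkOn_add CkOn_mult)

lemma smoothOn_diff: "open U \<Longrightarrow> smoothOn U f \<Longrightarrow> smoothOn U g \<Longrightarrow> smoothOn U (\<lambda>x. f x - g x)"
  using smoothOn_add[of U f "\<lambda>x. (-1) * g x"] smoothOn_mult[of U "\<lambda>x. -1" g] smoothOn_const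
  by simp

lemma smoothOn_power: "open U \<Longrightarrow> smoothOn U f \<Longrightarrow> smoothOn U (\<lambda>x. f x ^ n)"
  by (induction n) (auto intro: smoothOn_const smoothOn_mult)

text \<open>The whole tower of derivatives is the witness, which is the form that
  \<open>CkOn_comp\<close> consumes.\<close>

definition smooth1 :: "real set \<Rightarrow> (real \<Rightarrow> real) \<Rightarrow> bool" where
  "smooth1 V F \<longleftrightarrow> (\<exists>D. D (0::nat) = F \<and> (\<forall>n. \<forall>t\<in>V. (D n has_real_derivative D (Suc n) t) (at t)))"

lemma smooth1I:
  assumes "\<And>n t. t \<in> V \<Longrightarrow> (D n has_real_derivative D (Suc n) t) (at t)" "\<And>t. D 0 t = F t"
  shows "smooth1 V F"
  unfolding smooth1_def using assms by (intro exI[of _ D]) auto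

lemma smoothOn_comp:
  assumes "open U" "smooth1 V F" "smoothOn U f" "\<And>x. x \<in> U \<Longrightarrow> f x \<in> V"
  shows "smoothOn U (\<lambda>x. F (f x))"
proof -
  obtain D where D: "D (0::nat) = F" "\<And>n t. t \<in> V \<Longrightarrow> (D n has_real_derivative D (Suc n) t) (at t)"
    using assms(2) unfolding smooth1_def by blast
  have "CkOn k U (\<lambda>x. D 0 (f x))" for k
    by (rule CkOn_comp[where D=D and V=V]) (use assms smoothOn_def D(2) in auto)
  then show ?thesis by (simp add: smoothOn_def D(1))
qed

lemma smoothOn_cong:
  "open U \<Longrightarrow> (\<And>y. y \<in> U \<Longrightarrow> f y = g y) \<Longrightarrow> smoothOn U f \<Longrightarrow> smoothOn U g"
  using CkOn_cong unfolding smoothOn_def by blast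

lemma smoothOn_Un: "open U \<Longrightarrow> open V \<Longrightarrow> smoothOn U f \<Longrightarrow> smoothOn V f \<Longrightarrow> smoothOn (U \<union> V) f"
  by (simp add: smoothOn_def CkOn_Un)

lemma smoothOn_subset: "smoothOn U f \<Longrightarrow> V \<subseteq> U \<Longrightarrow> smoothOn V f"
  unfolding smoothOn_def by (metis CkOn_subset)

lemma smoothOn_dx: "smoothOn U f \<Longrightarrow> smoothOn U (dx1 f)" "smoothOn U f \<Longrightarrow> smoothOn U (dx2 f)"
  unfolding smoothOn_def using CkOn_SucE(2,3) by blast+

lemma smoothOn_pd: "smoothOn U f \<Longrightarrow> x \<in> U \<Longrightarrow> pd f (dx1 f x) (dx2 f x) x"
  unfolding smoothOn_def using CkOn_SucE(4) by blast

lemma smoothOn_differentiable: "smoothOn U f \<Longrightarrow> x \<in> U \<Longrightarrow> f differentiable (at x)"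
  using pdD(3)[OF smoothOn_pd] .

lemma smoothOn_continuous: "smoothOn U f \<Longrightarrow> continuous_on U f"
  unfolding smoothOn_def using CkOn.simps(1) by blast

lemma smoothOn_sin:
  assumes "open U" "smoothOn U f" shows "smoothOn U (\<lambda>x. sin (f x))"
proof -
  \<comment> \<open>Each derivative of the sine is a shift by a quarter period.\<close>
  define D where "D n t = sin (t + real n * (pi/2))" for n t
  have "smooth1 UNIV sin"
    by (rule smooth1I[of _ D]; unfold D_def)
      (auto intro!: derivative_eq_intros simp: sin_add cos_add algebra_simps add_divide_distrib)
  from smoothOn_comp[OF assms(1) this assms(2)] show ?thesis by simp
qed

lemma smoothOn_inverse:
  assumes "open U" "smoothOn U f" "\<And>x. x \<in> U \<Longrightarrow> f x \<noteq> 0" shows "smoothOn U (\<lambda>x. 1 / f x)"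
proof -
  define D where "D n t = (-1)^n * fact n * t powi (- int (Suc n))" for n and t :: real
  have "smooth1 (-{0}) (\<lambda>t. 1/t)"
  proof (rule smooth1I[of _ D])
    fix n and t :: real assume "t \<in> -{0}"
    then show "(D n has_real_derivative D (Suc n) t) (at t)"
      unfolding D_def by (auto intro!: derivative_eq_intros simp: algebra_simps)
  qed (simp add: D_def power_int_minus field_simps)
  from smoothOn_comp[OF assms(1) this assms(2)] show ?thesis using assms(3) by simp
qed

lemma smoothOn_divide:
  assumes "open U" "smoothOn U f" "smoothOn U g" "\<And>x. x \<in> U \<Longrightarrow> g x \<noteq> 0"
  shows "smoothOn U (\<lambda>x. f x / g x)"
  using smoothOn_mult[OF assms(1,2) smoothOn_inverse[OF assms(1,3,4)]] by simp

lemma smoothOn_sqrt: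
  assumes "open U" "smoothOn U f" "\<And>x. x \<in> U \<Longrightarrow> f x > 0" shows "smoothOn U (\<lambda>x. sqrt (f x))"
proof -
  define D where "D n t = (\<Prod>i<n. 1/2 - real i) * t powr (1/2 - real n)" for n and t :: real
  have "smooth1 {0<..} (D 0)"
    by (rule smooth1I[of _ D]; unfold D_def) (auto intro!: derivative_eq_intros simp: algebra_simps)
  from smoothOn_comp[OF assms(1) this assms(2)] have "smoothOn U (\<lambda>x. D 0 (f x))"
    using assms(3) by simp
  then show ?thesis
    by (rule smoothOn_cong[OF assms(1), rotated]) (simp add: D_def powr_half_sqrt assms(3) less_imp_le)
qed

text \<open>Quotients and gluing are developed for functions on the plane; restriction to the first
  axis carries them back to one variable. This gives the smoothness of \<open>stp\<close> and
  \<open>GG\<close>.\<close>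

lemma smooth1_slice:
  assumes "smoothOn UNIV f"
  shows "smooth1 UNIV (\<lambda>t. f (t,0))"
proof -
  define D where "D n t = ((dx1 ^^ n) f) (t,0)" for n t
  have s: "smoothOn UNIV ((dx1 ^^ n) f)" for n
    using assms by (induction n) (simp_all add: smoothOn_dx)
  show ?thesis
  proof (rule smooth1I[of _ D])
    fix n t
    have "((dx1 ^^ n) f has_derivative (\<lambda>h. D (Suc n) t * fst h + dx2 ((dx1 ^^ n) f) (t,0) * snd h)) (at (t,0))"
      using smoothOn_pd[OF s, of "(t,0)" n] by (simp add: pd_def D_def)
    moreover have "((\<lambda>t. (t,0::real)) has_derivative (\<lambda>h. (h,0))) (at t)"
      by (auto intro!: derivative_eq_intros)
    ultimately have "((\<lambda>t. ((dx1 ^^ n) f) (t,0)) has_derivative (\<lambda>h. D (Suc n) t * h)) (at t)"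
      using has_derivative_compose by fastforce
    then show "(D n has_real_derivative D (Suc n) t) (at t)"
      unfolding D_def[of n] has_field_derivative_def by simp
  qed (simp add: D_def)
qed

subsection \<open>Cut-off functions\<close>

lemma poly_exp_tendsto_0: "((\<lambda>s. poly p s / exp s) \<longlongrightarrow> 0) (at_top :: real filter)"
proof -
  have "((\<lambda>s::real. \<Sum>i\<le>degree p. coeff p i * (s ^ i / exp s)) \<longlongrightarrow> (\<Sum>i\<le>degree p. coeff p i * 0)) at_top"
    by (intro tendsto_sum tendsto_mult tendsto_const tendsto_power_div_exp_0)
  then show ?thesis by (simp add: poly_altdef sum_divide_distrib)
qed

definition ee :: "real \<Rightarrow> real" where "ee t = (if t \<le> 0 then 0 else exp (- 1 / t))"

text \<open>With s = 1/t, the derivative of p(s) exp(-s) in t is s^2 (p(s) - p'(s)) exp(-s); the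
  factor \<open>[:0,0,1:]\<close> is s^2.\<close>

fun eeP :: "nat \<Rightarrow> real poly" where
  "eeP 0 = 1"
| "eeP (Suc n) = [:0,0,1:] * (eeP n - pderiv (eeP n))"

definition eeD :: "nat \<Rightarrow> real \<Rightarrow> real" where
  "eeD n t = (if t \<le> 0 then 0 else poly (eeP n) (1/t) * exp (- 1 / t))"

lemma eeD_deriv: "(eeD n has_real_derivative eeD (Suc n) t) (at t)"
proof -
  consider "t < 0" | "t > 0" | "t = 0" by linarith
  then show ?thesis
  proof cases
    case 1
    have "((\<lambda>t. 0) has_real_derivative 0) (at t)" by simp
    then have "(eeD n has_real_derivative 0) (at t)"
      by (rule has_field_derivative_transform_within_open[of _ _ _ "{..<0}"]) (use 1 in \<open>auto simp: eeD_def\<close>)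
    then show ?thesis using 1 by (simp add: eeD_def)
  next
    case 2
    have "((\<lambda>t. poly (eeP n) (1/t) * exp (- 1 / t)) has_real_derivative eeD (Suc n) t) (at t)"
      using 2 by (auto intro!: derivative_eq_intros DERIV_chain2[OF poly_DERIV] simp: eeD_def field_simps power2_eq_square)
    then show ?thesis
      by (rule has_field_derivative_transform_within_open[of _ _ _ "{0<..}"]) (use 2 in \<open>auto simp: eeD_def\<close>)
  next
    case 3
    have "((\<lambda>h. eeD n h / h) \<longlongrightarrow> 0) (at_left 0)"
      by (rule tendsto_eventually) (auto simp: eventually_at_filter eeD_def)
    moreover have "((\<lambda>h. eeD n h / h) \<longlongrightarrow> 0) (at_right 0)"
    proof (rule Lim_transform_eventually)
      \<comment> \<open>\<open>pCons 0\<close> multiplies by s = 1/h, which absorbs the division by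
        \<open>h\<close> in the difference quotient; the exponential then beats the
        polynomial.\<close>
      show "((\<lambda>h. poly (pCons 0 (eeP n)) (inverse h) / exp (inverse h)) \<longlongrightarrow> 0) (at_right (0::real))"
        by (rule filterlim_compose[OF poly_exp_tendsto_0 filterlim_inverse_at_top_right])
      show "\<forall>\<^sub>F h in at_right 0. poly (pCons 0 (eeP n)) (inverse h) / exp (inverse h) = eeD n h / h"
        by (auto simp: eventually_at_filter eeD_def field_simps exp_minus)
    qed
    ultimately have "((\<lambda>h. eeD n h / h) \<longlongrightarrow> 0) (at 0)"
      by (simp add: filterlim_split_at)
    then show ?thesis using 3 by (simp add: has_field_derivative_def has_derivative_at DERIV_def field_has_derivative_at eeD_def flip: has_field_derivative_def)
  qed
qed

definition ee1 :: "real \<Rightarrow> real" where "ee1 t = (if t \<le> 0 then 0 else exp (- 1 / t) / t\<^sup>2)"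
definition ee2 :: "real \<Rightarrow> real" where "ee2 t = (if t \<le> 0 then 0 else exp (- 1 / t) * (1 - 2 * t) / t^4)"

lemma eeD_simps: "eeD 0 = ee" "eeD 1 = ee1" "eeD 2 = ee2"
  by (auto simp: eeD_def ee_def ee1_def ee2_def numeral_2_eq_2 pderiv_pCons field_simps power2_eq_square eval_nat_numeral fun_eq_iff)

lemma ee_deriv: "(ee has_real_derivative ee1 t) (at t)"
  and ee1_deriv: "(ee1 has_real_derivative ee2 t) (at t)"
  using eeD_deriv[of 0 t] eeD_deriv[of 1 t] by (simp_all only: eeD_simps One_nat_def[symmetric] numeral_2_eq_2[symmetric] Suc_1)

lemma smooth1_ee: "smooth1 UNIV ee"
  by (rule smooth1I[of _ eeD]) (use eeD_deriv eeD_simps in auto)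

lemma smoothOn_ee: "open U \<Longrightarrow> smoothOn U f \<Longrightarrow> smoothOn U (\<lambda>x. ee (f x))"
  using smoothOn_comp[OF _ smooth1_ee] by simp

lemma ee_pos: "t > 0 \<Longrightarrow> ee t > 0" and ee_nonneg: "ee t \<ge> 0" and ee_le_1: "ee t \<le> 1"
  and ee_0: "t \<le> 0 \<Longrightarrow> ee t = 0" and ee1_nonneg: "ee1 t \<ge> 0"
  by (auto simp: ee_def ee1_def)

lemma ee_mono: "s \<le> t \<Longrightarrow> ee s \<le> ee t"
  by (auto simp: ee_def frac_le)

text \<open>The step lies between 1/2 and 1, not between 0 and 1, so that expressions such as
  \<open>stp q / q\<close> vanish identically near the singularity at 0.\<close>

definition stp :: "real \<Rightarrow> real" where "stp t = ee (t - 1/2) / (ee (t - 1/2) + ee (1 - t))"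

lemma stp_denom_pos: "ee (t - 1/2) + ee (1 - t) > 0"
  using ee_nonneg[of "t-1/2"] ee_nonneg[of "1-t"] ee_pos[of "t - 1/2"] ee_pos[of "1-t"] by (cases "t < 1") auto

lemma stp_0: "t \<le> 1/2 \<Longrightarrow> stp t = 0" and stp_1: "t \<ge> 1 \<Longrightarrow> stp t = 1"
  and stp_nonneg: "stp t \<ge> 0" and stp_le_1: "stp t \<le> 1"
  using stp_denom_pos[of t] ee_nonneg[of "t-1/2"] ee_nonneg[of "1-t"] ee_pos[of "t-1/2"]
  by (auto simp: stp_def ee_0 field_simps)

lemma smooth1_stp: "smooth1 UNIV stp"
proof -
  have "smoothOn UNIV (\<lambda>x. ee (fst x - 1/2) / (ee (fst x - 1/2) + ee (1 - fst x)))"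
    by (intro smoothOn_divide smoothOn_add smoothOn_ee smoothOn_diff smoothOn_fst smoothOn_const)
      (use stp_denom_pos less_imp_neq[symmetric] in auto)
  from smooth1_slice[OF this] show ?thesis by (simp add: stp_def[abs_def])
qed

lemma smoothOn_stp: "open U \<Longrightarrow> smoothOn U f \<Longrightarrow> smoothOn U (\<lambda>x. stp (f x))"
  using smoothOn_comp[OF _ smooth1_stp] by simp

lemma smooth1_imp_deriv:
  assumes "smooth1 UNIV F"
  obtains F1 F2 where "\<And>t. (F has_real_derivative F1 t) (at t)" "\<And>t. (F1 has_real_derivative F2 t) (at t)"
    "continuous_on UNIV F2"
proof -
  obtain D where D: "D (0::nat) = F" "\<And>n t. (D n has_real_derivative D (Suc n) t) (at t)"
    using assms unfolding smooth1_def by blast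
  have "continuous_on UNIV (D 2)"
    by (meson D(2) DERIV_isCont continuous_at_imp_continuous_on)
  then show ?thesis using that[of "D 1" "D 2"] D(2)[of 0] D(2)[of 1] D(1) by (simp add: numeral_2_eq_2)
qed

subsection \<open>Test functions and integration by parts\<close>

lemma test_funI:
  assumes "smoothOn UNIV f" "compact K" "K \<subseteq> \<Omega>" "\<And>x. x \<notin> K \<Longrightarrow> f x = 0"
  shows "test_fun \<Omega> f"
proof -
  have "{x. f x \<noteq> 0} \<subseteq> K" using assms(4) by blast
  then have c: "closure {x. f x \<noteq> 0} \<subseteq> K"
    by (rule closure_minimal) (simp add: assms(2) compact_imp_closed)
  then have "compact (closure {x. f x \<noteq> 0})"
    by (metis assms(2) closed_closure compact_Int_closed inf.absorb_iff2)
  with c assms(1,3) show ?thesis by (auto simp: test_fun_def smooth_iff_smoothOn)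
qed

lemma test_fun_smooth: "test_fun \<Omega> f \<Longrightarrow> smoothOn UNIV f"
  by (simp add: test_fun_def smooth_iff_smoothOn)

lemma test_funE:
  assumes "test_fun \<Omega> f"
  obtains K where "compact K" "K \<subseteq> \<Omega>" "\<And>x. x \<notin> K \<Longrightarrow> f x = 0"
proof (rule that)
  show "compact (closure {x. f x \<noteq> 0})" "closure {x. f x \<noteq> 0} \<subseteq> \<Omega>"
    using assms by (simp_all add: test_fun_def)
  show "f x = 0" if "x \<notin> closure {x. f x \<noteq> 0}" for x
    using that closure_subset[of "{x. f x \<noteq> 0}"] by blast
qed

lemma test_fun_mono: "test_fun \<Omega> f \<Longrightarrow> \<Omega> \<subseteq> \<Omega>' \<Longrightarrow> test_fun \<Omega>' f"
  by (auto simp: test_fun_def)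

lemma test_fun_outside: "test_fun \<Omega> f \<Longrightarrow> x \<notin> \<Omega> \<Longrightarrow> f x = 0"
  by (erule test_funE) blast

lemma dx_zero_outside:
  assumes "closed K" "\<And>x. x \<notin> K \<Longrightarrow> f x = 0" "x \<notin> K"
  shows "dx1 f x = 0" "dx2 f x = 0"
proof -
  have "pd f 0 0 x"
    by (rule pd_cong[of "- K" _ "\<lambda>x. 0"]) (use assms pd_const in auto)
  then show "dx1 f x = 0" "dx2 f x = 0" by (rule pdD)+
qed

lemma test_fun_dx:
  assumes "test_fun \<Omega> f"
  shows "test_fun \<Omega> (dx1 f)" "test_fun \<Omega> (dx2 f)"
proof -
  obtain K where K: "compact K" "K \<subseteq> \<Omega>" "\<And>x. x \<notin> K \<Longrightarrow> f x = 0" using assms by (rule test_funE) blast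
  note z = dx_zero_outside[where f=f, OF compact_imp_closed[OF K(1)] K(3)]
  show "test_fun \<Omega> (dx1 f)" "test_fun \<Omega> (dx2 f)"
    by (rule test_funI[OF _ K(1,2)], use smoothOn_dx[OF test_fun_smooth[OF assms]] z in auto)+
qed

lemma test_fun_local:
  assumes "test_fun \<Omega> f" "open \<Omega>" "smoothOn \<Omega> g"
  shows "test_fun \<Omega> (\<lambda>x. f x * g x)"
proof -
  obtain K where K: "compact K" "K \<subseteq> \<Omega>" "\<And>x. x \<notin> K \<Longrightarrow> f x = 0" using assms(1) by (rule test_funE) blast
  have "smoothOn (- K) (\<lambda>x. f x * g x)"
    by (rule smoothOn_cong[of _ "\<lambda>x. 0"]) (use K smoothOn_const in \<open>auto simp: compact_imp_closed open_Compl\<close>)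
  moreover have "smoothOn \<Omega> (\<lambda>x. f x * g x)"
    using assms(2,3) smoothOn_subset[OF test_fun_smooth[OF assms(1)]] by (intro smoothOn_mult) auto
  ultimately have "smoothOn (- K \<union> \<Omega>) (\<lambda>x. f x * g x)"
    using smoothOn_Un assms(2) K(1) by (auto simp: compact_imp_closed open_Compl)
  moreover have "- K \<union> \<Omega> = UNIV" using K(2) by auto
  ultimately show ?thesis by (intro test_funI[OF _ K(1,2)]) (use K(3) in auto)
qed

lemma test_fun_mult:
  assumes "test_fun \<Omega> f" "smoothOn UNIV g"
  shows "test_fun \<Omega> (\<lambda>x. f x * g x)"
proof -
  obtain K where K: "compact K" "K \<subseteq> \<Omega>" "\<And>x. x \<notin> K \<Longrightarrow> f x = 0" using assms(1) by (rule test_funE) blast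
  show ?thesis
    by (rule test_funI[OF smoothOn_mult[OF open_UNIV test_fun_smooth[OF assms(1)] assms(2)] K(1,2)])
      (use K(3) in auto)
qed

lemma test_fun_add:
  assumes "test_fun \<Omega> f" "test_fun \<Omega> g"
  shows "test_fun \<Omega> (\<lambda>x. f x + g x)"
proof -
  obtain K where K: "compact K" "K \<subseteq> \<Omega>" "\<And>x. x \<notin> K \<Longrightarrow> f x = 0" using assms(1) by (rule test_funE) blast
  obtain L where L: "compact L" "L \<subseteq> \<Omega>" "\<And>x. x \<notin> L \<Longrightarrow> g x = 0" using assms(2) by (rule test_funE) blast
  show ?thesis
    by (rule test_funI[of _ "K \<union> L"])
      (use K L smoothOn_add[OF open_UNIV test_fun_smooth[OF assms(1)] test_fun_smooth[OF assms(2)]] in auto)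
qed

lemma test_fun_cmult: "test_fun \<Omega> f \<Longrightarrow> test_fun \<Omega> (\<lambda>x. c * f x)"
  using test_fun_mult[of \<Omega> f "\<lambda>x. c"] smoothOn_const by (simp add: mult.commute)

lemma test_fun_0: "test_fun \<Omega> (\<lambda>x. 0)"
  by (rule test_funI[of _ "{}"]) (auto simp: smoothOn_const)

lemma test_fun_sum:
  "(\<And>i. i \<in> I \<Longrightarrow> test_fun \<Omega> (f i)) \<Longrightarrow> test_fun \<Omega> (\<lambda>x. \<Sum>i\<in>I. f i x)"
  by (induction I rule: infinite_finite_induct) (auto intro: test_fun_0 test_fun_add)

lemma test_fun_borel: "test_fun \<Omega> f \<Longrightarrow> f \<in> borel_measurable borel"
  by (intro borel_measurable_continuous_onI smoothOn_continuous test_fun_smooth)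

lemma integrable_compact_support:
  fixes f :: "'a::euclidean_space \<Rightarrow> real"
  assumes "continuous_on UNIV f" "compact K" "\<And>x. x \<notin> K \<Longrightarrow> f x = 0"
  shows "integrable lborel f"
proof -
  have "integrable lborel (\<lambda>x. indicator K x *\<^sub>R f x)"
    by (rule borel_integrable_compact[OF assms(2) continuous_on_subset[OF assms(1)]]) simp
  moreover have "(\<lambda>x. indicator K x *\<^sub>R f x) = f" using assms(3) by (intro ext) (auto simp: indicator_def simp del: split_paired_All)
  ultimately show ?thesis by simp
qed

lemma integrable_test:
  assumes "test_fun \<Omega> f" shows "integrable lborel f"
proof -
  obtain K where K: "compact K" "K \<subseteq> \<Omega>" "\<And>x. x \<notin> K \<Longrightarrow> f x = 0" using assms by (rule test_funE) blast
  show ?thesis using integrable_compact_support[OF smoothOn_continuous[OF test_fun_smooth[OF assms]] K(1,3)] .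
qed

lemma integrable_test_mult:
  assumes "test_fun \<Omega> f" "continuous_on UNIV g" shows "integrable lborel (\<lambda>x. f x * g x)"
proof -
  obtain K where K: "compact K" "K \<subseteq> \<Omega>" "\<And>x. x \<notin> K \<Longrightarrow> f x = 0" using assms(1) by (rule test_funE) blast
  show ?thesis
    by (rule integrable_compact_support[OF continuous_on_mult[OF smoothOn_continuous[OF test_fun_smooth[OF assms(1)]] assms(2)] K(1)])
       (simp add: K(3))
qed

lemma integrable_test_prod: "test_fun \<Omega> f \<Longrightarrow> test_fun \<Omega>' g \<Longrightarrow> integrable lborel (\<lambda>x. f x * g x)"
  by (rule integrable_test_mult) (auto intro: smoothOn_continuous test_fun_smooth)

lemma integrable_test_sq: "test_fun \<Omega> f \<Longrightarrow> integrable lborel (\<lambda>x. (f x)\<^sup>2)"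
  using integrable_test_prod[of \<Omega> f \<Omega> f] by (simp add: power2_eq_square)

lemma integral_deriv_compact:
  fixes g g' :: "real \<Rightarrow> real"
  assumes "\<And>t. (g has_real_derivative g' t) (at t)" "continuous_on UNIV g'" "\<And>t. \<bar>t\<bar> \<ge> R \<Longrightarrow> g t = 0"
    "\<And>t. \<bar>t\<bar> \<ge> R \<Longrightarrow> g' t = 0" "R > 0"
  shows "(\<integral>t. g' t \<partial>lborel) = 0"
proof -
  have "(\<integral>t. g' t * indicator {-R..R} t \<partial>lborel) = g R - g (-R)"
    by (rule integral_FTC_Icc_real) (use assms in \<open>auto simp: continuous_on_eq_continuous_at\<close>)
  moreover have "(\<lambda>t. g' t * indicator {-R..R} t) = g'"
    using assms(4) by (force simp: indicator_def)
  ultimately show ?thesis using assms(3,5) by simp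
qed

lemma pd_slice:
  assumes "pd f a b (x,y)"
  shows "((\<lambda>t. f (t,y)) has_real_derivative a) (at x)" "((\<lambda>t. f (x,t)) has_real_derivative b) (at y)"
proof -
  have d: "(f has_derivative (\<lambda>h. a * fst h + b * snd h)) (at (x,y))" using assms by (simp add: pd_def)
  have "((\<lambda>t. (t,y)) has_derivative (\<lambda>h. (h,0))) (at x)" by (auto intro!: derivative_eq_intros)
  from has_derivative_compose[OF this d]
  show "((\<lambda>t. f (t,y)) has_real_derivative a) (at x)" by (simp add: has_field_derivative_def)
  have "((\<lambda>t. (x,t)) has_derivative (\<lambda>h. (0,h))) (at y)" by (auto intro!: derivative_eq_intros)
  from has_derivative_compose[OF this d]
  show "((\<lambda>t. f (x,t)) has_real_derivative b) (at y)" by (simp add: has_field_derivative_def)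
qed

lemma test_fun_slices:
  assumes "test_fun \<Omega> f"
  obtains R where "R > 0" "\<And>x y. \<bar>x\<bar> \<ge> R \<or> \<bar>y\<bar> \<ge> R \<Longrightarrow> f (x,y) = 0 \<and> dx1 f (x,y) = 0 \<and> dx2 f (x,y) = 0"
    "\<And>x y. ((\<lambda>t. f (t,y)) has_real_derivative dx1 f (x,y)) (at x)"
    "\<And>x y. ((\<lambda>t. f (x,t)) has_real_derivative dx2 f (x,y)) (at y)"
    "\<And>y. continuous_on UNIV (\<lambda>x. dx1 f (x,y))" "\<And>x. continuous_on UNIV (\<lambda>y. dx2 f (x,y))"
proof -
  obtain K where K: "compact K" "K \<subseteq> \<Omega>" "\<And>x. x \<notin> K \<Longrightarrow> f x = 0" using assms by (rule test_funE) blast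
  note z = dx_zero_outside[where f=f, OF compact_imp_closed[OF K(1)] K(3)]
  obtain R where R: "R > 0" "\<And>x. x \<in> K \<Longrightarrow> norm x < R"
    using compact_imp_bounded[OF K(1)] bounded_pos_less by metis
  have b: "(x,y) \<notin> K" if "\<bar>x\<bar> \<ge> R \<or> \<bar>y\<bar> \<ge> R" for x y
  proof
    assume "(x,y) \<in> K"
    then have "norm (x,y) < R" using R by blast
    moreover have "\<bar>x\<bar> \<le> norm (x,y)" "\<bar>y\<bar> \<le> norm (x,y)"
      using norm_fst_le[of x y] norm_snd_le[of y x] by auto
    ultimately show False using that by linarith
  qed
  have s: "smoothOn UNIV f" using test_fun_smooth[OF assms] .
  show ?thesis
  proof (rule that)
    show "R > 0" by fact
    show "f (x,y) = 0 \<and> dx1 f (x,y) = 0 \<and> dx2 f (x,y) = 0" if "\<bar>x\<bar> \<ge> R \<or> \<bar>y\<bar> \<ge> R" for x y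
      using K(3)[OF b[OF that]] z[OF _ b[OF that]] by simp
    show "((\<lambda>t. f (t,y)) has_real_derivative dx1 f (x,y)) (at x)"
      "((\<lambda>t. f (x,t)) has_real_derivative dx2 f (x,y)) (at y)" for x y
      by (rule pd_slice[OF smoothOn_pd[OF s UNIV_I]])+
    show "continuous_on UNIV (\<lambda>x. dx1 f (x,y))" for y
      by (rule continuous_on_compose2[OF smoothOn_continuous[OF smoothOn_dx(1)[OF s]]])
        (auto intro!: continuous_intros)
    show "continuous_on UNIV (\<lambda>y. dx2 f (x,y))" for x
      by (rule continuous_on_compose2[OF smoothOn_continuous[OF smoothOn_dx(2)[OF s]]])
        (auto intro!: continuous_intros)
  qed
qed

text \<open>Fubini, and the fundamental theorem on lines that leave the support. All integration by
  parts below rests on this, so the boundary of the pipe never enters.\<close>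

lemma integral_dx:
  assumes "test_fun \<Omega> f"
  shows "(\<integral>x. dx1 f x \<partial>lborel) = 0" "(\<integral>x. dx2 f x \<partial>lborel) = 0"
proof -
  obtain R where R: "R > 0" "\<And>x y. \<bar>x\<bar> \<ge> R \<or> \<bar>y\<bar> \<ge> R \<Longrightarrow> f (x,y) = 0 \<and> dx1 f (x,y) = 0 \<and> dx2 f (x,y) = 0"
    "\<And>x y. ((\<lambda>t. f (t,y)) has_real_derivative dx1 f (x,y)) (at x)"
    "\<And>x y. ((\<lambda>t. f (x,t)) has_real_derivative dx2 f (x,y)) (at y)"
    "\<And>y. continuous_on UNIV (\<lambda>x. dx1 f (x,y))" "\<And>x. continuous_on UNIV (\<lambda>y. dx2 f (x,y))"
    using assms by (rule test_fun_slices) blast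
  have i: "integrable (lborel \<Otimes>\<^sub>M lborel) (dx1 f)" "integrable (lborel \<Otimes>\<^sub>M lborel) (dx2 f)"
    using test_fun_dx[OF assms] integrable_test by (auto simp: lborel_prod)
  have "(\<integral>y. (\<integral>x. dx1 f (x,y) \<partial>lborel) \<partial>lborel) = integral\<^sup>L (lborel \<Otimes>\<^sub>M lborel) (dx1 f)"
    using lborel_pair.integral_snd[of "\<lambda>x y. dx1 f (x,y)"] i(1) by simp
  moreover have "(\<integral>x. dx1 f (x,y) \<partial>lborel) = 0" for y
    by (rule integral_deriv_compact[of "\<lambda>t. f (t,y)" _ R]) (use R in auto)
  ultimately show "(\<integral>x. dx1 f x \<partial>lborel) = 0" by (simp add: lborel_prod)
  have "(\<integral>x. (\<integral>y. dx2 f (x,y) \<partial>lborel) \<partial>lborel) = integral\<^sup>L (lborel \<Otimes>\<^sub>M lborel) (dx2 f)"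
    using lborel_pair.integral_fst'[of "dx2 f"] i(2) by simp
  moreover have "(\<integral>y. dx2 f (x,y) \<partial>lborel) = 0" for x
    by (rule integral_deriv_compact[of "\<lambda>t. f (x,t)" _ R]) (use R in auto)
  ultimately show "(\<integral>x. dx2 f x \<partial>lborel) = 0" by (simp add: lborel_prod)
qed

definition lap :: "(pt \<Rightarrow> real) \<Rightarrow> pt \<Rightarrow> real" where
  "lap f x = dx1 (dx1 f) x + dx2 (dx2 f) x"

definition dotg :: "(pt \<Rightarrow> real) \<Rightarrow> (pt \<Rightarrow> real) \<Rightarrow> pt \<Rightarrow> real" where
  "dotg f g x = dx1 f x * dx1 g x + dx2 f x * dx2 g x"

lemma norm_grad_sq: "(norm (grad f x))\<^sup>2 = dotg f f x"
  by (simp add: grad_def dotg_def norm_Pair power2_eq_square)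

lemma smoothOn_lap: "open U \<Longrightarrow> smoothOn U f \<Longrightarrow> smoothOn U (lap f)"
  using smoothOn_add[of U "dx1 (dx1 f)" "dx2 (dx2 f)"] smoothOn_dx[of U] by (simp add: lap_def[abs_def])

lemma integrable_dotg: "test_fun \<Omega> f \<Longrightarrow> test_fun \<Omega>' g \<Longrightarrow> integrable lborel (dotg f g)"
  unfolding dotg_def[abs_def] using integrable_test_prod test_fun_dx by (intro Bochner_Integration.integrable_add) blast+

text \<open>Compact support is asked of \<open>u\<close> alone. The other factor may be non-zero
  across the boundary of the pipe, as the bump over an opening is.\<close>

lemma green:
  assumes "test_fun \<Omega> u" "smoothOn UNIV h"
  shows "integrable lborel (dotg u h)" "integrable lborel (\<lambda>x. u x * lap h x)"
    "(\<integral>x. dotg u h x \<partial>lborel) = - (\<integral>x. u x * lap h x \<partial>lborel)"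
proof -
  note sh = smoothOn_dx[OF assms(2)]
  note u = test_fun_dx[OF assms(1)] and s = test_fun_smooth[OF assms(1)]
  have t: "test_fun \<Omega> (\<lambda>x. u x * dx1 h x)" "test_fun \<Omega> (\<lambda>x. u x * dx2 h x)"
    using test_fun_mult assms sh by auto
  have e: "dx1 (\<lambda>x. u x * dx1 h x) x = dx1 u x * dx1 h x + u x * dx1 (dx1 h) x"
     "dx2 (\<lambda>x. u x * dx2 h x) x = dx2 u x * dx2 h x + u x * dx2 (dx2 h) x" for x
    using pdD(1)[OF pd_mult[OF smoothOn_pd[OF s UNIV_I] smoothOn_pd[OF sh(1) UNIV_I]]]
      pdD(2)[OF pd_mult[OF smoothOn_pd[OF s UNIV_I] smoothOn_pd[OF sh(2) UNIV_I]]] by auto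
  have i: "integrable lborel (\<lambda>x. dx1 u x * dx1 h x)" "integrable lborel (\<lambda>x. dx2 u x * dx2 h x)"
    "integrable lborel (\<lambda>x. u x * dx1 (dx1 h) x)" "integrable lborel (\<lambda>x. u x * dx2 (dx2 h) x)"
    using integrable_test test_fun_mult u assms(1) sh smoothOn_dx by blast+
  show "integrable lborel (dotg u h)" using i by (simp add: dotg_def[abs_def])
  show "integrable lborel (\<lambda>x. u x * lap h x)" using i by (simp add: lap_def distrib_left)
  show "(\<integral>x. dotg u h x \<partial>lborel) = - (\<integral>x. u x * lap h x \<partial>lborel)"
    using integral_dx(1)[OF t(1)] integral_dx(2)[OF t(2)] i by (simp add: e dotg_def lap_def distrib_left)
qed

subsection \<open>Ladyzhenskaya's inequality\<close>

text \<open>The square of \<open>g\<close> is the integral of 2 g g' from the left, and AM-GM bounds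
  the integrand. The non-negative integral avoids integrability questions on slices.\<close>

lemma sq_le_nn_integral:
  fixes g g' :: "real \<Rightarrow> real"
  assumes "\<And>t. (g has_real_derivative g' t) (at t)" "continuous_on UNIV g'" "\<And>t. \<bar>t\<bar> \<ge> R \<Longrightarrow> g t = 0" "R > 0"
  shows "ennreal ((g s)\<^sup>2) \<le> (\<integral>\<^sup>+t. ennreal ((g t)\<^sup>2 + (g' t)\<^sup>2) \<partial>lborel)"
proof (cases "\<bar>s\<bar> \<ge> R")
  case True then show ?thesis using assms(3) by simp
next
  case False
  have cg: "continuous_on UNIV g"
    using assms(1) by (meson DERIV_isCont continuous_at_imp_continuous_on)
  have d: "((\<lambda>t. (g t)\<^sup>2) has_real_derivative 2 * g t * g' t) (at t)" for t
    using DERIV_power[OF assms(1)[of t], of 2] by (simp add: mult.assoc mult.left_commute mult.commute)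
  have c: "isCont (\<lambda>t. 2 * g t * g' t) t" for t
    using cg assms(2) by (auto simp: continuous_on_eq_continuous_at intro!: continuous_intros)
  have "(\<integral>t. (2 * g t * g' t) * indicator {-R..s} t \<partial>lborel) = (g s)\<^sup>2 - (g (-R))\<^sup>2"
    "integrable lborel (\<lambda>t. (2 * g t * g' t) * indicator {-R..s} t)"
    using has_bochner_integral_FTC_Icc_real[of "-R" s "\<lambda>t. (g t)\<^sup>2" "\<lambda>t. 2 * g t * g' t", OF _ d c] False
    by (auto simp: has_bochner_integral_iff)
  moreover have "g (-R) = 0" using assms(3,4) by simp
  ultimately have "ennreal ((g s)\<^sup>2) = ennreal (\<integral>t. (2 * g t * g' t) * indicator {-R..s} t \<partial>lborel)" by simp
  also have "\<dots> \<le> ennreal (norm (\<integral>t. (2 * g t * g' t) * indicator {-R..s} t \<partial>lborel))"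
    by (rule ennreal_leI) simp
  also have "\<dots> \<le> (\<integral>\<^sup>+t. ennreal (norm ((2 * g t * g' t) * indicator {-R..s} t)) \<partial>lborel)"
    by (rule integral_norm_bound_ennreal) fact
  also have "\<dots> \<le> (\<integral>\<^sup>+t. ennreal ((g t)\<^sup>2 + (g' t)\<^sup>2) \<partial>lborel)"
  proof (intro nn_integral_mono ennreal_leI)
    fix t
    have "\<bar>2 * g t * g' t\<bar> \<le> (g t)\<^sup>2 + (g' t)\<^sup>2"
      using sum_squares_bound[of "g t" "g' t"] sum_squares_bound[of "- g t" "g' t"] by (simp add: abs_if)
    then show "norm ((2 * g t * g' t) * indicator {-R..s} t) \<le> (g t)\<^sup>2 + (g' t)\<^sup>2"
      by (auto simp: indicator_def)
  qed
  finally show ?thesis .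
qed

text \<open>At (x, y) the square of \<open>u\<close> is bounded by a line integral in either
  direction, and the product of the two bounds separates the variables. The L^4 bound is what keeps
  mass from concentrating on small sets and what converts L^2 mass into L^1 mass.\<close>

lemma ladyzhenskaya:
  assumes "test_fun \<Omega> u"
  shows "(\<integral>x. (u x)^4 \<partial>lborel) \<le> (\<integral>x. (u x)\<^sup>2 + dotg u u x \<partial>lborel)\<^sup>2"
proof -
  obtain R where R: "R > 0" "\<And>x y. \<bar>x\<bar> \<ge> R \<or> \<bar>y\<bar> \<ge> R \<Longrightarrow> u (x,y) = 0 \<and> dx1 u (x,y) = 0 \<and> dx2 u (x,y) = 0"
    "\<And>x y. ((\<lambda>t. u (t,y)) has_real_derivative dx1 u (x,y)) (at x)"
    "\<And>x y. ((\<lambda>t. u (x,t)) has_real_derivative dx2 u (x,y)) (at y)"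
    "\<And>y. continuous_on UNIV (\<lambda>x. dx1 u (x,y))" "\<And>x. continuous_on UNIV (\<lambda>y. dx2 u (x,y))"
    using assms by (rule test_fun_slices) blast
  let ?I = "\<integral>x. (u x)\<^sup>2 + dotg u u x \<partial>lborel"
  have iI: "integrable lborel (\<lambda>x. (u x)\<^sup>2 + dotg u u x)"
    using integrable_test_sq[OF assms] integrable_dotg[OF assms assms] by simp
  have [measurable]: "u \<in> borel_measurable borel" "dx1 u \<in> borel_measurable borel" "dx2 u \<in> borel_measurable borel"
    using test_fun_borel assms test_fun_dx by blast+
  have nn: "0 \<le> (u x)\<^sup>2 + dotg u u x" for x by (simp add: dotg_def)
  define A where "A y = (\<integral>\<^sup>+x. ennreal ((u (x,y))\<^sup>2 + (dx1 u (x,y))\<^sup>2) \<partial>lborel)" for y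
  define B where "B x = (\<integral>\<^sup>+y. ennreal ((u (x,y))\<^sup>2 + (dx2 u (x,y))\<^sup>2) \<partial>lborel)" for x
  have pm: "(\<lambda>p. ennreal ((u p)\<^sup>2 + (dx1 u p)\<^sup>2)) \<in> borel_measurable (lborel \<Otimes>\<^sub>M lborel)"
     "(\<lambda>p. ennreal ((u p)\<^sup>2 + (dx2 u p)\<^sup>2)) \<in> borel_measurable (lborel \<Otimes>\<^sub>M lborel)"
    by (simp_all add: lborel_prod)
  have [measurable]: "A \<in> borel_measurable borel" "B \<in> borel_measurable borel"
    unfolding A_def B_def
    using lborel.borel_measurable_nn_integral_fst[OF measurable_pair_swap[OF pm(1)]] lborel.borel_measurable_nn_integral_fst[OF pm(2)]
    by simp_all
  have A: "(\<integral>\<^sup>+y. A y \<partial>lborel) \<le> ennreal ?I"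
  proof -
    have "(\<integral>\<^sup>+y. A y \<partial>lborel) = (\<integral>\<^sup>+p. ennreal ((u p)\<^sup>2 + (dx1 u p)\<^sup>2) \<partial>lborel)"
      unfolding A_def using lborel_pair.nn_integral_snd[OF pm(1)] by (simp add: lborel_prod)
    also have "\<dots> \<le> (\<integral>\<^sup>+x. ennreal ((u x)\<^sup>2 + dotg u u x) \<partial>lborel)"
      by (intro nn_integral_mono ennreal_leI) (simp add: dotg_def power2_eq_square)
    also have "\<dots> = ennreal ?I" by (rule nn_integral_eq_integral[OF iI]) (simp add: nn)
    finally show ?thesis .
  qed
  have B: "(\<integral>\<^sup>+x. B x \<partial>lborel) \<le> ennreal ?I"
  proof -
    have "(\<integral>\<^sup>+x. B x \<partial>lborel) = (\<integral>\<^sup>+p. ennreal ((u p)\<^sup>2 + (dx2 u p)\<^sup>2) \<partial>lborel)"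
      unfolding B_def using lborel.nn_integral_fst[OF pm(2)] by (simp add: lborel_prod)
    also have "\<dots> \<le> (\<integral>\<^sup>+x. ennreal ((u x)\<^sup>2 + dotg u u x) \<partial>lborel)"
      by (intro nn_integral_mono ennreal_leI) (simp add: dotg_def power2_eq_square)
    also have "\<dots> = ennreal ?I" by (rule nn_integral_eq_integral[OF iI]) (simp add: nn)
    finally show ?thesis .
  qed
  have i4: "integrable lborel (\<lambda>x. (u x)^4)"
    using integrable_test_sq[OF test_fun_mult[OF assms test_fun_smooth[OF assms]]]
    by (simp add: power2_eq_square power4_eq_xxxx mult.assoc)
  have "ennreal (\<integral>x. (u x)^4 \<partial>lborel) = (\<integral>\<^sup>+x. ennreal ((u x)^4) \<partial>lborel)"
    by (rule nn_integral_eq_integral[symmetric, OF i4]) simp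
  also have "\<dots> = (\<integral>\<^sup>+x. (\<integral>\<^sup>+y. ennreal ((u (x,y))^4) \<partial>lborel) \<partial>lborel)"
    using lborel.nn_integral_fst[of "\<lambda>x. ennreal ((u x)^4)" lborel] by (simp add: lborel_prod)
  also have "\<dots> \<le> (\<integral>\<^sup>+x. (\<integral>\<^sup>+y. B x * A y \<partial>lborel) \<partial>lborel)"
  proof (intro nn_integral_mono)
    fix x y
    have "ennreal ((u (x,y))\<^sup>2) \<le> A y"
      unfolding A_def by (rule sq_le_nn_integral[where R=R and g="\<lambda>t. u (t,y)" and s=x]) (use R in auto)
    moreover have "ennreal ((u (x,y))\<^sup>2) \<le> B x"
      unfolding B_def by (rule sq_le_nn_integral[where R=R and g="\<lambda>t. u (x,t)" and s=y]) (use R in auto)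
    ultimately have "ennreal ((u (x,y))\<^sup>2) * ennreal ((u (x,y))\<^sup>2) \<le> B x * A y"
      by (intro mult_mono) auto
    then show "ennreal ((u (x,y))^4) \<le> B x * A y"
      by (simp add: ennreal_mult[symmetric] power4_eq_xxxx power2_eq_square mult.assoc)
  qed
  also have "\<dots> = (\<integral>\<^sup>+x. B x \<partial>lborel) * (\<integral>\<^sup>+y. A y \<partial>lborel)"
    by (simp add: nn_integral_cmult nn_integral_multc)
  also have "\<dots> \<le> ennreal ?I * ennreal ?I" using A B by (intro mult_mono) auto
  also have "\<dots> = ennreal (?I\<^sup>2)" using integral_nonneg_AE[of "\<lambda>x. (u x)\<^sup>2 + dotg u u x" lborel] nn
    by (simp add: ennreal_mult power2_eq_square)
  finally show ?thesis by (subst (asm) ennreal_le_iff) auto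
qed

subsection \<open>Radial bumps\<close>

lemma pd_comp_on:
  assumes "open U" "x \<in> U" "smoothOn U f" "\<And>y. y \<in> U \<Longrightarrow> (F has_real_derivative F1 (f y)) (at (f y))"
  shows "dx1 (\<lambda>x. F (f x)) x = F1 (f x) * dx1 f x" "dx2 (\<lambda>x. F (f x)) x = F1 (f x) * dx2 f x"
  using pdD(1,2)[OF pd_comp[OF assms(4)[OF assms(2)] smoothOn_pd[OF assms(3,2)]]] .

lemma lap_comp_on:
  assumes "open U" "x \<in> U" "smoothOn U f" "\<And>y. y \<in> U \<Longrightarrow> (F has_real_derivative F1 (f y)) (at (f y))"
    "(F1 has_real_derivative F2) (at (f x))"
  shows "lap (\<lambda>x. F (f x)) x = F2 * dotg f f x + F1 (f x) * lap f x"
proof -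
  note d = smoothOn_dx[OF assms(3)]
  have p1: "pd (\<lambda>x. F1 (f x)) (F2 * dx1 f x) (F2 * dx2 f x) x"
    by (rule pd_comp[OF assms(5) smoothOn_pd[OF assms(3,2)]])
  have "pd (dx1 (\<lambda>x. F (f x))) (F2 * dx1 f x * dx1 f x + F1 (f x) * dx1 (dx1 f) x)
       (F2 * dx2 f x * dx1 f x + F1 (f x) * dx2 (dx1 f) x) x"
    by (rule pd_cong[OF assms(1,2) _ pd_mult[OF p1 smoothOn_pd[OF d(1) assms(2)]]])
       (rule pd_comp_on(1)[OF assms(1) _ assms(3,4), symmetric])
  moreover have "pd (dx2 (\<lambda>x. F (f x))) (F2 * dx1 f x * dx2 f x + F1 (f x) * dx1 (dx2 f) x)
       (F2 * dx2 f x * dx2 f x + F1 (f x) * dx2 (dx2 f) x) x"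
    by (rule pd_cong[OF assms(1,2) _ pd_mult[OF p1 smoothOn_pd[OF d(2) assms(2)]]])
       (rule pd_comp_on(2)[OF assms(1) _ assms(3,4), symmetric])
  ultimately show ?thesis
    unfolding lap_def dotg_def by (simp add: pdD(1,2) algebra_simps)
qed

text \<open>The squared distance is a polynomial, so smooth functions of it are smooth at the centre
  as well, and its Laplacian is constant.\<close>

definition dsq :: "pt \<Rightarrow> pt \<Rightarrow> real" where
  "dsq c x = (fst x - fst c)\<^sup>2 + (snd x - snd c)\<^sup>2"

lemma dsq_dist: "dsq c x = (dist c x)\<^sup>2"
  by (simp add: dsq_def dist_prod_def dist_real_def power2_commute)

lemma dsq_nonneg: "dsq c x \<ge> 0" by (simp add: dsq_def)

lemma pd_coord:
  "pd (\<lambda>x. fst x - a) 1 0 x" "pd (\<lambda>x. snd x - a) 0 1 x"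
  using pd_add[OF pd_fst pd_const[of "-a"]] pd_add[OF pd_snd pd_const[of "-a"]] by simp_all

lemma pd_affine:
  assumes "pd f a b x" shows "pd (\<lambda>x. r + s * f x) (s * a) (s * b) x"
  using pd_add[OF pd_const[of r] pd_mult[OF pd_const[of s] assms]] by simp

lemma pd_dsq: "pd (dsq c) (2 * (fst x - fst c)) (2 * (snd x - snd c)) x"
  unfolding dsq_def[abs_def] power2_eq_square
  by (rule pd_eq[OF pd_add[OF pd_mult[OF pd_coord(1) pd_coord(1)] pd_mult[OF pd_coord(2) pd_coord(2)]]]) auto

lemma smoothOn_coord: "open U \<Longrightarrow> smoothOn U (\<lambda>x. fst x - a)" "open U \<Longrightarrow> smoothOn U (\<lambda>x. snd x - a)"
  by (intro smoothOn_diff smoothOn_fst smoothOn_snd smoothOn_const; simp)+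

lemma smoothOn_dsq: "open U \<Longrightarrow> smoothOn U (dsq c)"
  unfolding dsq_def[abs_def] by (intro smoothOn_add smoothOn_power smoothOn_coord)

lemma dx_dsq: "dx1 (dsq c) = (\<lambda>x. 2 * (fst x - fst c))" "dx2 (dsq c) = (\<lambda>x. 2 * (snd x - snd c))"
  by (rule ext, rule pdD[OF pd_dsq])+

lemma lap_dsq: "lap (dsq c) x = 4"
  unfolding lap_def dx_dsq
  using pdD(1)[OF pd_affine[OF pd_coord(1), of 0 2]] pdD(2)[OF pd_affine[OF pd_coord(2), of 0 2]] by simp

lemma dotg_dsq: "dotg (dsq c) (dsq c) x = 4 * dsq c x"
  unfolding dotg_def dx_dsq dsq_def by (simp add: power2_eq_square algebra_simps)

text \<open>\<open>A\<close> is the squared radius of the support. A large \<open>b\<close> keeps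
  the argument of \<open>ee\<close> small on the whole disc, where exp (-1/t) is so convex that the
  bump is subharmonic except near its centre.\<close>

definition bump :: "pt \<Rightarrow> real \<Rightarrow> real \<Rightarrow> pt \<Rightarrow> real" where
  "bump c A b x = ee ((A - dsq c x) / b)"

lemma smooth_bump: "smoothOn UNIV (bump c A b)"
  unfolding bump_def[abs_def]
  by (intro smoothOn_ee open_UNIV) (use smoothOn_mult[OF open_UNIV smoothOn_diff[OF open_UNIV smoothOn_const smoothOn_dsq] smoothOn_const, of A c "1/b"] in simp)

lemma bump_nonneg: "bump c A b x \<ge> 0" by (simp add: bump_def ee_nonneg)

lemma bump_0: "b > 0 \<Longrightarrow> dsq c x \<ge> A \<Longrightarrow> bump c A b x = 0"
  by (simp add: bump_def ee_0 divide_nonpos_pos)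

lemma bump_pos: "b > 0 \<Longrightarrow> dsq c x < A \<Longrightarrow> bump c A b x > 0"
  by (simp add: bump_def ee_pos)

lemma test_bump:
  assumes "b > 0" "R > 0" "cball c R \<subseteq> \<Omega>"
  shows "test_fun \<Omega> (bump c (R\<^sup>2) b)"
proof (rule test_funI[OF smooth_bump compact_cball assms(3)])
  fix x assume "x \<notin> cball c R"
  then have "R\<^sup>2 \<le> dsq c x" unfolding dsq_dist using assms(2) by (intro power_mono) auto
  then show "bump c (R\<^sup>2) b x = 0" by (rule bump_0[OF assms(1)])
qed

lemma dx_bump:
  assumes "b > 0"
  shows "dx1 (bump c A b) x = - ee1 ((A - dsq c x) / b) * 2 * (fst x - fst c) / b"
  "dx2 (bump c A b) x = - ee1 ((A - dsq c x) / b) * 2 * (snd x - snd c) / b"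
proof -
  have d: "((\<lambda>s. ee ((A - s) / b)) has_real_derivative - ee1 ((A - s) / b) / b) (at s)" for s
    by (rule DERIV_chain2[OF ee_deriv, THEN DERIV_cong]) (use assms in \<open>auto intro!: derivative_eq_intros\<close>)
  show "dx1 (bump c A b) x = - ee1 ((A - dsq c x) / b) * 2 * (fst x - fst c) / b"
   "dx2 (bump c A b) x = - ee1 ((A - dsq c x) / b) * 2 * (snd x - snd c) / b"
    using pdD(1,2)[OF pd_comp[OF d pd_dsq]] unfolding bump_def[abs_def] by auto
qed

text \<open>All positive factors are pulled out: the sign of the Laplacian is that of the last
  bracket.\<close>

lemma lap_bump:
  assumes "b > 0"
  shows "lap (bump c A b) x = (let t = (A - dsq c x) / b in
     (if t \<le> 0 then 0 else exp (-1/t) * (4 / (b * t^4)) * ((dsq c x / b) * (1 - 2 * t) - t\<^sup>2)))"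
proof -
  define t where "t = (A - dsq c x) / b"
  have d: "((\<lambda>s. ee ((A - s) / b)) has_real_derivative - ee1 ((A - s) / b) / b) (at s)" for s
    by (rule DERIV_chain2[OF ee_deriv, THEN DERIV_cong]) (use assms in \<open>auto intro!: derivative_eq_intros\<close>)
  have d2: "((\<lambda>s. - ee1 ((A - s) / b) / b) has_real_derivative ee2 ((A - s) / b) / b\<^sup>2) (at s)" for s
  proof -
    have "((\<lambda>s. ee1 ((A - s) / b)) has_real_derivative ee2 ((A - s) / b) * (-1 / b)) (at s)"
      by (rule DERIV_chain2[OF ee1_deriv]) (use assms in \<open>auto intro!: derivative_eq_intros\<close>)
    from DERIV_cmult[OF this, of "-1/b"] show ?thesis
      by (simp add: power2_eq_square)
  qed
  have "lap (bump c A b) x = ee2 t / b\<^sup>2 * (4 * dsq c x) - ee1 t / b * 4"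
    unfolding bump_def[abs_def] t_def
    by (subst lap_comp_on[OF open_UNIV UNIV_I smoothOn_dsq[OF open_UNIV] d d2]) (simp add: dotg_dsq lap_dsq)
  also have "\<dots> = (if t \<le> 0 then 0 else exp (-1/t) * (4 / (b * t^4)) * ((dsq c x / b) * (1 - 2 * t) - t\<^sup>2))"
  proof (cases "t \<le> 0")
    case False
    then show ?thesis using assms
      by (simp add: ee1_def ee2_def field_simps power2_eq_square power4_eq_xxxx)
  qed (simp add: ee1_def ee2_def)
  finally show ?thesis by (simp add: t_def Let_def)
qed

subsection \<open>The Rayleigh quotient\<close>

definition nsq :: "(pt \<Rightarrow> real) \<Rightarrow> real" where "nsq u = (\<integral>x. (u x)\<^sup>2 \<partial>lborel)"
definition dir :: "(pt \<Rightarrow> real) \<Rightarrow> real" where "dir u = (\<integral>x. dotg u u x \<partial>lborel)"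

lemma nsq_nonneg: "nsq u \<ge> 0" and dir_nonneg: "dir u \<ge> 0"
  unfolding nsq_def dir_def by (auto intro!: integral_nonneg_AE simp: dotg_def)

lemma dotg_cmult:
  assumes "smoothOn UNIV u" shows "dotg (\<lambda>x. c * u x) (\<lambda>x. c * u x) x = c\<^sup>2 * dotg u u x"
proof -
  have "dx1 (\<lambda>x. c * u x) x = c * dx1 u x" "dx2 (\<lambda>x. c * u x) x = c * dx2 u x"
    using pdD(1,2)[OF pd_affine[OF smoothOn_pd[OF assms UNIV_I], of 0 c]] by auto
  then show ?thesis by (simp add: dotg_def power2_eq_square algebra_simps)
qed

lemma dir_cmult: "test_fun \<Omega> u \<Longrightarrow> dir (\<lambda>x. c * u x) = c\<^sup>2 * dir u"
  by (simp add: dir_def dotg_cmult[OF test_fun_smooth])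

lemma nsq_cmult: "nsq (\<lambda>x. c * u x) = c\<^sup>2 * nsq u"
  by (simp add: nsq_def power_mult_distrib)

lemma integral_lebesgue_lborel:
  fixes f :: "pt \<Rightarrow> real"
  assumes "f \<in> borel_measurable borel"
  shows "integral\<^sup>L lebesgue f = integral\<^sup>L lborel f" "integrable lebesgue f \<longleftrightarrow> integrable lborel f"
  using assms by (simp_all add: integral_completion integrable_completion)

lemma W120_test:
  assumes "test_fun \<Omega> u"
  shows "W120 \<Omega> u (grad u)"
    "integral\<^sup>L lebesgue (\<lambda>x. (norm (grad u x))\<^sup>2) = dir u" "integral\<^sup>L lebesgue (\<lambda>x. (u x)\<^sup>2) = nsq u"
proof -
  have [measurable]: "u \<in> borel_measurable borel" "dx1 u \<in> borel_measurable borel" "dx2 u \<in> borel_measurable borel"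
    using test_fun_borel assms test_fun_dx by blast+
  have g[measurable]: "grad u \<in> borel_measurable borel"
    unfolding grad_def[abs_def] by measurable
  have m: "u \<in> borel_measurable lebesgue" "grad u \<in> borel_measurable lebesgue"
    using measurable_completion[of u lborel borel] measurable_completion[of "grad u" lborel borel] by simp_all
  have "dotg u u \<in> borel_measurable borel" unfolding dotg_def[abs_def] by measurable
  then show 1: "integral\<^sup>L lebesgue (\<lambda>x. (norm (grad u x))\<^sup>2) = dir u"
    and 2: "integral\<^sup>L lebesgue (\<lambda>x. (u x)\<^sup>2) = nsq u"
    by (simp_all add: norm_grad_sq integral_lebesgue_lborel dir_def nsq_def)
  have "integrable lebesgue (\<lambda>x. (u x)\<^sup>2)" "integrable lebesgue (\<lambda>x. (norm (grad u x))\<^sup>2)"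
    using integrable_test_sq[OF assms] integrable_dotg[OF assms assms] \<open>dotg u u \<in> _\<close>
    by (simp_all add: norm_grad_sq integral_lebesgue_lborel)
  then show "W120 \<Omega> u (grad u)" unfolding W120_def using m assms by (auto intro!: exI[of _ "\<lambda>k. u"])
qed

lemma lambda1_le:
  assumes "test_fun \<Omega> u"
  shows "lambda1 \<Omega> * nsq u \<le> dir u"
proof (cases "nsq u = 0")
  case False
  then have pos: "nsq u > 0" using nsq_nonneg[of u] by simp
  define c where "c = 1 / sqrt (nsq u)"
  have c: "c\<^sup>2 = 1 / nsq u" using pos by (simp add: c_def power_divide)
  let ?v = "\<lambda>x. c * u x"
  have t: "test_fun \<Omega> ?v" by (rule test_fun_cmult[OF assms])
  have "lambda1 \<Omega> \<le> dir ?v"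
    unfolding lambda1_def
  proof (rule cInf_lower)
    show "dir ?v \<in> {integral\<^sup>L lebesgue (\<lambda>x. (norm (g x))\<^sup>2) |u g. W120 \<Omega> u g \<and> integral\<^sup>L lebesgue (\<lambda>x. (u x)\<^sup>2) = 1}"
      using W120_test[OF t] pos by (intro CollectI exI[of _ ?v] exI[of _ "grad ?v"]) (simp add: nsq_cmult c)
    show "bdd_below {integral\<^sup>L lebesgue (\<lambda>x. (norm (g x))\<^sup>2) |u g. W120 \<Omega> u g \<and> integral\<^sup>L lebesgue (\<lambda>x. (u x)\<^sup>2) = 1}"
      by (rule bdd_belowI[of _ 0]) auto
  qed
  also have "\<dots> = dir u / nsq u" by (simp add: dir_cmult[OF assms] c)
  finally show ?thesis using pos by (simp add: pos_le_divide_eq)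
qed (simp add: dir_nonneg)

text \<open>Young's inequality with a free parameter \<theta> replaces the triangle inequality in
  L^2: first \<theta> makes the fixed term small, then a large \<open>k\<close> the other
  one.\<close>

lemma L2_tendsto:
  fixes f :: "nat \<Rightarrow> 'a \<Rightarrow> 'b::euclidean_space"
  assumes [measurable]: "\<And>k. f k \<in> borel_measurable M" "g \<in> borel_measurable M"
    and i: "\<And>k. integrable M (\<lambda>x. (norm (f k x))\<^sup>2)" "integrable M (\<lambda>x. (norm (g x))\<^sup>2)"
    and l: "(\<lambda>k. integral\<^sup>L M (\<lambda>x. (norm (f k x - g x))\<^sup>2)) \<longlonglongrightarrow> 0"
  shows "(\<lambda>k. integral\<^sup>L M (\<lambda>x. (norm (f k x))\<^sup>2)) \<longlonglongrightarrow> integral\<^sup>L M (\<lambda>x. (norm (g x))\<^sup>2)"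
proof -
  let ?a = "\<lambda>k. integral\<^sup>L M (\<lambda>x. (norm (f k x))\<^sup>2)" and ?b = "integral\<^sup>L M (\<lambda>x. (norm (g x))\<^sup>2)"
  let ?d = "\<lambda>k. integral\<^sup>L M (\<lambda>x. (norm (f k x - g x))\<^sup>2)"
  have id: "integrable M (\<lambda>x. (norm (f k x - g x))\<^sup>2)" for k
  proof (rule Bochner_Integration.integrable_bound[OF Bochner_Integration.integrable_add[OF integrable_mult_right[OF i(1)] integrable_mult_right[OF i(2)]]])
    show "AE x in M. norm ((norm (f k x - g x))\<^sup>2) \<le> norm (2 * (norm (f k x))\<^sup>2 + 2 * (norm (g x))\<^sup>2)"
    proof (rule AE_I2)
      fix x
      have "(norm (f k x - g x))\<^sup>2 \<le> (norm (f k x) + norm (g x))\<^sup>2"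
        by (intro power_mono norm_triangle_ineq4) simp
      also have "\<dots> \<le> 2 * (norm (f k x))\<^sup>2 + 2 * (norm (g x))\<^sup>2"
        using sum_squares_bound[of "norm (f k x)" "norm (g x)"] by (simp add: power2_sum)
      finally show "norm ((norm (f k x - g x))\<^sup>2) \<le> norm (2 * (norm (f k x))\<^sup>2 + 2 * (norm (g x))\<^sup>2)" by simp
    qed
  qed measurable
  have pw: "\<bar>(norm p)\<^sup>2 - (norm q)\<^sup>2\<bar> \<le> \<theta> * (norm q)\<^sup>2 + (1 + 1/\<theta>) * (norm (p - q))\<^sup>2" if "\<theta> > 0" for p q :: 'b and \<theta> :: real
  proof -
    have "(norm p)\<^sup>2 - (norm q)\<^sup>2 = (norm (p - q))\<^sup>2 + 2 * inner (p - q) q"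
      by (simp add: power2_norm_eq_inner inner_diff_left inner_diff_right inner_commute algebra_simps)
    moreover have "\<bar>2 * inner (p - q) q\<bar> \<le> \<theta> * (norm q)\<^sup>2 + 1/\<theta> * (norm (p - q))\<^sup>2"
    proof -
      have "\<bar>2 * inner (p - q) q\<bar> \<le> 2 * (norm (p - q) * norm q)" using Cauchy_Schwarz_ineq2[of "p - q" q] by simp
      also have "\<dots> \<le> \<theta> * (norm q)\<^sup>2 + 1/\<theta> * (norm (p - q))\<^sup>2"
      proof -
        have "0 \<le> (\<theta> * norm q - norm (p - q))\<^sup>2 / \<theta>" using that by simp
        also have "\<dots> = \<theta> * (norm q)\<^sup>2 + 1/\<theta> * (norm (p - q))\<^sup>2 - 2 * (norm (p - q) * norm q)"
          using that by (simp add: power2_diff field_simps power2_eq_square)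
        finally show ?thesis by simp
      qed
      finally show ?thesis .
    qed
    ultimately show ?thesis by (simp add: algebra_simps abs_le_iff) (smt (verit) zero_le_power2)
  qed
  have est: "\<bar>?a k - ?b\<bar> \<le> \<theta> * ?b + (1 + 1/\<theta>) * ?d k" if "\<theta> > 0" for k \<theta>
  proof -
    have "\<bar>?a k - ?b\<bar> = \<bar>integral\<^sup>L M (\<lambda>x. (norm (f k x))\<^sup>2 - (norm (g x))\<^sup>2)\<bar>" using i by simp
    also have "\<dots> \<le> integral\<^sup>L M (\<lambda>x. \<bar>(norm (f k x))\<^sup>2 - (norm (g x))\<^sup>2\<bar>)"
      using integral_abs_bound by blast
    also have "\<dots> \<le> integral\<^sup>L M (\<lambda>x. \<theta> * (norm (g x))\<^sup>2 + (1 + 1/\<theta>) * (norm (f k x - g x))\<^sup>2)"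
      using i id pw[OF that] by (intro integral_mono) auto
    also have "\<dots> = \<theta> * ?b + (1 + 1/\<theta>) * ?d k" using i id by simp
    finally show ?thesis .
  qed
  show ?thesis
  proof (rule LIMSEQ_I)
    fix r :: real assume r: "r > 0"
    have b: "?b \<ge> 0" by simp
    define \<theta> where "\<theta> = r / (2 * (?b + 1))"
    have t: "\<theta> > 0" "\<theta> * ?b < r / 2" using r b by (auto simp: \<theta>_def field_simps add_pos_nonneg)
    have "r / (2 * (1 + 1/\<theta>)) > 0" using r t by (simp add: add_pos_pos)
    from LIMSEQ_D[OF l this] obtain K where K: "\<And>k. k \<ge> K \<Longrightarrow> ?d k < r / (2 * (1 + 1/\<theta>))" by auto
    have "\<bar>?a k - ?b\<bar> < r" if "k \<ge> K" for k
    proof -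
      have p: "1 + 1/\<theta> > 0" using t by (simp add: add_pos_pos)
      have half: "q * (r / (2 * q)) = r / 2" if "q > 0" for q :: real using that by simp
      have "(1 + 1/\<theta>) * ?d k < (1 + 1/\<theta>) * (r / (2 * (1 + 1/\<theta>)))" using K[OF that] p by (intro mult_strict_left_mono)
      also note half[OF p]
      finally show ?thesis using est[OF t(1), of k] t(2) by linarith
    qed
    then show "\<exists>K. \<forall>k\<ge>K. norm (?a k - ?b) < r" by auto
  qed
qed

text \<open>\<open>W120\<close> is a closure of test functions, so the Rayleigh quotients of an
  approximating sequence converge. The function \<open>w\<close> certifies that the infimum runs
  over a non-empty set; \<open>Inf\<close> of the empty set would be unspecified.\<close>

lemma near_minimiser:
  assumes "test_fun \<Omega> w" "nsq w > 0" "\<eta> > 0"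
  obtains u where "test_fun \<Omega> u" "nsq u = 1" "dir u < lambda1 \<Omega> + \<eta>"
proof -
  let ?S = "{integral\<^sup>L lebesgue (\<lambda>x. (norm (g x))\<^sup>2) |u g. W120 \<Omega> u g \<and> integral\<^sup>L lebesgue (\<lambda>x. (u x)\<^sup>2) = 1}"
  define c where "c = 1 / sqrt (nsq w)"
  have c: "c\<^sup>2 = 1 / nsq w" using assms(2) by (simp add: c_def power_divide)
  have t: "test_fun \<Omega> (\<lambda>x. c * w x)" by (rule test_fun_cmult[OF assms(1)])
  have ne: "?S \<noteq> {}"
    using W120_test[OF t] assms(2) by (auto simp: nsq_cmult c)
  have "Inf ?S < lambda1 \<Omega> + \<eta>" using assms(3) by (simp add: lambda1_def)
  from cInf_lessD[OF ne this] obtain u g where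
    W: "W120 \<Omega> u g" and n1: "integral\<^sup>L lebesgue (\<lambda>x. (u x)\<^sup>2) = 1"
    and lt: "integral\<^sup>L lebesgue (\<lambda>x. (norm (g x))\<^sup>2) < lambda1 \<Omega> + \<eta>" by auto
  from W obtain \<phi> where m: "u \<in> borel_measurable lebesgue" "integrable lebesgue (\<lambda>x. (u x)^2)"
     "g \<in> borel_measurable lebesgue" "integrable lebesgue (\<lambda>x. (norm (g x))^2)" and
    \<phi>: "\<And>k. test_fun \<Omega> (\<phi> k)"
    "(\<lambda>k. integral\<^sup>L lebesgue (\<lambda>x. (\<phi> k x - u x)^2)) \<longlonglongrightarrow> 0"
    "(\<lambda>k. integral\<^sup>L lebesgue (\<lambda>x. (norm (grad (\<phi> k) x - g x))^2)) \<longlonglongrightarrow> 0"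
    unfolding W120_def by blast
  have W': "W120 \<Omega> (\<phi> k) (grad (\<phi> k))" for k by (rule W120_test(1)[OF \<phi>(1)])
  have "(\<lambda>k. integral\<^sup>L lebesgue (\<lambda>x. (norm (\<phi> k x))\<^sup>2)) \<longlonglongrightarrow> integral\<^sup>L lebesgue (\<lambda>x. (norm (u x))\<^sup>2)"
    by (rule L2_tendsto) (use m \<phi> W' in \<open>auto simp: W120_def\<close>)
  then have l1: "(\<lambda>k. nsq (\<phi> k)) \<longlonglongrightarrow> 1" using n1 by (simp add: W120_test(3)[OF \<phi>(1)])
  have "(\<lambda>k. integral\<^sup>L lebesgue (\<lambda>x. (norm (grad (\<phi> k) x))\<^sup>2)) \<longlonglongrightarrow> integral\<^sup>L lebesgue (\<lambda>x. (norm (g x))\<^sup>2)"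
    by (rule L2_tendsto) (use m \<phi> W' in \<open>auto simp: W120_def\<close>)
  then have l2: "(\<lambda>k. dir (\<phi> k)) \<longlonglongrightarrow> integral\<^sup>L lebesgue (\<lambda>x. (norm (g x))\<^sup>2)"
    by (simp add: W120_test(2)[OF \<phi>(1)])
  have "(\<lambda>k. dir (\<phi> k) / nsq (\<phi> k)) \<longlonglongrightarrow> integral\<^sup>L lebesgue (\<lambda>x. (norm (g x))\<^sup>2) / 1"
    by (intro tendsto_divide l1 l2) simp
  then have "\<forall>\<^sub>F k in sequentially. dir (\<phi> k) / nsq (\<phi> k) < lambda1 \<Omega> + \<eta>"
    using lt by (intro order_tendstoD) auto
  moreover have "\<forall>\<^sub>F k in sequentially. nsq (\<phi> k) > 0" by (rule order_tendstoD[OF l1]) simp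
  ultimately have "\<forall>\<^sub>F k in sequentially. dir (\<phi> k) / nsq (\<phi> k) < lambda1 \<Omega> + \<eta> \<and> nsq (\<phi> k) > 0"
    by (rule eventually_conj)
  then obtain k where k: "dir (\<phi> k) / nsq (\<phi> k) < lambda1 \<Omega> + \<eta>" "nsq (\<phi> k) > 0"
    using eventually_happens'[OF sequentially_bot] by blast
  define d where "d = 1 / sqrt (nsq (\<phi> k))"
  have d: "d\<^sup>2 = 1 / nsq (\<phi> k)" using k by (simp add: d_def power_divide)
  show thesis
    by (rule that[of "\<lambda>x. d * \<phi> k x"]) (use k \<phi>(1) in \<open>auto simp: nsq_cmult dir_cmult[OF \<phi>(1)] d test_fun_cmult\<close>)
qed

text \<open>The modulus of \<open>f\<close> is not smooth. Its regularisation sqrt (f^2 +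
  \<delta>^2) - \<delta> is smooth, vanishes where \<open>f\<close> does, has no larger gradient,
  and its square falls short of f^2 by at most 2 \<delta> |f|.\<close>

lemma near_minimiser_nonneg:
  assumes "test_fun \<Omega> w" "nsq w > 0" "\<eta> > 0"
  obtains u where "test_fun \<Omega> u" "\<And>x. u x \<ge> 0" "nsq u = 1" "dir u \<le> lambda1 \<Omega> + \<eta>"
proof -
  obtain f where f: "test_fun \<Omega> f" "nsq f = 1" "dir f < lambda1 \<Omega> + \<eta>"
    using near_minimiser[OF assms] by blast
  define M where "M = (\<integral>x. \<bar>f x\<bar> \<partial>lborel)"
  have M: "M \<ge> 0" by (simp add: M_def)
  have e: "lambda1 \<Omega> + \<eta> > 0" using f(3) dir_nonneg[of f] by linarith
  \<comment> \<open>The loss 2 \<delta> M must fit into the slack between \<open>dir f\<close> and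
    \<open>lambda1 \<Omega> + \<eta>\<close>. The summand 1 covers M = 0 and makes the fit strict,
    which excludes \<open>nsq v = 0\<close> at the end.\<close>
  define \<delta> where "\<delta> = (1 - dir f / (lambda1 \<Omega> + \<eta>)) / (2 * M + 1)"
  have \<delta>: "\<delta> > 0" using f(3) e M by (simp add: \<delta>_def)
  have "\<delta> * (2 * M) \<le> \<delta> * (2 * M + 1)" using \<delta> by simp
  also have "\<dots> = 1 - dir f / (lambda1 \<Omega> + \<eta>)" using M by (simp add: \<delta>_def)
  finally have \<delta>M: "dir f / (lambda1 \<Omega> + \<eta>) \<le> 1 - 2 * \<delta> * M" by simp
  define v where "v x = sqrt ((f x)\<^sup>2 + \<delta>\<^sup>2) - \<delta>" for x
  have sf: "smoothOn UNIV f" by (rule test_fun_smooth[OF f(1)])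
  have pos: "(f x)\<^sup>2 + \<delta>\<^sup>2 > 0" for x using \<delta> by (simp add: add_nonneg_pos)
  obtain K where K: "compact K" "K \<subseteq> \<Omega>" "\<And>x. x \<notin> K \<Longrightarrow> f x = 0" using f(1) by (rule test_funE) blast
  have tv: "test_fun \<Omega> v"
  proof (rule test_funI[OF _ K(1,2)])
    show "smoothOn UNIV v" unfolding v_def[abs_def]
      by (intro smoothOn_diff smoothOn_sqrt smoothOn_add smoothOn_power smoothOn_const open_UNIV sf pos)
    show "v x = 0" if "x \<notin> K" for x using K(3)[OF that] \<delta> by (simp add: v_def)
  qed
  have v0: "v x \<ge> 0" for x using \<delta> real_le_rsqrt[of \<delta> "(f x)\<^sup>2 + \<delta>\<^sup>2"] by (simp add: v_def)
  have vl: "(v x)\<^sup>2 \<ge> (f x)\<^sup>2 - 2 * \<delta> * \<bar>f x\<bar>" for x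
  proof -
    have a: "\<bar>f x\<bar> \<le> sqrt ((f x)\<^sup>2 + \<delta>\<^sup>2)" by (rule real_le_rsqrt) simp
    have "sqrt ((f x)\<^sup>2 + \<delta>\<^sup>2) \<le> sqrt ((\<bar>f x\<bar> + \<delta>)\<^sup>2)" using \<delta> by (intro real_sqrt_le_mono) (simp add: power2_sum)
    also have "\<dots> = \<bar>f x\<bar> + \<delta>" using \<delta> by simp
    finally have b: "sqrt ((f x)\<^sup>2 + \<delta>\<^sup>2) \<le> \<bar>f x\<bar> + \<delta>" .
    have "(v x)\<^sup>2 = (f x)\<^sup>2 + 2 * \<delta>\<^sup>2 - 2 * \<delta> * sqrt ((f x)\<^sup>2 + \<delta>\<^sup>2)"
      using pos[of x] by (simp add: v_def power2_diff algebra_simps)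
    moreover have "2 * \<delta> * sqrt ((f x)\<^sup>2 + \<delta>\<^sup>2) \<le> 2 * \<delta> * (\<bar>f x\<bar> + \<delta>)" using b \<delta> by (intro mult_left_mono) auto
    ultimately show ?thesis by (simp add: power2_eq_square algebra_simps)
  qed
  have iabs: "integrable lborel (\<lambda>x. \<bar>f x\<bar>)" using integrable_test[OF f(1)] by simp
  have nv: "nsq v \<ge> 1 - 2 * \<delta> * M"
  proof -
    have "1 - 2 * \<delta> * M = (\<integral>x. (f x)\<^sup>2 - 2 * \<delta> * \<bar>f x\<bar> \<partial>lborel)"
      using integrable_test_sq[OF f(1)] iabs f(2) by (simp add: M_def nsq_def)
    also have "\<dots> \<le> nsq v" unfolding nsq_def
      using integrable_test_sq[OF f(1)] iabs integrable_test_sq[OF tv] vl by (intro integral_mono) auto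
    finally show ?thesis .
  qed
  have gv: "dotg v v x \<le> dotg f f x" for x
  proof -
    define s where "s = sqrt ((f x)\<^sup>2 + \<delta>\<^sup>2)"
    have s: "s > 0" "(f x / s)\<^sup>2 \<le> 1" using pos[of x] by (auto simp: s_def power_divide)
    have d: "((\<lambda>t. sqrt (t\<^sup>2 + \<delta>\<^sup>2) - \<delta>) has_real_derivative f x / s) (at (f x))"
      using pos[of x] by (auto intro!: derivative_eq_intros simp: s_def field_simps)
    have "dx1 v x = f x / s * dx1 f x" "dx2 v x = f x / s * dx2 f x"
      using pdD(1,2)[OF pd_comp[OF d smoothOn_pd[OF sf UNIV_I]]] unfolding v_def[abs_def] by auto
    then have "dotg v v x = (f x / s)\<^sup>2 * dotg f f x" by (simp add: dotg_def power2_eq_square algebra_simps)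
    also have "\<dots> \<le> 1 * dotg f f x" using s by (intro mult_right_mono) (auto simp: dotg_def)
    finally show ?thesis by simp
  qed
  have dv: "dir v \<le> dir f" unfolding dir_def
    using integrable_dotg[OF tv tv] integrable_dotg[OF f(1) f(1)] gv by (intro integral_mono) auto
  show thesis
  proof (cases "nsq v > 0")
    case True
    define d where "d = 1 / sqrt (nsq v)"
    have d: "d\<^sup>2 = 1 / nsq v" "d \<ge> 0" using True by (auto simp: d_def power_divide)
    have "dir f \<le> (lambda1 \<Omega> + \<eta>) * nsq v"
    proof -
      have "dir f / (lambda1 \<Omega> + \<eta>) \<le> nsq v" using nv \<delta>M by linarith
      then show ?thesis using e by (simp add: pos_divide_le_eq mult.commute)
    qed
    then have "dir v / nsq v \<le> lambda1 \<Omega> + \<eta>" using dv True by (simp add: pos_divide_le_eq)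
    then show thesis
      by (intro that[of "\<lambda>x. d * v x"]) (use True d v0 in \<open>auto simp: nsq_cmult dir_cmult[OF tv] test_fun_cmult[OF tv]\<close>)
  next
    case False
    then have "dir f / (lambda1 \<Omega> + \<eta>) \<le> 0" using nv \<delta>M by linarith
    then have "dir f = 0" using e dir_nonneg[of f] by (simp add: divide_le_0_iff)
    moreover have "1 - 2 * \<delta> * M > 0"
    proof -
      have "\<delta> * (2 * M) < \<delta> * (2 * M + 1)" using \<delta> by simp
      also have "\<dots> = 1" using M \<open>dir f = 0\<close> by (simp add: \<delta>_def)
      finally show ?thesis by simp
    qed
    ultimately show thesis using nv False by simp
  qed
qed

subsection \<open>Hersch's pipe\<close>

lemma mem_H_pipe: "x \<in> H_pipe \<longleftrightarrow> (fst x)\<^sup>2 + (snd x)\<^sup>2 < 1 \<and> fst x < 0 \<or> 0 < \<bar>snd x\<bar> \<and> \<bar>snd x\<bar> < 1 \<and> fst x \<ge> 0"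
  by (cases x) (auto simp: H_pipe_def)

lemma H_pipe_snd: "x \<in> H_pipe \<Longrightarrow> \<bar>snd x\<bar> < 1"
proof -
  assume "x \<in> H_pipe"
  moreover have "\<bar>snd x\<bar> < 1" if "(fst x)\<^sup>2 + (snd x)\<^sup>2 < 1"
  proof -
    have "(snd x)\<^sup>2 < 1" using that zero_le_power2[of "fst x"] by linarith
    then show ?thesis by (simp add: abs_square_less_1)
  qed
  ultimately show ?thesis by (auto simp: mem_H_pipe)
qed

text \<open>The condition x1 >= 0 in the definition hides openness at x1 = 0; the upper and lower
  half discs bridge that line. Each of the five pieces is open and convex and meets the union of the
  preceding ones, which also yields connectedness.\<close>

lemma H_pipe_Un: "H_pipe = {x. (fst x)\<^sup>2 + (snd x)\<^sup>2 < 1 \<and> fst x < 0} \<union>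
   {x. (fst x)\<^sup>2 + (snd x)\<^sup>2 < 1 \<and> 0 < snd x} \<union> {x. (fst x)\<^sup>2 + (snd x)\<^sup>2 < 1 \<and> snd x < 0} \<union>
   {x. 0 < fst x \<and> 0 < snd x \<and> snd x < 1} \<union> {x. 0 < fst x \<and> -1 < snd x \<and> snd x < 0}" (is "_ = ?R")
proof (rule set_eqI)
  fix x :: pt
  have a: "\<bar>snd x\<bar> < 1" if "(fst x)\<^sup>2 + (snd x)\<^sup>2 < 1"
  proof -
    have "(snd x)\<^sup>2 < 1" using that zero_le_power2[of "fst x"] by linarith
    then show ?thesis by (simp add: abs_square_less_1)
  qed
  have b: "(snd x)\<^sup>2 < 1" if "\<bar>snd x\<bar> < 1" using that by (simp add: abs_square_less_1)
  have c: "(fst x)\<^sup>2 + (snd x)\<^sup>2 = (snd x)\<^sup>2" if "fst x = 0" using that by simp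
  show "x \<in> H_pipe \<longleftrightarrow> x \<in> ?R"
    unfolding mem_H_pipe Un_iff mem_Collect_eq using a b c by (smt (verit))
qed

lemma open_H_pipe: "open H_pipe"
  unfolding H_pipe_Un
  by (intro open_Un open_Collect_conj open_Collect_less continuous_intros)

lemma connected_H_pipe: "connected H_pipe"
proof -
  have e: "{x::pt. (fst x)\<^sup>2 + (snd x)\<^sup>2 < 1 \<and> P x} = ball 0 1 \<inter> {x. P x}" for P
    by (auto simp: dist_prod_def dist_norm)
  have hs: "convex {x::pt. fst x < 0}" "convex {x::pt. 0 < fst x}" "convex {x::pt. 0 < snd x}" "convex {x::pt. snd x < 0}"
    "convex {x::pt. snd x < 1}" "convex {x::pt. -1 < snd x}"
    using convex_halfspace_lt[of "(1,0)::pt"] convex_halfspace_gt[of _ "(1,0)::pt"]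
      convex_halfspace_lt[of "(0,1)::pt"] convex_halfspace_gt[of _ "(0,1)::pt"] by (simp_all add: inner_prod_def)
  have g: "connected {x::pt. (fst x)\<^sup>2 + (snd x)\<^sup>2 < 1 \<and> P x}" if "convex {x. P x}" for P
    unfolding e by (intro convex_connected convex_Int convex_ball that)
  note c = g[OF hs(1)] g[OF hs(3)] g[OF hs(4)]
  have "connected ({x::pt. 0 < fst x} \<inter> ({x. 0 < snd x} \<inter> {x. snd x < 1}))"
    "connected ({x::pt. 0 < fst x} \<inter> ({x. -1 < snd x} \<inter> {x. snd x < 0}))"
    by (intro convex_connected convex_Int hs)+
  then have d: "connected {x::pt. 0 < fst x \<and> 0 < snd x \<and> snd x < 1}" "connected {x::pt. 0 < fst x \<and> -1 < snd x \<and> snd x < 0}"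
    by (simp_all add: Collect_conj_eq)
  let ?A = "{x::pt. (fst x)\<^sup>2 + (snd x)\<^sup>2 < 1 \<and> fst x < 0}"
  let ?B = "{x::pt. (fst x)\<^sup>2 + (snd x)\<^sup>2 < 1 \<and> 0 < snd x}" and ?C = "{x::pt. (fst x)\<^sup>2 + (snd x)\<^sup>2 < 1 \<and> snd x < 0}"
  let ?D = "{x::pt. 0 < fst x \<and> 0 < snd x \<and> snd x < 1}" and ?E = "{x::pt. 0 < fst x \<and> -1 < snd x \<and> snd x < 0}"
  have "(-1/2,1/2) \<in> ?A \<inter> ?B" "(-1/2,-1/2) \<in> (?A \<union> ?B) \<inter> ?C"
    "(1/2,1/2) \<in> (?A \<union> ?B \<union> ?C) \<inter> ?D" "(1/2,-1/2) \<in> (?A \<union> ?B \<union> ?C \<union> ?D) \<inter> ?E"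
    by (simp_all add: power2_eq_square)
  then have "?A \<inter> ?B \<noteq> {}" "(?A \<union> ?B) \<inter> ?C \<noteq> {}" "(?A \<union> ?B \<union> ?C) \<inter> ?D \<noteq> {}" "(?A \<union> ?B \<union> ?C \<union> ?D) \<inter> ?E \<noteq> {}"
    by blast+
  then show ?thesis unfolding H_pipe_Un by (intro connected_Un c d)
qed

lemma nsq_pos:
  assumes "test_fun \<Omega> w" "w x0 \<noteq> 0"
  shows "nsq w > 0"
proof -
  have c: "continuous_on UNIV w" by (rule smoothOn_continuous[OF test_fun_smooth[OF assms(1)]])
  have "\<not> (AE x in lborel. (w x)\<^sup>2 = 0)"
  proof
    assume "AE x in lborel. (w x)\<^sup>2 = 0"
    then have ae: "AE x in lborel. w x = 0" by simp
    have o: "open {x. w x \<noteq> 0}" using c by (intro open_Collect_neq continuous_intros) auto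
    obtain r where r: "r > 0" "ball x0 r \<subseteq> {x. w x \<noteq> 0}" using o assms(2) open_contains_ball by blast
    have "AE x in lborel. x \<notin> ball x0 r" using ae r(2) by (auto elim!: eventually_mono)
    then have "emeasure lborel (ball x0 r) = 0"
      using AE_iff_null_sets[of "ball x0 r" lborel] by (auto simp del: mem_ball)
    then show False using emeasure_ball[of r x0] r mult_pos_pos[of "unit_ball_vol 2" "r * r"] by (simp add: not_le[symmetric] unit_ball_vol_2)
  qed
  then have "nsq w \<noteq> 0" unfolding nsq_def
    using integral_nonneg_eq_0_iff_AE[OF integrable_test_sq[OF assms(1)]] by simp
  then show ?thesis using nsq_nonneg[of w] by linarith
qed

lemma H_pipe_test_exists: obtains w where "test_fun H_pipe w" "nsq w > 0"
proof -
  have "(1,1/2) \<in> H_pipe" by (simp add: mem_H_pipe)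
  then obtain r where r: "r > 0" "cball (1,1/2) r \<subseteq> H_pipe" using open_H_pipe open_contains_cball by blast
  have t: "test_fun H_pipe (bump (1,1/2) (r\<^sup>2) 1)" using test_bump[of 1 r] r by simp
  show ?thesis
    by (rule that[OF t nsq_pos[OF t, of "(1,1/2)"]]) (use bump_pos[of 1 "(1,1/2)" "(1,1/2)" "r\<^sup>2"] r in \<open>auto simp: dsq_def\<close>)
qed

text \<open>The x2-derivative of u^2 x2 integrates to zero and |x2| < 1 on the pipe; completing the
  square gives the constant 4. It is far from sharp, but it makes \<open>lambda1 H_pipe\<close>
  positive.\<close>

lemma poincare_H_pipe:
  assumes "test_fun H_pipe u" shows "nsq u \<le> 4 * dir u"
proof -
  let ?w = "\<lambda>x. u x * (u x * snd x)"
  have s: "smoothOn UNIV u" by (rule test_fun_smooth[OF assms])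
  have t: "test_fun H_pipe ?w"
    by (rule test_fun_mult[OF assms]) (intro smoothOn_mult s smoothOn_snd open_UNIV)
  have d: "dx2 ?w x = 2 * u x * dx2 u x * snd x + (u x)\<^sup>2" for x
    using pdD(2)[OF pd_mult[OF smoothOn_pd[OF s UNIV_I] pd_mult[OF smoothOn_pd[OF s UNIV_I] pd_snd]], of x]
    by (simp add: power2_eq_square algebra_simps)
  have "(u x)\<^sup>2 / 4 - dx2 ?w x / 2 \<le> dotg u u x - (u x)\<^sup>2 / 2 + (u x)\<^sup>2/2" for x
  proof -
    have a: "(u x)\<^sup>2 * (snd x)\<^sup>2 \<le> (u x)\<^sup>2 * 1"
    proof (cases "x \<in> H_pipe")
      case True
      then have "(snd x)\<^sup>2 \<le> 1" using H_pipe_snd[of x] by (simp add: abs_square_le_1)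
      then show ?thesis by (intro mult_left_mono) auto
    qed (simp add: test_fun_outside[OF assms])
    have "0 \<le> (dx2 u x + u x * snd x / 2)\<^sup>2" by simp
    also have "\<dots> = (dx2 u x)\<^sup>2 + u x * dx2 u x * snd x + (u x)\<^sup>2 * (snd x)\<^sup>2 / 4"
      by (simp add: power2_eq_square algebra_simps)
    also have "\<dots> \<le> dotg u u x + u x * dx2 u x * snd x + (u x)\<^sup>2 / 4"
      using a zero_le_square[of "dx1 u x"] unfolding dotg_def power2_eq_square by linarith
    finally have "0 \<le> dotg u u x + u x * dx2 u x * snd x + (u x)\<^sup>2 / 4" .
    moreover have "dx2 ?w x / 2 = u x * dx2 u x * snd x + (u x)\<^sup>2 / 2" unfolding d by (simp add: field_simps)
    ultimately show ?thesis by linarith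
  qed
  then have pw: "(u x)\<^sup>2 / 4 - dx2 ?w x / 2 \<le> dotg u u x" for x by simp
  have i: "integrable lborel (\<lambda>x. (u x)\<^sup>2)" "integrable lborel (dx2 ?w)" "integrable lborel (dotg u u)"
    using integrable_test_sq[OF assms] integrable_test[OF test_fun_dx(2)[OF t]] integrable_dotg[OF assms assms] by auto
  have "(\<integral>x. (u x)\<^sup>2 / 4 - dx2 ?w x / 2 \<partial>lborel) \<le> dir u" unfolding dir_def
    using i pw by (intro integral_mono) auto
  then show ?thesis using i integral_dx(2)[OF t] by (simp add: nsq_def)
qed

lemma lambda1_H_pos: "lambda1 H_pipe \<ge> 1/4"
proof (rule field_le_epsilon)
  fix e :: real assume "e > 0"
  obtain w where "test_fun H_pipe w" "nsq w > 0" by (rule H_pipe_test_exists)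
  from near_minimiser[OF this \<open>e > 0\<close>] obtain u where u: "test_fun H_pipe u" "nsq u = 1" "dir u < lambda1 H_pipe + e" by blast
  then show "1/4 \<le> lambda1 H_pipe + e" using poincare_H_pipe[OF u(1)] by simp
qed

subsection \<open>The energy form\<close>

definition En :: "real \<Rightarrow> (pt \<Rightarrow> real) \<Rightarrow> real" where "En l u = dir u - l * nsq u"
definition Bl :: "real \<Rightarrow> (pt \<Rightarrow> real) \<Rightarrow> (pt \<Rightarrow> real) \<Rightarrow> real" where
  "Bl l u v = (\<integral>x. dotg u v x \<partial>lborel) - l * (\<integral>x. u x * v x \<partial>lborel)"

lemma dx_add_cmult:
  assumes "smoothOn UNIV u" "smoothOn UNIV v"
  shows "dx1 (\<lambda>x. u x + t * v x) x = dx1 u x + t * dx1 v x" "dx2 (\<lambda>x. u x + t * v x) x = dx2 u x + t * dx2 v x"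
  using pdD(1,2)[OF pd_add[OF smoothOn_pd[OF assms(1) UNIV_I] pd_affine[OF smoothOn_pd[OF assms(2) UNIV_I], of 0 t]]] by simp_all

lemma En_add:
  assumes "test_fun \<Omega> u" "test_fun \<Omega> v"
  shows "nsq (\<lambda>x. u x + t * v x) = nsq u + 2 * t * (\<integral>x. u x * v x \<partial>lborel) + t\<^sup>2 * nsq v"
    "En l (\<lambda>x. u x + t * v x) = En l u + 2 * t * Bl l u v + t\<^sup>2 * En l v"
proof -
  note i = integrable_test_sq[OF assms(1)] integrable_test_sq[OF assms(2)] integrable_test_prod[OF assms]
    integrable_dotg[OF assms] integrable_dotg[OF assms(1) assms(1)] integrable_dotg[OF assms(2) assms(2)]
  have "(\<lambda>x. (u x + t * v x)\<^sup>2) = (\<lambda>x. (u x)\<^sup>2 + 2 * t * (u x * v x) + t\<^sup>2 * (v x)\<^sup>2)"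
    by (rule ext) (simp add: power2_eq_square algebra_simps)
  then show 1: "nsq (\<lambda>x. u x + t * v x) = nsq u + 2 * t * (\<integral>x. u x * v x \<partial>lborel) + t\<^sup>2 * nsq v"
    using i by (simp add: nsq_def)
  have "dotg (\<lambda>x. u x + t * v x) (\<lambda>x. u x + t * v x) = (\<lambda>x. dotg u u x + 2 * t * dotg u v x + t\<^sup>2 * dotg v v x)"
    by (rule ext) (simp add: dotg_def dx_add_cmult[OF test_fun_smooth[OF assms(1)] test_fun_smooth[OF assms(2)]] power2_eq_square algebra_simps)
  then have "dir (\<lambda>x. u x + t * v x) = dir u + 2 * t * (\<integral>x. dotg u v x \<partial>lborel) + t\<^sup>2 * dir v"
    using i by (simp add: dir_def)
  with 1 show "En l (\<lambda>x. u x + t * v x) = En l u + 2 * t * Bl l u v + t\<^sup>2 * En l v"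
    by (simp add: En_def Bl_def algebra_simps)
qed

lemma discr_le:
  fixes a b c :: real
  assumes "\<And>t. a + 2 * t * b + t\<^sup>2 * c \<ge> 0" "c \<ge> 0"
  shows "b\<^sup>2 \<le> a * c"
proof (cases "c = 0")
  case True
  have "b = 0"
  proof (rule ccontr)
    assume "b \<noteq> 0"
    then show False using assms(1)[of "- (a + 1) / (2 * b)"] True by (simp add: field_simps)
  qed
  then show ?thesis using True by simp
next
  case False
  then have "c > 0" using assms(2) by simp
  then have "0 \<le> a - b\<^sup>2 / c" using assms(1)[of "- b / c"] by (simp add: power2_eq_square field_simps)
  then show ?thesis using \<open>c > 0\<close> by (simp add: field_simps)
qed

lemma En_cauchy_schwarz:
  assumes "\<And>w. test_fun \<Omega> w \<Longrightarrow> En l w \<ge> 0" "test_fun \<Omega> u" "test_fun \<Omega> v"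
  shows "(Bl l u v)\<^sup>2 \<le> En l u * En l v"
proof (rule discr_le)
  show "En l v \<ge> 0" by (rule assms(1)[OF assms(3)])
  fix t
  have "En l (\<lambda>x. u x + t * v x) \<ge> 0"
    by (intro assms(1) test_fun_add test_fun_cmult assms(2,3))
  then show "En l u + 2 * t * Bl l u v + t\<^sup>2 * En l v \<ge> 0" by (simp add: En_add(2)[OF assms(2,3)])
qed

lemma Bl_green:
  assumes "test_fun \<Omega> u" "smoothOn UNIV v"
  shows "integrable lborel (\<lambda>x. u x * (lap v x + l * v x))" "Bl l u v = - (\<integral>x. u x * (lap v x + l * v x) \<partial>lborel)"
proof -
  have i: "integrable lborel (\<lambda>x. u x * v x)" by (rule integrable_test_mult[OF assms(1) smoothOn_continuous[OF assms(2)]])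
  have e: "(\<lambda>x. u x * (lap v x + l * v x)) = (\<lambda>x. u x * lap v x + l * (u x * v x))" by (rule ext) (simp add: algebra_simps)
  show "integrable lborel (\<lambda>x. u x * (lap v x + l * v x))" unfolding e using i green(2)[OF assms] by simp
  show "Bl l u v = - (\<integral>x. u x * (lap v x + l * v x) \<partial>lborel)" unfolding e Bl_def green(3)[OF assms]
    using i green(2)[OF assms] by simp
qed

text \<open>The stand-in for a ground state; \<eta> is the defect of its Rayleigh quotient.\<close>

definition nearmin :: "real \<Rightarrow> (pt \<Rightarrow> real) \<Rightarrow> bool" where
  "nearmin \<eta> u \<longleftrightarrow> test_fun H_pipe u \<and> (\<forall>x. u x \<ge> 0) \<and> nsq u = 1 \<and> dir u \<le> lambda1 H_pipe + \<eta>"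

lemma nearminD: "nearmin \<eta> u \<Longrightarrow> test_fun H_pipe u" "nearmin \<eta> u \<Longrightarrow> u x \<ge> 0" "nearmin \<eta> u \<Longrightarrow> nsq u = 1"
   "nearmin \<eta> u \<Longrightarrow> En (lambda1 H_pipe) u \<le> \<eta>" "nearmin \<eta> u \<Longrightarrow> dir u \<le> lambda1 H_pipe + \<eta>"
  by (simp_all add: nearmin_def En_def del: split_paired_All)

lemma nearmin_exists: "\<eta> > 0 \<Longrightarrow> \<exists>u. nearmin \<eta> u"
  unfolding nearmin_def by (metis H_pipe_test_exists near_minimiser_nonneg)

lemma En_H_nonneg: "test_fun H_pipe w \<Longrightarrow> En (lambda1 H_pipe) w \<ge> 0"
  using lambda1_le[of H_pipe w] by (simp add: En_def)

text \<open>The energy form is semidefinite on the pipe and almost zero at \<open>u\<close>, so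
  Cauchy-Schwarz makes \<open>u\<close> almost orthogonal to every test function: an approximate
  eigenvalue equation. The factor of sqrt \<eta> depends on \<open>v\<close>, so \<eta> has to be
  chosen after \<open>v\<close>.\<close>

lemma nearmin_Bl:
  assumes "nearmin \<eta> u" "test_fun H_pipe v"
  shows "\<bar>Bl (lambda1 H_pipe) u v\<bar> \<le> sqrt (En (lambda1 H_pipe) v) * sqrt \<eta>"
proof -
  have "(Bl (lambda1 H_pipe) u v)\<^sup>2 \<le> En (lambda1 H_pipe) u * En (lambda1 H_pipe) v"
    by (rule En_cauchy_schwarz[OF En_H_nonneg nearminD(1)[OF assms(1)] assms(2)])
  also have "\<dots> \<le> \<eta> * En (lambda1 H_pipe) v"
    by (intro mult_right_mono nearminD(4)[OF assms(1)] En_H_nonneg assms(2))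
  finally have "sqrt ((Bl (lambda1 H_pipe) u v)\<^sup>2) \<le> sqrt (\<eta> * En (lambda1 H_pipe) v)" by (rule real_sqrt_le_mono)
  then show ?thesis by (simp add: real_sqrt_mult mult.commute)
qed

text \<open>The L^1 mass is the natural quantity, because testing the approximate equation bounds
  expressions linear in \<open>u\<close>.\<close>

definition mass :: "pt set \<Rightarrow> (pt \<Rightarrow> real) \<Rightarrow> real" where
  "mass A u = (\<integral>x. indicator A x * u x \<partial>lborel)"

lemma integrable_mass:
  assumes "test_fun \<Omega> u" "A \<in> sets borel" shows "integrable lborel (\<lambda>x. indicator A x * u x)"
  using integrable_mult_indicator[of A lborel u] integrable_test[OF assms(1)] assms(2) by simp

lemma mass_mono:
  assumes "test_fun \<Omega> u" "\<And>x. u x \<ge> 0" "A \<in> sets borel" "B \<in> sets borel" "A \<subseteq> B"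
  shows "mass A u \<le> mass B u"
  unfolding mass_def
  by (intro integral_mono integrable_mass[OF assms(1)] assms) (use assms(2,5) in \<open>auto simp: indicator_def\<close>)

lemma mass_nonneg: "(\<And>x. u x \<ge> 0) \<Longrightarrow> mass A u \<ge> 0"
  unfolding mass_def by (intro integral_nonneg_AE AE_I2) (simp add: indicator_def)

lemma mass_UN_le:
  assumes "finite I" "test_fun \<Omega> u" "\<And>x. u x \<ge> 0" "\<And>i. i \<in> I \<Longrightarrow> B i \<in> sets borel" "A \<in> sets borel" "A \<subseteq> (\<Union>i\<in>I. B i)"
  shows "mass A u \<le> (\<Sum>i\<in>I. mass (B i) u)"
proof -
  have "mass A u \<le> (\<integral>x. (\<Sum>i\<in>I. indicator (B i) x * u x) \<partial>lborel)"
    unfolding mass_def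
  proof (intro integral_mono integrable_mass[OF assms(2,5)] Bochner_Integration.integrable_sum integrable_mass[OF assms(2)] assms(4))
    fix x
    show "indicator A x * u x \<le> (\<Sum>i\<in>I. indicator (B i) x * u x)"
    proof (cases "x \<in> A")
      case True
      then obtain j where j: "j \<in> I" "x \<in> B j" using assms(6) by blast
      have "indicator A x * u x = indicator (B j) x * u x" using True j by simp
      also have "\<dots> \<le> (\<Sum>i\<in>I. indicator (B i) x * u x)"
        by (rule member_le_sum[OF j(1) _ assms(1)]) (simp add: assms(3))
      finally show ?thesis .
    qed (simp add: sum_nonneg assms(3))
  qed
  also have "\<dots> = (\<Sum>i\<in>I. mass (B i) u)"
    unfolding mass_def by (intro Bochner_Integration.integral_sum integrable_mass[OF assms(2)] assms(4))
  finally show ?thesis .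
qed

text \<open>A bump that decays fast enough is strictly subharmonic off a small core, so testing the
  approximate equation with it bounds the mass on a ball by the mass on the core.\<close>

lemma chain_step:
  assumes "cball c R \<subseteq> H_pipe" "R > 0" "r > 0"
  obtains C D where "C \<ge> 0" "D \<ge> 0"
    "\<And>u \<eta>. nearmin \<eta> u \<Longrightarrow> mass (ball c (R/2)) u \<le> C * mass (ball c r) u + D * sqrt \<eta>"
proof -
  let ?l = "lambda1 H_pipe"
  have l: "?l > 0" using lambda1_H_pos by linarith
  \<comment> \<open>The first summand gives t <= 1/4, hence 1 - 2t >= 1/2; the second gives t^2 <=
    R^4 / b^2 <= r^2 / (2b). So the bracket of \<open>lap_bump\<close> is non-negative off the
    core.\<close>
  define b where "b = 4 * R\<^sup>2 + 2 * R^4 / r\<^sup>2"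
  have R2: "R\<^sup>2 > 0" "R^4 > 0" using assms(2) by auto
  have b: "b > 0" "b \<ge> 4 * R\<^sup>2" "b * r\<^sup>2 \<ge> 2 * R^4"
    using R2 assms(3) by (auto simp: b_def add_pos_nonneg field_simps)
  define f where "f = bump c (R\<^sup>2) b"
  have tf: "test_fun H_pipe f" unfolding f_def by (rule test_bump[OF b(1) assms(2,1)])
  have sf: "smoothOn UNIV f" by (rule test_fun_smooth[OF tf])
  have lap1: "lap f x \<ge> 0" if "x \<notin> ball c r" for x
  proof -
    define t where "t = (R\<^sup>2 - dsq c x) / b"
    have rx: "dsq c x \<ge> r\<^sup>2" using that assms(3) unfolding dsq_dist by (intro power_mono) auto
    have "(dsq c x / b) * (1 - 2 * t) - t\<^sup>2 \<ge> 0" if t: "t > 0"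
    proof -
      have tb: "t \<le> R\<^sup>2 / b" unfolding t_def using b(1) dsq_nonneg[of c x] by (intro divide_right_mono) auto
      have "R\<^sup>2 / b \<le> 1/4" using b by (simp add: pos_divide_le_eq)
      then have t2: "1/2 \<le> 1 - 2 * t" using tb by linarith
      have "t\<^sup>2 \<le> (R\<^sup>2 / b)\<^sup>2" using t tb by (intro power_mono) auto
      also have "\<dots> = R^4 / b\<^sup>2" by (simp add: power_divide flip: power_mult)
      also have "\<dots> \<le> (r\<^sup>2 / b) * (1/2)"
        using b by (simp add: field_simps power2_eq_square)
      also have "\<dots> \<le> (dsq c x / b) * (1 - 2 * t)"
        using rx b(1) t2 by (intro mult_mono divide_right_mono) (auto simp: dsq_nonneg)
      finally show ?thesis by simp
    qed
    then show ?thesis unfolding f_def lap_bump[OF b(1)] Let_def t_def[symmetric] using b(1)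
      by (auto intro!: mult_nonneg_nonneg)
  qed
  obtain C where C: "C \<ge> 0" "\<And>x. x \<in> ball c r \<Longrightarrow> lap f x \<ge> - C"
  proof -
    have "continuous_on (cball c r) (lap f)"
      using smoothOn_continuous[OF smoothOn_lap[OF open_UNIV sf]] continuous_on_subset by blast
    then have "bounded (lap f ` cball c r)" by (intro compact_imp_bounded compact_continuous_image compact_cball)
    then obtain B where B: "\<And>x. x \<in> cball c r \<Longrightarrow> norm (lap f x) \<le> B" unfolding bounded_iff by blast
    show ?thesis
    proof (rule that[of "\<bar>B\<bar>"])
      fix x assume "x \<in> ball c r"
      then have "norm (lap f x) \<le> B" by (intro B) auto
      then show "- \<bar>B\<bar> \<le> lap f x" by (simp add: abs_le_iff)
    qed simp
  qed
  \<comment> \<open>Strict positivity on the half ball comes from the zero-order term: off the core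
    the Laplacian is only known to be non-negative, while \<open>?l * f\<close> is at least
    \<open>q\<close>.\<close>
  define q where "q = ?l * ee ((R\<^sup>2 - (R/2)\<^sup>2) / b)"
  have "ee ((R\<^sup>2 - (R/2)\<^sup>2) / b) > 0" using R2 b by (intro ee_pos) (auto simp: power_divide)
  then have q: "q > 0" using l by (simp add: q_def)
  have fq: "?l * f x \<ge> q" if "x \<in> ball c (R/2)" for x
  proof -
    have "dsq c x \<le> (R/2)\<^sup>2" unfolding dsq_dist using that assms(2) by (intro power_mono) auto
    then have "ee ((R\<^sup>2 - (R/2)\<^sup>2) / b) \<le> f x" unfolding f_def bump_def using b(1) by (intro ee_mono divide_right_mono) auto
    then show ?thesis unfolding q_def using l by simp
  qed
  have f0: "f x \<ge> 0" for x by (simp add: f_def bump_nonneg)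
  show thesis
  proof (rule that[of "C / q" "sqrt (En ?l f) / q"])
    show "C / q \<ge> 0" "sqrt (En ?l f) / q \<ge> 0" using C q En_H_nonneg[OF tf] by auto
    fix u \<eta> assume nm: "nearmin \<eta> u"
    note u = nearminD(1,2)[OF nm]
    have "q * mass (ball c (R/2)) u - C * mass (ball c r) u
       = (\<integral>x. q * (indicator (ball c (R/2)) x * u x) - C * (indicator (ball c r) x * u x) \<partial>lborel)"
      unfolding mass_def using integrable_mass[OF u(1)] by simp
    also have "\<dots> \<le> (\<integral>x. u x * (lap f x + ?l * f x) \<partial>lborel)"
    proof (intro integral_mono Bl_green(1)[OF u(1) sf] Bochner_Integration.integrable_diff integrable_mult_right integrable_mass[OF u(1)])
      fix x
      have "q * indicator (ball c (R/2)) x - C * indicator (ball c r) x \<le> lap f x + ?l * f x"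
        using lap1[of x] C(2)[of x] fq[of x] f0[of x] l mult_nonneg_nonneg[of ?l "f x"]
        by (cases "x \<in> ball c r"; cases "x \<in> ball c (R/2)"; simp del: mem_ball; linarith)
      from mult_left_mono[OF this u(2)[of x]]
      show "q * (indicator (ball c (R/2)) x * u x) - C * (indicator (ball c r) x * u x) \<le> u x * (lap f x + ?l * f x)"
        by (simp add: algebra_simps)
    qed auto
    also have "\<dots> = - Bl ?l u f" using Bl_green(2)[OF u(1) sf] by simp
    also have "\<dots> \<le> sqrt (En ?l f) * sqrt \<eta>" using nearmin_Bl[OF nm tf] by linarith
    finally have "q * mass (ball c (R/2)) u \<le> C * mass (ball c r) u + sqrt (En ?l f) * sqrt \<eta>" by simp
    then have "mass (ball c (R/2)) u \<le> (C * mass (ball c r) u + sqrt (En ?l f) * sqrt \<eta>) / q"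
      using q by (simp add: pos_le_divide_eq mult.commute)
    then show "mass (ball c (R/2)) u \<le> C / q * mass (ball c r) u + sqrt (En ?l f) / q * sqrt \<eta>"
      by (simp add: add_divide_distrib)
  qed
qed

subsection \<open>Near-minimisers charge every ball\<close>

text \<open>Jacobi's trick with \<open>\<pi> cot (\<pi> x\<^sub>2)\<close> gives the sharp Poincare inequality in the two
  arms, so if \<open>\<lambda>\<^sub>1 < \<pi>\<^sup>2\<close> a fixed share of the mass stays out of them.\<close>

lemma mass_sq_bounded_part:
  assumes "nearmin \<eta> u"
  shows "1 - (lambda1 H_pipe + \<eta>) / pi\<^sup>2 \<le> mass (H_pipe \<inter> {x. fst x < 1}) (\<lambda>x. (u x)\<^sup>2)"
proof -
  note u = nearminD(1,2)[OF assms]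
  have su: "smoothOn UNIV u" by (rule test_fun_smooth[OF u(1)])
  \<comment> \<open>The cut-off depends on x1 alone, so x2-derivatives pass it by. It vanishes for
    x1 <= 1/2 and so hides the singularity of the cotangent on x2 = 0 inside the left half
    disc.\<close>
  define z where "z x = stp (fst x)" for x :: pt
  have sz: "smoothOn UNIV z" unfolding z_def[abs_def] by (intro smoothOn_stp smoothOn_fst open_UNIV)
  have z01: "0 \<le> z x" "z x \<le> 1" for x by (simp_all add: z_def stp_nonneg stp_le_1)
  \<comment> \<open>The logarithmic derivative of sin (pi x2), the transverse ground state. It
    solves the Riccati equation k' = - pi^2 - k^2, and in the arms its poles lie on the
    walls.\<close>
  define k where "k x = pi * cos (pi * snd x) / sin (pi * snd x)" for x :: pt
  define g where "g x = z x * k x" for x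
  let ?V = "{x::pt. sin (pi * snd x) \<noteq> 0}"
  have oV: "open ?V" by (intro open_Collect_neq continuous_intros)
  have oL: "open {x::pt. fst x < 1/2}" by (intro open_Collect_less continuous_intros)
  have sL: "smoothOn {x::pt. fst x < 1/2} g"
    by (rule smoothOn_cong[OF oL, of "\<lambda>x. 0"]) (auto simp: g_def z_def stp_0 smoothOn_const)
  have snl: "smoothOn ?V (\<lambda>x. pi * snd x)" by (intro smoothOn_mult smoothOn_const smoothOn_snd oV)
  have sV: "smoothOn ?V g"
  proof -
    have "smoothOn ?V (\<lambda>x. z x * (pi * sin (pi * snd x + pi/2) / sin (pi * snd x)))"
      by (intro smoothOn_mult smoothOn_divide smoothOn_sin smoothOn_add smoothOn_const snl oV)
         (use smoothOn_subset[OF sz] in auto)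
    then show ?thesis unfolding g_def[abs_def] k_def by (simp add: sin_add)
  qed
  have HV: "H_pipe \<subseteq> {x::pt. fst x < 1/2} \<union> ?V"
  proof
    fix x assume x: "x \<in> H_pipe"
    show "x \<in> {x::pt. fst x < 1/2} \<union> ?V"
    proof (cases "fst x < 1/2")
      case False
      then have "0 < \<bar>snd x\<bar>" "\<bar>snd x\<bar> < 1" using x by (auto simp: mem_H_pipe)
      then have "0 < sin (pi * \<bar>snd x\<bar>)" by (intro sin_gt_zero) auto
      then have "sin (pi * snd x) \<noteq> 0" by (cases "snd x \<ge> 0") auto
      then show ?thesis by simp
    qed simp
  qed
  have sg: "smoothOn H_pipe g"
    by (rule smoothOn_subset[OF smoothOn_Un[OF oL oV sL sV] HV])
  define w where "w x = u x * (u x * g x)" for x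
  have tw: "test_fun H_pipe w" unfolding w_def[abs_def]
    by (rule test_fun_local[OF u(1) open_H_pipe]) (intro smoothOn_mult open_H_pipe sg smoothOn_subset[OF su] subset_UNIV)
  have pw: "pi\<^sup>2 * (z x * (u x)\<^sup>2) + dx2 w x \<le> dotg u u x" for x
  proof (cases "x \<in> H_pipe")
    case False
    obtain K where K: "compact K" "K \<subseteq> H_pipe" "\<And>x. x \<notin> K \<Longrightarrow> w x = 0" using tw by (rule test_funE) blast
    have "dx2 w x = 0" by (rule dx_zero_outside(2)[OF compact_imp_closed[OF K(1)] K(3)]) (use False K(2) in auto)
    moreover have "u x = 0" by (rule test_fun_outside[OF u(1) False])
    ultimately show ?thesis by (simp add: dotg_def)
  next
    case True
    show ?thesis
    proof (cases "fst x < 1/2")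
      case True
      have "pd w 0 0 x"
        by (rule pd_cong[OF oL _ _ pd_const[of 0]]) (use True in \<open>auto simp: w_def g_def z_def stp_0\<close>)
      then have "dx2 w x = 0" by (rule pdD)
      moreover have "z x = 0" using True by (simp add: z_def stp_0)
      ultimately show ?thesis by (simp add: dotg_def)
    next
      case False
      then have s0: "sin (pi * snd x) \<noteq> 0" using HV \<open>x \<in> H_pipe\<close> by auto
      have dk: "((\<lambda>t. pi * cos (pi * t) / sin (pi * t)) has_real_derivative - pi\<^sup>2 - (k x)\<^sup>2) (at (snd x))"
      proof -
        have q: "sin (pi * snd x) * sin (pi * snd x) = 1 - cos (pi * snd x) * cos (pi * snd x)"
          using sin_cos_squared_add[of "pi * snd x"] by (simp add: power2_eq_square)
        show ?thesis using s0
          by (auto intro!: derivative_eq_intros simp: k_def field_simps power2_eq_square)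
      qed
      have "pd k ((- pi\<^sup>2 - (k x)\<^sup>2) * 0) ((- pi\<^sup>2 - (k x)\<^sup>2) * 1) x"
        unfolding k_def[abs_def, symmetric] using pd_comp[OF dk pd_snd] by (simp add: k_def[abs_def])
      moreover have "pd z (dx1 z x) 0 x"
      proof -
        obtain F1 F2 where "\<And>t. (stp has_real_derivative F1 t) (at t)" by (rule smooth1_imp_deriv[OF smooth1_stp]) blast
        from pdI[OF pdD(3)[OF pd_comp[OF this pd_fst, of x]]] pd_comp[OF this pd_fst, of x] show ?thesis
          unfolding z_def[abs_def] by (metis mult_zero_right pdD(2))
      qed
      ultimately have "pd g (dx1 z x * k x + z x * ((- pi\<^sup>2 - (k x)\<^sup>2) * 0)) (0 * k x + z x * ((- pi\<^sup>2 - (k x)\<^sup>2) * 1)) x"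
        unfolding g_def[abs_def] by (intro pd_mult)
      from pd_mult[OF smoothOn_pd[OF su UNIV_I] pd_mult[OF smoothOn_pd[OF su UNIV_I] this]]
      have dw: "dx2 w x = 2 * u x * dx2 u x * g x + (u x)\<^sup>2 * (z x * (- pi\<^sup>2 - (k x)\<^sup>2))"
        using pdD(2) unfolding w_def[abs_def] by (fastforce simp: power2_eq_square algebra_simps)
      \<comment> \<open>After expanding the square, the Riccati equation combines the cross term and
        k^2 u^2 into the exact derivative of u^2 z k, which integrates to zero.\<close>
      have "0 \<le> z x * (dx2 u x - u x * k x)\<^sup>2" using z01 by simp
      also have "\<dots> = z x * (dx2 u x)\<^sup>2 - pi\<^sup>2 * (z x * (u x)\<^sup>2) - dx2 w x"
        unfolding dw g_def by (simp add: power2_eq_square algebra_simps)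
      also have "z x * (dx2 u x)\<^sup>2 \<le> 1 * (dx2 u x)\<^sup>2" using z01 by (intro mult_right_mono) auto
      finally have "pi\<^sup>2 * (z x * (u x)\<^sup>2) + dx2 w x \<le> (dx2 u x)\<^sup>2" by simp
      also have "\<dots> \<le> dotg u u x" by (simp add: dotg_def power2_eq_square)
      finally show ?thesis .
    qed
  qed
  have tz: "test_fun H_pipe (\<lambda>x. u x * (u x * z x))"
    by (rule test_fun_mult[OF u(1)]) (intro smoothOn_mult su sz open_UNIV)
  have iz: "integrable lborel (\<lambda>x. z x * (u x)\<^sup>2)"
    using integrable_test[OF tz] by (simp add: power2_eq_square mult_ac)
  note i = iz integrable_test_sq[OF u(1)] integrable_test[OF test_fun_dx(2)[OF tw]] integrable_dotg[OF u(1) u(1)]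
  have "(\<integral>x. pi\<^sup>2 * (z x * (u x)\<^sup>2) + dx2 w x \<partial>lborel) \<le> dir u"
    unfolding dir_def by (intro integral_mono Bochner_Integration.integrable_add integrable_mult_right i pw)
  then have "pi\<^sup>2 * (\<integral>x. z x * (u x)\<^sup>2 \<partial>lborel) \<le> dir u"
    using i integral_dx(2)[OF tw] by simp
  then have 1: "(\<integral>x. z x * (u x)\<^sup>2 \<partial>lborel) \<le> (lambda1 H_pipe + \<eta>) / pi\<^sup>2"
    using nearminD(5)[OF assms] by (simp add: pos_le_divide_eq mult.commute)
  have mK: "H_pipe \<inter> {x. fst x < 1} \<in> sets borel"
    by (intro borel_open open_Int open_H_pipe open_Collect_less continuous_intros)
  have t2: "test_fun H_pipe (\<lambda>x. (u x)\<^sup>2)" using test_fun_mult[OF u(1) su] by (simp add: power2_eq_square)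
  have "1 - (\<integral>x. z x * (u x)\<^sup>2 \<partial>lborel) = (\<integral>x. (u x)\<^sup>2 - z x * (u x)\<^sup>2 \<partial>lborel)"
    using i nearminD(3)[OF assms] by (simp add: nsq_def)
  also have "\<dots> \<le> mass (H_pipe \<inter> {x. fst x < 1}) (\<lambda>x. (u x)\<^sup>2)"
    unfolding mass_def
  proof (intro integral_mono Bochner_Integration.integrable_diff i integrable_mass[OF t2 mK])
    fix x show "(u x)\<^sup>2 - z x * (u x)\<^sup>2 \<le> indicator (H_pipe \<inter> {x. fst x < 1}) x * (u x)\<^sup>2"
      using test_fun_outside[OF u(1), of x] z01(1)[of x] by (auto simp: indicator_def z_def stp_1)
  qed
  finally show ?thesis using 1 by linarith
qed

text \<open>Mass kept out of the arms could still pile up near the boundary. The L^4 bound excludes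
  this: it controls the L^2 mass on the thin set left over by an inner compact set \<open>G\<close>,
  and on \<open>G\<close> it turns L^2 mass into L^1 mass.\<close>

lemma mass_compact:
  assumes "lambda1 H_pipe < pi\<^sup>2"
  obtains G c \<eta> where "compact G" "G \<subseteq> H_pipe" "c > 0" "\<eta> > 0" "\<And>u. nearmin \<eta> u \<Longrightarrow> c \<le> mass G u"
proof -
  let ?l = "lambda1 H_pipe"
  let ?K = "H_pipe \<inter> {x. fst x < 1}"
  define \<eta> where "\<eta> = (pi\<^sup>2 - ?l) / 2"
  define c0 where "c0 = (pi\<^sup>2 - ?l) / (2 * pi\<^sup>2)"
  have pos: "\<eta> > 0" "c0 > 0" using assms by (auto simp: \<eta>_def c0_def)
  have c0: "1 - (?l + \<eta>) / pi\<^sup>2 = c0" by (simp add: \<eta>_def c0_def field_simps)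
  define Q where "Q = (1 + ?l + \<eta>)\<^sup>2"
  have Q: "Q > 0" using lambda1_H_pos pos(1) by (simp add: Q_def)
  \<comment> \<open>For use in u^2 <= M + u^4 / M off \<open>G\<close>: the L^4 term then costs c0 /
    4, and so does the constant M on a set of measure at most c0 / (4 M).\<close>
  define M where "M = 4 * Q / c0"
  have M: "M > 0" "Q / M = c0 / 4" using Q pos by (auto simp: M_def)
  have oK: "open ?K" by (intro open_Int open_H_pipe open_Collect_less continuous_intros)
  have bK: "bounded ?K"
  proof (rule bounded_subset[of "cbox (-1,-1) (1,1)"])
    show "?K \<subseteq> cbox (-1,-1) (1,1)"
    proof
      fix x assume x: "x \<in> ?K"
      have "-1 \<le> fst x"
      proof (cases "fst x < 0")
        case True
        then have "(fst x)\<^sup>2 + (snd x)\<^sup>2 < 1" using x by (auto simp: mem_H_pipe)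
        then have "(fst x)\<^sup>2 < 1" using zero_le_power2[of "snd x"] by linarith
        then show ?thesis by (simp add: abs_square_less_1)
      qed simp
      then show "x \<in> cbox (-1,-1) (1,1)" using x H_pipe_snd[of x] by (cases x) (auto simp: cbox_Pair_eq)
    qed
  qed simp
  obtain G where G: "closed G" "G \<subseteq> ?K" "?K - G \<in> lmeasurable" "emeasure lebesgue (?K - G) < ennreal (c0 / (4 * M))"
    using sets_lebesgue_inner_closed[of ?K "c0 / (4 * M)"] pos M oK by (auto intro: borel_open)
  have cG: "compact G" using G(1,2) bK by (metis bounded_subset compact_eq_bounded_closed)
  have mG: "G \<in> sets borel" "?K - G \<in> sets borel" "?K \<in> sets borel" using G(1) oK by (auto intro: borel_closed borel_open)
  have fin: "emeasure lborel (?K - G) < \<infinity>" "emeasure lborel G < \<infinity>"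
    using emeasure_bounded_finite[OF bounded_diff[OF bK]] emeasure_compact_finite[OF cG] by auto
  have "emeasure lborel (?K - G) < ennreal (c0 / (4 * M))" using G(4) mG by simp
  then have small: "measure lborel (?K - G) \<le> c0 / (4 * M)"
    using pos M by (simp add: measure_def enn2real_leI less_imp_le)
  \<comment> \<open>For use in u^2 <= N u + u^4 / N^2, which holds whether u <= N or not. The L^4
    term costs c0 / 4 of the remaining c0 / 2.\<close>
  define N where "N = sqrt (4 * Q / c0)"
  have N: "N > 0" "Q / N\<^sup>2 = c0 / 4" using Q pos by (auto simp: N_def)
  show thesis
  proof (rule that[OF cG _ _ pos(1), of "c0 / (4 * N)"])
    show "G \<subseteq> H_pipe" using G(2) by blast
    show "c0 / (4 * N) > 0" using pos N by simp
    fix u assume nm: "nearmin \<eta> u"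
    note u = nearminD(1,2)[OF nm]
    have su: "smoothOn UNIV u" by (rule test_fun_smooth[OF u(1)])
    have t2: "test_fun H_pipe (\<lambda>x. (u x)\<^sup>2)" using test_fun_mult[OF u(1) su] by (simp add: power2_eq_square)
    have t4: "test_fun H_pipe (\<lambda>x. (u x)^4)" using test_fun_mult[OF t2 test_fun_smooth[OF t2]] by (simp add: power4_eq_xxxx power2_eq_square mult.assoc)
    have i4: "integrable lborel (\<lambda>x. (u x)^4)" by (rule integrable_test[OF t4])
    have I4: "(\<integral>x. (u x)^4 \<partial>lborel) \<le> Q"
    proof -
      have "(\<integral>x. (u x)\<^sup>2 + dotg u u x \<partial>lborel) = nsq u + dir u"
        using integrable_test_sq[OF u(1)] integrable_dotg[OF u(1) u(1)] by (simp add: nsq_def dir_def)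
      then have "(\<integral>x. (u x)^4 \<partial>lborel) \<le> (nsq u + dir u)\<^sup>2" using ladyzhenskaya[OF u(1)] by simp
      also have "\<dots> \<le> Q" unfolding Q_def using nearminD(3,5)[OF nm] dir_nonneg[of u] by (intro power_mono) auto
      finally show ?thesis .
    qed
    have "mass ?K (\<lambda>x. (u x)\<^sup>2) \<le> (\<integral>x. indicator G x * (u x)\<^sup>2 + (M * indicator (?K - G) x + (u x)^4 / M) \<partial>lborel)"
      unfolding mass_def
    proof (intro integral_mono integrable_mass[OF t2] mG Bochner_Integration.integrable_add integrable_mult_right integrable_divide i4)
      show "integrable lborel (indicat_real (?K - G))" using mG fin by simp
      fix x
      have "(u x)\<^sup>2 \<le> M + (u x)^4 / M"
      proof -
        have "0 \<le> (M - (u x)\<^sup>2)\<^sup>2 + M * (u x)\<^sup>2" using M by (intro add_nonneg_nonneg mult_nonneg_nonneg) auto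
        also have "\<dots> = M * (M + (u x)^4 / M - (u x)\<^sup>2)" using M(1) by (simp add: field_simps power2_eq_square power4_eq_xxxx)
        finally show ?thesis using M(1) by (simp add: zero_le_mult_iff)
      qed
      moreover have "(u x)^4 / M \<ge> 0" using M by simp
      ultimately show "indicator ?K x * (u x)\<^sup>2 \<le> indicator G x * (u x)\<^sup>2 + (M * indicator (?K - G) x + (u x)^4 / M)"
        using G(2) by (auto simp: indicator_def)
    qed
    also have "\<dots> = mass G (\<lambda>x. (u x)\<^sup>2) + (M * measure lborel (?K - G) + (\<integral>x. (u x)^4 \<partial>lborel) / M)"
      unfolding mass_def using mG fin i4 integrable_mass[OF t2 mG(1)] by simp
    also have "M * measure lborel (?K - G) \<le> c0 / 4" using small M by (simp add: field_simps)
    also have "(\<integral>x. (u x)^4 \<partial>lborel) / M \<le> c0 / 4" using I4 M by (metis divide_right_mono less_imp_le)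
    finally have "c0 / 2 \<le> mass G (\<lambda>x. (u x)\<^sup>2)" using mass_sq_bounded_part[OF nm] c0 by linarith
    also have "\<dots> \<le> (\<integral>x. N * (indicator G x * u x) + (u x)^4 / N\<^sup>2 \<partial>lborel)"
      unfolding mass_def
    proof (intro integral_mono integrable_mass[OF t2] integrable_mass[OF u(1)] mG Bochner_Integration.integrable_add integrable_mult_right integrable_divide i4)
      fix x
      have "(u x)\<^sup>2 \<le> N * u x + (u x)^4 / N\<^sup>2"
      proof (cases "u x \<le> N")
        case True
        then have "u x * u x \<le> N * u x" using u(2)[of x] by (intro mult_right_mono)
        then have "(u x)\<^sup>2 \<le> N * u x" by (simp add: power2_eq_square)
        moreover have "0 \<le> (u x)^4 / N\<^sup>2" by simp
        ultimately show ?thesis by linarith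
      next
        case False
        then have "N\<^sup>2 \<le> (u x)\<^sup>2" using N by (intro power_mono) auto
        then have "(u x)\<^sup>2 * N\<^sup>2 \<le> (u x)\<^sup>2 * (u x)\<^sup>2" by (intro mult_left_mono) auto
        then have "(u x)\<^sup>2 \<le> (u x)^4 / N\<^sup>2" using N by (simp add: pos_le_divide_eq power4_eq_xxxx power2_eq_square mult.assoc)
        moreover have "0 \<le> N * u x" using N u(2)[of x] by simp
        ultimately show ?thesis by linarith
      qed
      moreover have "0 \<le> (u x)^4 / N\<^sup>2" by simp
      ultimately show "indicator G x * (u x)\<^sup>2 \<le> N * (indicator G x * u x) + (u x)^4 / N\<^sup>2"
        by (auto simp: indicator_def)
    qed
    also have "\<dots> = N * mass G u + (\<integral>x. (u x)^4 \<partial>lborel) / N\<^sup>2"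
      unfolding mass_def using i4 integrable_mass[OF u(1) mG(1)] by simp
    also have "(\<integral>x. (u x)^4 \<partial>lborel) / N\<^sup>2 \<le> c0 / 4" using I4 N by (metis divide_right_mono zero_le_power2)
    finally have "c0 / 4 \<le> N * mass G u" by simp
    then show "c0 / (4 * N) \<le> mass G u" using N by (simp add: field_simps)
  qed
qed

text \<open>The points near which the mass of a sequence of near-minimisers vanishes form a relatively
  clopen subset of the pipe.\<close>

lemma mass_point:
  assumes "lambda1 H_pipe < pi\<^sup>2" "p \<in> H_pipe" "r > 0"
  obtains c \<eta> where "c > 0" "\<eta> > 0" "\<And>u. nearmin \<eta> u \<Longrightarrow> c \<le> mass (ball p r) u"
proof (rule ccontr)
  assume neg: "\<not> thesis"
  have "\<exists>u. nearmin (1 / real (Suc k)) u \<and> mass (ball p r) u < 1 / real (Suc k)" for k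
    using neg that[of "1 / real (Suc k)" "1 / real (Suc k)"] by (meson not_le of_nat_0_less_iff zero_less_Suc zero_less_divide_1_iff)
  then obtain u where u: "\<And>k. nearmin (1 / real (Suc k)) (u k)" "\<And>k. mass (ball p r) (u k) < 1 / real (Suc k)"
    by metis
  note tu = nearminD(1)[OF u(1)] and u0 = nearminD(2)[OF u(1)]
  have inv0: "(\<lambda>k. 1 / real (Suc k)) \<longlonglongrightarrow> 0" using LIMSEQ_inverse_real_of_nat by (simp add: inverse_eq_divide)
  define Z where "Z A \<longleftrightarrow> (\<lambda>k. mass A (u k)) \<longlonglongrightarrow> 0" for A
  have Zmono: "Z A" if z: "Z B" "A \<subseteq> B" "A \<in> sets borel" "B \<in> sets borel" for A B
    unfolding Z_def
  proof (rule tendsto_sandwich[OF _ _ tendsto_const z(1)[unfolded Z_def]])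
    show "\<forall>\<^sub>F k in sequentially. 0 \<le> mass A (u k)" by (rule always_eventually, rule allI, rule mass_nonneg[OF u0])
    show "\<forall>\<^sub>F k in sequentially. mass A (u k) \<le> mass B (u k)"
      by (rule always_eventually, rule allI, rule mass_mono[OF tu u0 z(3,4,2)])
  qed
  have Zchain: "Z (ball x (R/2))" if z: "Z (ball x s)" "s > 0" "R > 0" "cball x R \<subseteq> H_pipe" for x s R
  proof -
    obtain C D where CD: "\<And>u \<eta>. nearmin \<eta> u \<Longrightarrow> mass (ball x (R/2)) u \<le> C * mass (ball x s) u + D * sqrt \<eta>"
    proof (rule chain_step[OF z(4,3,2)])
      fix C D assume "\<And>u \<eta>. nearmin \<eta> u \<Longrightarrow> mass (ball x (R/2)) u \<le> C * mass (ball x s) u + D * sqrt \<eta>"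
      then show thesis by (rule that)
    qed
    have l: "(\<lambda>k. C * mass (ball x s) (u k) + D * sqrt (1 / real (Suc k))) \<longlonglongrightarrow> C * 0 + D * sqrt 0"
      using z(1)[unfolded Z_def] inv0 by (intro tendsto_intros)
    show ?thesis unfolding Z_def
    proof (rule tendsto_sandwich[OF _ _ tendsto_const])
      show "\<forall>\<^sub>F k in sequentially. 0 \<le> mass (ball x (R/2)) (u k)" by (rule always_eventually, rule allI, rule mass_nonneg[OF u0])
      show "\<forall>\<^sub>F k in sequentially. mass (ball x (R/2)) (u k) \<le> C * mass (ball x s) (u k) + D * sqrt (1 / real (Suc k))"
        by (rule always_eventually, rule allI, rule CD[OF u(1)])
      show "(\<lambda>k. C * mass (ball x s) (u k) + D * sqrt (1 / real (Suc k))) \<longlonglongrightarrow> 0" using l by simp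
    qed
  qed
  define S where "S = {x \<in> H_pipe. \<exists>s>0. Z (ball x s)}"
  have pS: "p \<in> S"
  proof -
    have "Z (ball p r)" unfolding Z_def
    proof (rule tendsto_sandwich[OF _ _ tendsto_const inv0])
      show "\<forall>\<^sub>F k in sequentially. 0 \<le> mass (ball p r) (u k)" by (rule always_eventually, rule allI, rule mass_nonneg[OF u0])
      show "\<forall>\<^sub>F k in sequentially. mass (ball p r) (u k) \<le> 1 / real (Suc k)"
        by (rule always_eventually, rule allI, rule less_imp_le[OF u(2)])
    qed
    then show ?thesis using assms(2,3) by (auto simp: S_def)
  qed
  have oS: "open S" unfolding open_contains_ball
  proof
    fix x assume "x \<in> S"
    then obtain s where s: "s > 0" "Z (ball x s)" "x \<in> H_pipe" by (auto simp: S_def)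
    obtain t where t: "t > 0" "ball x t \<subseteq> H_pipe" using open_H_pipe s(3) open_contains_ball by blast
    have "ball x (min t (s/2)) \<subseteq> S"
    proof
      fix y assume y: "y \<in> ball x (min t (s/2))"
      then have "ball y (s/2) \<subseteq> ball x s"
        by (intro ball_subset_ball_iff[THEN iffD2] disjI1) (auto simp: dist_commute)
      then have "Z (ball y (s/2))" using Zmono[OF s(2)] by (simp add: borel_open)
      then show "y \<in> S" using y t s by (auto simp: S_def intro!: exI[of _ "s/2"])
    qed
    then show "\<exists>e>0. ball x e \<subseteq> S" using t s by (intro exI[of _ "min t (s/2)"]) auto
  qed
  have oC: "open (H_pipe - S)" unfolding open_contains_ball
  proof
    fix y assume y: "y \<in> H_pipe - S"
    then obtain R where R: "R > 0" "cball y R \<subseteq> H_pipe" using open_H_pipe open_contains_cball by blast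
    \<comment> \<open>If the mass vanished near some x within R/8 of y, the chain step in the ball
      of radius R/2 about x would spread this to radius R/4, which covers the ball of radius R/8
      about y.\<close>
    have "ball y (R/8) \<subseteq> H_pipe - S"
    proof
      fix x assume x: "x \<in> ball y (R/8)"
      have "x \<in> cball y R" using x R(1) by simp
      then have xH: "x \<in> H_pipe" using R(2) by blast
      moreover have "x \<notin> S"
      proof
        assume "x \<in> S"
        then obtain s where s: "s > 0" "Z (ball x s)" by (auto simp: S_def)
        have "cball x (R/2) \<subseteq> cball y R" using x R by (intro cball_subset_cball_iff[THEN iffD2] disjI1) (auto simp: dist_commute)
        then have "Z (ball x (R/2/2))" using R by (intro Zchain[OF s(2,1)]) auto
        moreover have "ball y (R/8) \<subseteq> ball x (R/2/2)" using x R by (intro ball_subset_ball_iff[THEN iffD2] disjI1) auto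
        ultimately have "Z (ball y (R/8))" using Zmono by (meson borel_open open_ball)
        then show False using y R by (auto simp: S_def intro!: exI[of _ "R/8"])
      qed
      ultimately show "x \<in> H_pipe - S" by simp
    qed
    then show "\<exists>e>0. ball y e \<subseteq> H_pipe - S" using R by (intro exI[of _ "R/8"]) auto
  qed
  have "S \<inter> H_pipe = {} \<or> (H_pipe - S) \<inter> H_pipe = {}"
    by (rule connectedD[OF connected_H_pipe oS oC]) auto
  \<comment> \<open>The mass now vanishes near every point of the pipe, hence by a finite cover on
    the compact set of \<open>mass_compact\<close>, where it is bounded below.\<close>
  then have SH: "H_pipe \<subseteq> S" using pS assms(2) by blast
  obtain G c \<eta> where G: "compact G" "G \<subseteq> H_pipe" "c > 0" "\<eta> > 0" "\<And>u. nearmin \<eta> u \<Longrightarrow> c \<le> mass G u"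
  proof (rule mass_compact[OF assms(1)])
    fix G c \<eta> assume "compact G" "G \<subseteq> H_pipe" "c > 0" "\<eta> > 0" "\<And>u. nearmin \<eta> u \<Longrightarrow> c \<le> mass G u"
    then show thesis by (rule that)
  qed
  have "\<forall>x\<in>G. \<exists>s>0. Z (ball x s)" using SH G(2) by (auto simp: S_def)
  then obtain s where s: "\<And>x. x \<in> G \<Longrightarrow> s x > 0" "\<And>x. x \<in> G \<Longrightarrow> Z (ball x (s x))" by metis
  obtain I where I: "I \<subseteq> G" "finite I" "G \<subseteq> (\<Union>x\<in>I. ball x (s x))"
  proof (rule compactE_image[OF G(1), of G "\<lambda>x. ball x (s x)"])
    show "G \<subseteq> (\<Union>x\<in>G. ball x (s x))" using s(1) by force
  qed auto
  have l: "(\<lambda>k. \<Sum>x\<in>I. mass (ball x (s x)) (u k)) \<longlonglongrightarrow> (\<Sum>x\<in>I. 0)"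
    using s(2) I(1) by (intro tendsto_sum) (auto simp: Z_def)
  have "\<forall>\<^sub>F k in sequentially. (\<Sum>x\<in>I. mass (ball x (s x)) (u k)) < c"
    using order_tendstoD(2)[OF l] G(3) by simp
  moreover have "\<forall>\<^sub>F k in sequentially. 1 / real (Suc k) < \<eta>" using order_tendstoD(2)[OF inv0 G(4)] .
  ultimately have "\<forall>\<^sub>F k in sequentially. (\<Sum>x\<in>I. mass (ball x (s x)) (u k)) < c \<and> 1 / real (Suc k) < \<eta>"
    by (rule eventually_conj)
  then obtain k where k: "(\<Sum>x\<in>I. mass (ball x (s x)) (u k)) < c" "1 / real (Suc k) < \<eta>"
    using eventually_happens'[OF sequentially_bot] by blast
  have "dir (u k) \<le> lambda1 H_pipe + \<eta>" using nearminD(5)[OF u(1)[of k]] k(2) by linarith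
  then have "nearmin \<eta> (u k)" using u(1)[of k] unfolding nearmin_def by meson
  then have "c \<le> mass G (u k)" by (rule G(5))
  also have "\<dots> \<le> (\<Sum>x\<in>I. mass (ball x (s x)) (u k))"
    by (rule mass_UN_le[OF I(2) tu u0]) (use I G in \<open>auto intro: borel_open borel_closed compact_imp_closed\<close>)
  finally show False using k(1) by simp
qed

subsection \<open>The first eigenvalue lies below the threshold \<open>\<pi>\<^sup>2\<close>\<close>

lemma emeasure_annulus:
  assumes "0 \<le> x" "x < 1"
  shows "emeasure lborel {p::pt. norm p < 1 \<and> x < norm p} = ennreal (pi * (1 - x\<^sup>2))"
proof -
  have e: "{p::pt. norm p < 1 \<and> x < norm p} = ball 0 1 - cball 0 x" by auto
  have "emeasure lborel (ball 0 1 - cball 0 x :: pt set) = emeasure lborel (ball 0 1 :: pt set) - emeasure lborel (cball 0 x :: pt set)"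
    by (rule emeasure_Diff) (use assms in \<open>auto simp: emeasure_cball borel_closed borel_open\<close>)
  also have "\<dots> = ennreal pi - ennreal (pi * x\<^sup>2)"
    using assms emeasure_ball[of 1 "0::pt"] emeasure_cball[of x "0::pt"] by (simp add: unit_ball_vol_2 power2_eq_square)
  also have "\<dots> = ennreal (pi * (1 - x\<^sup>2))"
    using assms by (simp add: ennreal_minus right_diff_distrib)
  finally show ?thesis by (simp add: e)
qed

text \<open>Both measures are finite on the half lines above x and agree there, by the area of
  annuli. For negative \<open>r\<close> the density is zero because \<open>ennreal\<close>
  truncates.\<close>

lemma polar_measure:
  "distr (density lborel (indicator (ball (0::pt) 1))) borel norm
     = density lborel (\<lambda>r::real. ennreal (2 * pi * r) * indicator {..<1} r)" (is "?M = ?N")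
proof (rule measure_eqI_lessThan)
  have M: "emeasure ?M {x<..} = emeasure lborel {p::pt. norm p < 1 \<and> x < norm p}" for x
  proof -
    have "emeasure ?M {x<..} = (\<integral>\<^sup>+p. indicator (ball (0::pt) 1) p * indicator (norm -` {x<..}) p \<partial>lborel)"
    proof (subst emeasure_distr)
      have "norm -` {x<..} = {p::pt. x < norm p}" by auto
      then have "norm -` {x<..} \<in> sets (borel :: pt measure)" by (auto intro!: borel_open open_Collect_less continuous_intros)
      then show "emeasure (density lborel (indicator (ball (0::pt) 1))) (norm -` {x<..} \<inter> space (density lborel (indicator (ball 0 1))))
        = (\<integral>\<^sup>+p. indicator (ball (0::pt) 1) p * indicator (norm -` {x<..}) p \<partial>lborel)"
        by (subst emeasure_density) (auto simp: borel_open intro!: borel_measurable_indicator)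
    qed auto
    also have "\<dots> = (\<integral>\<^sup>+p. indicator {p::pt. norm p < 1 \<and> x < norm p} p \<partial>lborel)"
      by (intro nn_integral_cong) (auto simp: indicator_def)
    also have "\<dots> = emeasure lborel {p::pt. norm p < 1 \<and> x < norm p}"
      by (rule nn_integral_indicator) simp
    finally show ?thesis .
  qed
  have N: "emeasure ?N {x<..} = ennreal (pi * (1 - (max x 0)\<^sup>2))" if "x < 1" for x
  proof -
    have "emeasure ?N {x<..} = (\<integral>\<^sup>+r. ennreal (2 * pi * r) * indicator {..<1} r * indicator {x<..} r \<partial>lborel)"
      by (simp add: emeasure_density)
    also have "\<dots> = (\<integral>\<^sup>+r. ennreal (2 * pi * r) * indicator {max x 0..1} r \<partial>lborel)"
    proof (rule nn_integral_cong_AE)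
      have "AE r in lborel. r \<noteq> 1 \<and> r \<noteq> x" using AE_lborel_singleton[of 1] AE_lborel_singleton[of x] by eventually_elim simp
      then show "AE r in lborel. ennreal (2 * pi * r) * indicator {..<1} r * indicator {x<..} r = ennreal (2 * pi * r) * indicator {max x 0..1} r"
        by eventually_elim (auto simp: indicator_def ennreal_eq_0_iff mult_le_0_iff)
    qed
    also have "\<dots> = ennreal (pi * 1\<^sup>2 - pi * (max x 0)\<^sup>2)"
      by (rule nn_integral_FTC_Icc) (use that in \<open>auto intro!: derivative_eq_intros\<close>)
    finally show ?thesis by (simp add: right_diff_distrib)
  qed
  show "emeasure ?M {x<..} < \<infinity>" for x
  proof -
    have "emeasure lborel {p::pt. norm p < 1 \<and> x < norm p} < \<infinity>"
      by (rule emeasure_bounded_finite, rule bounded_subset[of "ball 0 1"]) auto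
    then show ?thesis by (simp add: M)
  qed
  show "emeasure ?M {x<..} = emeasure ?N {x<..}" for x
  proof (cases "x < 1")
    case True
    show ?thesis
    proof (cases "x < 0")
      case True
      then have "{p::pt. norm p < 1 \<and> x < norm p} = ball 0 1" by (auto intro: less_le_trans[OF _ norm_ge_zero])
      then show ?thesis using N[OF \<open>x < 1\<close>] True emeasure_ball[of 1 "0::pt"] by (simp add: M unit_ball_vol_2)
    next
      case False
      then show ?thesis using N[OF True] emeasure_annulus[of x] True by (simp add: M)
    qed
  next
    case False
    have "emeasure ?N {x<..} = (\<integral>\<^sup>+r. 0 \<partial>lborel)"
      using False by (simp add: emeasure_density, intro nn_integral_0_iff_AE[THEN iffD2]) (auto simp: indicator_def)
    moreover have e: "{p::pt. norm p < 1 \<and> x < norm p} = {}" using False by auto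
    have "emeasure ?M {x<..} = 0" unfolding M e by simp
    ultimately show ?thesis by simp
  qed
qed simp_all

text \<open>For sin (pi r), the squared gradient minus pi^2 times the square of the function is pi^2
  cos (2 pi r), and the polar weight r makes its integral exactly zero. This is why the trial
  function sits on the threshold.\<close>

lemma disc_integral_cos: "(\<integral>p. indicator (ball (0::pt) 1) p * cos (2 * pi * norm p) \<partial>lborel) = 0"
proof -
  have "(\<integral>p. indicator (ball (0::pt) 1) p * cos (2 * pi * norm p) \<partial>lborel)
      = (\<integral>p. cos (2 * pi * norm p) \<partial>density lborel (indicator (ball (0::pt) 1)))"
    using integral_density[of "\<lambda>p::pt. cos (2 * pi * norm p)" lborel "indicator (ball 0 1)"]
      by (simp add: ennreal_indicator borel_measurable_indicator borel_open)
  also have "\<dots> = (\<integral>r. cos (2 * pi * r) \<partial>density lborel (\<lambda>r::real. ennreal (2 * pi * r) * indicator {..<1} r))"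
    unfolding polar_measure[symmetric] by (subst integral_distr) auto
  also have "\<dots> = (\<integral>r. cos (2 * pi * r) \<partial>density lborel (\<lambda>r::real. ennreal (2 * pi * r * indicator {0..1} r)))"
  proof -
    have "density lborel (\<lambda>r::real. ennreal (2 * pi * r) * indicator {..<1} r) = density lborel (\<lambda>r::real. ennreal (2 * pi * r * indicator {0..1} r))"
    proof (rule density_cong)
      show "AE r in lborel. ennreal (2 * pi * r) * indicator {..<1} r = ennreal (2 * pi * r * indicator {0..1} r)"
        using AE_lborel_singleton[of 1] by eventually_elim (auto simp: indicator_def ennreal_eq_0_iff mult_le_0_iff)
    qed auto
    then show ?thesis by simp
  qed
  also have "\<dots> = (\<integral>r. (2 * pi * r * cos (2 * pi * r)) * indicator {0..1} r \<partial>lborel)"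
    by (subst integral_density) (auto simp: indicator_def mult_ac intro!: Bochner_Integration.integral_cong)
  also have "\<dots> = (1 * sin (2 * pi * 1) + cos (2 * pi * 1) / (2 * pi)) - (0 * sin (2 * pi * 0) + cos (2 * pi * 0) / (2 * pi))"
    by (rule integral_FTC_Icc_real) (auto intro!: derivative_eq_intros continuous_intros)
  also have "\<dots> = 0" by simp
  finally show ?thesis .
qed

lemma lborel_integral_uminus:
  fixes f :: "pt \<Rightarrow> real"
  assumes [measurable]: "f \<in> borel_measurable borel"
  shows "(\<integral>x. f (- x) \<partial>lborel) = (\<integral>x. f x \<partial>lborel)"
proof -
  have "(lborel :: pt measure) = density (distr lborel borel uminus) (\<lambda>_. 1)"
    using lborel_affine[of "-1" "0::pt"] by simp
  then have "(lborel :: pt measure) = distr lborel borel uminus" by (simp add: density_1)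
  then have "(\<integral>x. f x \<partial>lborel) = (\<integral>x. f x \<partial>distr lborel borel (uminus :: pt \<Rightarrow> pt))" by simp
  also have "\<dots> = (\<integral>x. f (- x) \<partial>lborel)" by (rule integral_distr) auto
  finally show ?thesis by simp
qed

text \<open>The integrand is even, so point reflection splits the integral over the disc into equal
  halves.\<close>

lemma half_disc_integral_cos:
  "(\<integral>p. indicator {p::pt. fst p < 0 \<and> norm p < 1} p * cos (2 * pi * norm p) \<partial>lborel) = 0"
proof -
  let ?h = "\<lambda>p::pt. cos (2 * pi * norm p)"
  let ?A = "{p::pt. fst p < 0 \<and> norm p < 1}" and ?B = "{p::pt. fst p > 0 \<and> norm p < 1}"
  have m: "?A \<in> sets borel" "?B \<in> sets borel"
    by (intro borel_open open_Collect_conj open_Collect_less continuous_intros)+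
  have b: "bounded ?A" "bounded ?B" by (rule bounded_subset[of "ball 0 1"]; auto)+
  have i: "integrable lborel (\<lambda>p. indicator S p * ?h p)" if "S \<in> sets borel" "bounded S" for S
  proof (rule Bochner_Integration.integrable_bound[of lborel "indicat_real S"])
    show "integrable lborel (indicat_real S)" using that emeasure_bounded_finite[OF that(2)] by simp
  qed (use that in \<open>auto simp: indicator_def abs_le_iff\<close>)
  have "(\<integral>p. indicator ?B p * ?h p \<partial>lborel) = (\<integral>p. indicator ?B (-p) * ?h (-p) \<partial>lborel)"
    using m by (subst lborel_integral_uminus) auto
  also have "\<dots> = (\<integral>p. indicator ?A p * ?h p \<partial>lborel)"
    by (intro Bochner_Integration.integral_cong) (auto simp: indicator_def)
  finally have eq: "(\<integral>p. indicator ?B p * ?h p \<partial>lborel) = (\<integral>p. indicator ?A p * ?h p \<partial>lborel)" .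
  have z: "AE p in lborel. fst (p::pt) \<noteq> 0"
  proof (rule AE_I[where N="{0} \<times> UNIV"])
    have "emeasure lborel ({0::real} \<times> (UNIV :: real set)) = 0"
      by (simp add: lborel_prod[symmetric] lborel.emeasure_pair_measure_Times)
    then show "emeasure lborel ({0::real} \<times> (UNIV :: real set)) = 0" .
  qed (auto simp: borel_closed closed_Times)
  have "0 = (\<integral>p. indicator (ball (0::pt) 1) p * ?h p \<partial>lborel)" by (simp add: disc_integral_cos)
  also have "\<dots> = (\<integral>p. indicator ?A p * ?h p + indicator ?B p * ?h p \<partial>lborel)"
  proof (rule integral_cong_AE)
    show "AE p in lborel. indicator (ball (0::pt) 1) p * ?h p = indicator ?A p * ?h p + indicator ?B p * ?h p"
      using z by eventually_elim (auto simp: indicator_def)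
    show "(\<lambda>p. indicator ?A p * ?h p + indicator ?B p * ?h p) \<in> borel_measurable lborel"
      by (rule borel_measurable_integrable) (intro Bochner_Integration.integrable_add i m b)
    show "(\<lambda>p. indicator (ball (0::pt) 1) p * ?h p) \<in> borel_measurable lborel"
      by (rule borel_measurable_integrable) (intro i borel_open open_ball bounded_ball)
  qed
  also have "\<dots> = 2 * (\<integral>p. indicator ?A p * ?h p \<partial>lborel)"
    using i[OF m(1) b(1)] i[OF m(2) b(2)] eq by simp
  finally show ?thesis by simp
qed

section \<open>The trial function and its energy\<close>

definition dstp :: "real \<Rightarrow> real" where "dstp = deriv stp"

lemma stp_deriv: "(stp has_real_derivative dstp t) (at t)"
proof -
  obtain F1 F2 where "\<And>t. (stp has_real_derivative F1 t) (at t)" by (rule smooth1_imp_deriv[OF smooth1_stp]) blast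
  then show ?thesis unfolding dstp_def by (metis DERIV_imp_deriv)
qed

lemma continuous_dstp: "continuous_on UNIV dstp"
proof -
  obtain F1 F2 where F: "\<And>t. (stp has_real_derivative F1 t) (at t)" "\<And>t. (F1 has_real_derivative F2 t) (at t)"
    by (rule smooth1_imp_deriv[OF smooth1_stp]) blast
  have "dstp = F1" using F(1) stp_deriv DERIV_unique by blast
  then show ?thesis using F(2) by (meson DERIV_isCont continuous_at_imp_continuous_on)
qed

text \<open>At these points \<open>stp\<close> takes its extreme values 0 and 1; this argument
  includes the end points 1/2 and 1.\<close>

lemma dstp_0: "t \<le> 1/2 \<or> t \<ge> 1 \<Longrightarrow> dstp t = 0"
proof (erule disjE)
  assume "t \<le> 1/2"
  then show ?thesis by (intro DERIV_local_min[OF stp_deriv, of 1]) (auto simp: stp_0 stp_nonneg)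
next
  assume "t \<ge> 1"
  then show ?thesis by (intro DERIV_local_max[OF stp_deriv, of 1]) (auto simp: stp_1 stp_le_1)
qed

lemma dstp_bounded: obtains C where "C \<ge> 1" "\<And>t. \<bar>dstp t\<bar> \<le> C"
proof -
  have "bounded (dstp ` {0..1})"
    by (rule compact_imp_bounded[OF compact_continuous_image[OF continuous_on_subset[OF continuous_dstp]]]) auto
  then obtain B where B: "\<And>t. t \<in> {0..1} \<Longrightarrow> \<bar>dstp t\<bar> \<le> B"
    unfolding bounded_iff by fastforce
  show ?thesis
  proof (rule that[of "max B 1"])
    fix t show "\<bar>dstp t\<bar> \<le> max B 1"
      using B[of t] dstp_0[of t] by (cases "t \<in> {0..1}") (auto simp: max_def)
  qed simp
qed

text \<open>The trial function \<open>sin (\<pi> \<rho>)\<close>, where \<open>\<rho>\<close> is the distance to the slit, has energy exactly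
  at the threshold. Here \<open>\<rho>\<close> and the sine are smoothed at scale \<open>a\<close>, and the function is cut off
  in the arms at distance \<open>L\<close>.\<close>

definition mj :: "real \<Rightarrow> real \<Rightarrow> real" where "mj d t = - t * stp (- t / d)"
definition fj :: "real \<Rightarrow> real \<Rightarrow> real" where "fj a s = sin (pi * s) * (stp (s / a) * stp ((1 - s) / a))"
definition qj :: "real \<Rightarrow> pt \<Rightarrow> real" where "qj d x = (mj d (fst x))\<^sup>2 + (snd x)\<^sup>2"
text \<open>\<open>mj d\<close> smooths the negative part of a number, and \<open>qj d\<close> the
  squared distance to the slit. The scale a/4 is small against the collar of width a/2 on which
  \<open>fj a\<close> vanishes, so the support stays inside the pipe although \<open>qj\<close>
  underestimates the distance.\<close>

definition trial :: "real \<Rightarrow> real \<Rightarrow> pt \<Rightarrow> real" where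
  "trial L a x = stp (1 - fst x / L) * fj a (sqrt (qj (a/4) x))"

definition dmj :: "real \<Rightarrow> real \<Rightarrow> real" where "dmj d t = - stp (- t / d) + t / d * dstp (- t / d)"
definition dfj :: "real \<Rightarrow> real \<Rightarrow> real" where
  "dfj a s = pi * cos (pi * s) * (stp (s / a) * stp ((1 - s) / a)) +
     sin (pi * s) / a * (dstp (s / a) * stp ((1 - s) / a) - stp (s / a) * dstp ((1 - s) / a))"

lemma stp_scaled_deriv:
  assumes "d \<noteq> 0"
  shows "((\<lambda>t. stp (t / d)) has_real_derivative dstp (t / d) / d) (at t)"
    "((\<lambda>t. stp ((c - t) / d)) has_real_derivative - dstp ((c - t) / d) / d) (at t)"
proof -
  show "((\<lambda>t. stp (t / d)) has_real_derivative dstp (t / d) / d) (at t)"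
    by (rule DERIV_chain2[OF stp_deriv, THEN DERIV_cong]) (use assms in \<open>auto intro!: derivative_eq_intros\<close>)
  show "((\<lambda>t. stp ((c - t) / d)) has_real_derivative - dstp ((c - t) / d) / d) (at t)"
    by (rule DERIV_chain2[OF stp_deriv, THEN DERIV_cong]) (use assms in \<open>auto intro!: derivative_eq_intros\<close>)
qed

lemma mj_deriv: "d > 0 \<Longrightarrow> (mj d has_real_derivative dmj d t) (at t)"
  unfolding mj_def[abs_def] dmj_def
  using stp_scaled_deriv(2)[of d 0 t]
  by (auto intro!: derivative_eq_intros simp: field_simps)

lemma fj_deriv: "a > 0 \<Longrightarrow> (fj a has_real_derivative dfj a s) (at s)"
  unfolding fj_def[abs_def] dfj_def
  by (auto intro!: derivative_eq_intros stp_scaled_deriv(1) stp_scaled_deriv(2) simp: field_simps)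

lemma fj_0: "a > 0 \<Longrightarrow> s \<le> a/2 \<or> s \<ge> 1 - a/2 \<Longrightarrow> fj a s = 0 \<and> dfj a s = 0"
  by (auto simp: fj_def dfj_def stp_0 dstp_0 field_simps)

lemma fj_sin: "a > 0 \<Longrightarrow> a \<le> s \<Longrightarrow> s \<le> 1 - a \<Longrightarrow> fj a s = sin (pi * s) \<and> dfj a s = pi * cos (pi * s)"
  by (simp add: fj_def dfj_def stp_1 dstp_0 field_simps)

lemma mj_0: "d > 0 \<Longrightarrow> t \<ge> - d/2 \<Longrightarrow> mj d t = 0 \<and> dmj d t = 0"
proof -
  assume "d > 0" "t \<ge> - d/2"
  then have "- t / d \<le> 1/2" by (simp add: field_simps)
  then have "stp (- t / d) = 0" "dstp (- t / d) = 0" by (auto intro: stp_0 dstp_0)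
  then show "mj d t = 0 \<and> dmj d t = 0" unfolding mj_def dmj_def by (simp only:) simp
qed

lemma mj_neg: "d > 0 \<Longrightarrow> t \<le> - d \<Longrightarrow> mj d t = - t \<and> dmj d t = - 1"
proof -
  assume "d > 0" "t \<le> - d"
  then have "- t / d \<ge> 1" by (simp add: field_simps)
  then have "stp (- t / d) = 1" "dstp (- t / d) = 0" by (auto intro: stp_1 dstp_0)
  then show "mj d t = - t \<and> dmj d t = - 1" unfolding mj_def dmj_def by (simp only:) simp
qed

text \<open>The cut-offs have slope of order 1/a, but only within distance \<open>a\<close> of the
  zeros 0 and 1 of the sine, where the sine is at most pi a. So the bounds are uniform in
  \<open>a\<close>.\<close>

lemma fj_bounds:
  assumes "\<And>t. \<bar>dstp t\<bar> \<le> C" "0 < a"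
  shows "\<bar>fj a s\<bar> \<le> 1" "\<bar>dfj a s\<bar> \<le> pi + 2 * (pi * C)"
proof -
  have C: "C \<ge> 0" using assms(1)[of 0] by simp
  have p: "\<bar>stp x * stp y\<bar> \<le> 1" for x y
    by (simp add: abs_mult stp_nonneg stp_le_1 mult_le_one)
  show "\<bar>fj a s\<bar> \<le> 1" unfolding fj_def abs_mult[of "sin (pi * s)"] using p[of "s/a" "(1-s)/a"]
    by (intro mult_le_one) simp_all
  have k: "\<bar>sin (pi * s) / a * dstp (t / a)\<bar> \<le> pi * C" if "\<bar>sin (pi * s)\<bar> \<le> pi * \<bar>t\<bar>" for t
  proof (cases "1/2 < t / a \<and> t / a < 1")
    case True
    then have "0 < t / a" by linarith
    then have t0: "0 < t" using assms(2) by (simp add: zero_less_divide_iff)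
    have "t < a" using True assms(2) by (simp add: pos_divide_less_eq)
    then have "\<bar>sin (pi * s)\<bar> \<le> pi * a" using that t0 by (smt (verit) mult_left_mono pi_gt_zero)
    then have "\<bar>sin (pi * s) / a\<bar> \<le> pi" using assms(2) by (simp add: abs_divide pos_divide_le_eq)
    then show ?thesis unfolding abs_mult using assms(1) by (intro mult_mono) auto
  next
    case False
    then have "dstp (t / a) = 0" by (intro dstp_0) auto
    then show ?thesis using C by simp
  qed
  have s1: "\<bar>sin (pi * s)\<bar> \<le> pi * \<bar>s\<bar>" using abs_sin_x_le_abs_x[of "pi * s"] by (simp add: abs_mult)
  have s2: "\<bar>sin (pi * s)\<bar> \<le> pi * \<bar>1 - s\<bar>"
  proof -
    have "sin (pi * s) = sin (pi * (1 - s))" by (simp add: right_diff_distrib)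
    then show ?thesis using abs_sin_x_le_abs_x[of "pi * (1 - s)"] by (simp add: abs_mult)
  qed
  have a1: "\<bar>pi * cos (pi * s) * (stp (s / a) * stp ((1 - s) / a))\<bar> \<le> pi * 1 * 1"
    unfolding abs_mult[of "pi * cos (pi * s)"] abs_mult[of pi] using p by (intro mult_mono) auto
  have a2: "\<bar>sin (pi * s) / a * (dstp (s / a) * stp ((1 - s) / a))\<bar> \<le> pi * C * 1"
  proof -
    have "\<bar>(sin (pi * s) / a * dstp (s / a)) * stp ((1 - s) / a)\<bar> \<le> pi * C * 1"
      unfolding abs_mult[of _ "stp ((1 - s) / a)"] using k[OF s1] by (intro mult_mono) (auto simp: stp_le_1 stp_nonneg C)
    then show ?thesis by (simp only: mult.assoc)
  qed
  have a3: "\<bar>sin (pi * s) / a * (stp (s / a) * dstp ((1 - s) / a))\<bar> \<le> pi * C * 1"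
  proof -
    have "\<bar>(sin (pi * s) / a * dstp ((1 - s) / a)) * stp (s / a)\<bar> \<le> pi * C * 1"
      unfolding abs_mult[of _ "stp (s / a)"] using k[OF s2] by (intro mult_mono) (auto simp: stp_le_1 stp_nonneg C)
    then show ?thesis by (simp only: mult.assoc mult.commute[of "stp (s/a)"])
  qed
  show "\<bar>dfj a s\<bar> \<le> pi + 2 * (pi * C)"
  proof -
    have "\<bar>x + (y - z)\<bar> \<le> pi + 2 * (pi * C)" if "\<bar>x\<bar> \<le> pi * 1 * 1" "\<bar>y\<bar> \<le> pi * C * 1" "\<bar>z\<bar> \<le> pi * C * 1" for x y z
      using that by linarith
    from this[OF a1 a2 a3] show ?thesis unfolding dfj_def right_diff_distrib .
  qed
qed

text \<open>Again uniform in the scale: \<open>dstp (- t / d)\<close> vanishes unless |t| <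
  d.\<close>

lemma mj_bounds:
  assumes "\<And>t. \<bar>dstp t\<bar> \<le> C" "0 < d"
  shows "\<bar>dmj d t\<bar> \<le> 1 + C"
proof -
  have C: "C \<ge> 0" using assms(1)[of 0] by simp
  have "\<bar>(t / d) * dstp (- t / d)\<bar> \<le> 1 * C"
  proof (cases "1/2 < - t / d \<and> - t / d < 1")
    case True
    then have "\<bar>t / d\<bar> \<le> 1" by linarith
    then show ?thesis unfolding abs_mult using assms(1) by (intro mult_mono) auto
  next
    case False
    then have "dstp (- t / d) = 0" by (intro dstp_0) auto
    then show ?thesis using C by simp
  qed
  moreover have "\<bar>stp (- t / d)\<bar> \<le> 1" by (simp add: stp_le_1 stp_nonneg)
  ultimately show ?thesis unfolding dmj_def by linarith
qed

lemma smooth_mj: "d > 0 \<Longrightarrow> open U \<Longrightarrow> smoothOn U (\<lambda>x. mj d (fst x))"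
proof -
  assume "d > 0" "open U"
  then have "smoothOn U (\<lambda>x. (0 - fst x) * stp ((0 - fst x) / d))"
    by (intro smoothOn_mult smoothOn_diff smoothOn_const smoothOn_fst smoothOn_stp smoothOn_divide) auto
  then show ?thesis by (simp add: mj_def)
qed

lemma smooth_qj: "d > 0 \<Longrightarrow> open U \<Longrightarrow> smoothOn U (qj d)"
  unfolding qj_def[abs_def] by (intro smoothOn_add smoothOn_power smooth_mj smoothOn_snd)

text \<open>The square root is singular where \<open>qj\<close> vanishes, but the function is zero
  on the open set where \<open>qj\<close> is below (a/2)^2.\<close>

lemma smooth_trial:
  assumes "a > 0" "L > 0" shows "smoothOn UNIV (trial L a)"
proof -
  let ?d = "a/4"
  have d: "?d > 0" using assms by simp
  have cq: "continuous_on UNIV (qj ?d)" by (rule smoothOn_continuous[OF smooth_qj[OF d open_UNIV]])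
  let ?U = "{x. qj ?d x > 0}" and ?V = "{x. qj ?d x < (a/2)\<^sup>2}"
  have o: "open ?U" "open ?V" using cq by (auto intro!: open_Collect_less continuous_intros)
  have s: "smoothOn ?U (\<lambda>x. sqrt (qj ?d x))" by (intro smoothOn_sqrt smooth_qj d o) simp
  have "smoothOn ?U (trial L a)"
    unfolding trial_def[abs_def] fj_def
    by (intro smoothOn_mult smoothOn_stp smoothOn_diff smoothOn_const smoothOn_divide smoothOn_sin smoothOn_fst s o) (use assms in auto)
  moreover have "smoothOn ?V (trial L a)"
  proof (rule smoothOn_cong[OF o(2), of "\<lambda>x. 0"])
    fix x assume "x \<in> ?V"
    then have "sqrt (qj ?d x) \<le> a/2" using assms by (intro real_le_lsqrt) auto
    then show "0 = trial L a x" using fj_0[OF assms(1)] by (simp add: trial_def)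
  qed (rule smoothOn_const)
  ultimately have "smoothOn (?U \<union> ?V) (trial L a)" using o smoothOn_Un by blast
  moreover have "?U \<union> ?V = UNIV" using assms(1) by (auto simp: not_less intro: le_less_trans)
  ultimately show ?thesis by simp
qed

lemma trial_support:
  assumes "0 < a" "a \<le> 1/10" "L > 0" "trial L a x \<noteq> 0"
  shows "a/2 \<le> sqrt (qj (a/4) x)" "sqrt (qj (a/4) x) \<le> 1 - a/2" "fst x \<le> L"
proof -
  have f: "fj a (sqrt (qj (a/4) x)) \<noteq> 0" "stp (1 - fst x / L) \<noteq> 0" using assms(4) by (auto simp: trial_def)
  show "a/2 \<le> sqrt (qj (a/4) x)" "sqrt (qj (a/4) x) \<le> 1 - a/2" using fj_0[OF assms(1)] f(1) by (meson linear)+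
  have "\<not> 1 - fst x / L \<le> 1/2" using f(2) stp_0 by blast
  then have "fst x / L < 1" by linarith
  then show "fst x \<le> L" using assms(3) by (simp add: pos_divide_less_eq)
qed

lemma qj_box:
  assumes "0 < a" "a \<le> 1/10" "sqrt (qj (a/4) x) \<le> 1"
  shows "-1 \<le> fst x" "\<bar>snd x\<bar> \<le> 1"
proof -
  have q: "qj (a/4) x \<le> 1" using assms(3) by simp
  have "(snd x)\<^sup>2 \<le> 1" "(mj (a/4) (fst x))\<^sup>2 \<le> 1" using q unfolding qj_def by (smt (verit) zero_le_power2)+
  then have s: "\<bar>snd x\<bar> \<le> 1" "\<bar>mj (a/4) (fst x)\<bar> \<le> 1" by (simp_all add: abs_square_le_1)
  show "\<bar>snd x\<bar> \<le> 1" by fact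
  show "-1 \<le> fst x"
  proof (rule ccontr)
    assume "\<not> -1 \<le> fst x"
    then show False using s(2) mj_neg[of "a/4" "fst x"] assms by auto
  qed
qed

lemma test_trial:
  assumes "0 < a" "a \<le> 1/10" "L > 0" shows "test_fun H_pipe (trial L a)"
proof -
  let ?d = "a/4"
  have d: "?d > 0" using assms by simp
  have cq: "continuous_on UNIV (\<lambda>x. sqrt (qj ?d x))"
    by (intro continuous_intros smoothOn_continuous[OF smooth_qj[OF d open_UNIV]])
  let ?K = "{x. a/2 \<le> sqrt (qj ?d x)} \<inter> {x. sqrt (qj ?d x) \<le> 1 - a/2} \<inter> {x. fst x \<le> L}"
  have "closed ?K" by (intro closed_Int closed_Collect_le cq continuous_on_const continuous_on_fst continuous_on_id)
  moreover have "bounded ?K"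
  proof (rule bounded_subset[of "cbox (-1,-1) (L,1)"])
    show "?K \<subseteq> cbox (-1,-1) (L,1)"
    proof
      fix x assume x: "x \<in> ?K"
      then have "sqrt (qj ?d x) \<le> 1 - a/2" by blast
      then have "sqrt (qj ?d x) \<le> 1" using assms(1) by linarith
      from qj_box[OF assms(1,2) this] x show "x \<in> cbox (-1,-1) (L,1)"
        by (cases x) (auto simp: cbox_Pair_eq abs_le_iff)
    qed
  qed simp
  ultimately have cK: "compact ?K" by (simp add: compact_eq_bounded_closed)
  have "?K \<subseteq> H_pipe"
  proof
    fix x assume x: "x \<in> ?K"
    have q2: "qj ?d x \<le> (1 - a/2)\<^sup>2" using x assms by (simp add: sqrt_le_D)
    \<comment> \<open>For - a/4 < x1 < 0 the smoothed distance may ignore x1; the collar at the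
      circle leaves room for the missing (a/4)^2.\<close>
    have lt1: "(1 - a/2)\<^sup>2 + ?d\<^sup>2 < 1" using assms(1,2) by (simp add: power2_eq_square algebra_simps)
    consider "fst x \<ge> 0" | "fst x \<le> - ?d" | "- ?d < fst x" "fst x < 0" by linarith
    then show "x \<in> H_pipe"
    proof cases
      case 1
      then have "mj ?d (fst x) = 0" using mj_0[OF d] d by simp
      then have "sqrt (qj ?d x) = \<bar>snd x\<bar>" by (simp add: qj_def)
      then have "a/2 \<le> \<bar>snd x\<bar>" "\<bar>snd x\<bar> \<le> 1 - a/2" using x by auto
      then show ?thesis using 1 assms(1) unfolding mem_H_pipe by linarith
    next
      case 2
      then have "mj ?d (fst x) = - fst x" using mj_neg[OF d] by simp
      then have "(fst x)\<^sup>2 + (snd x)\<^sup>2 < 1" using q2 lt1 d unfolding qj_def by (smt (verit) power2_minus zero_le_power2)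
      then show ?thesis using 2 d unfolding mem_H_pipe by linarith
    next
      case 3
      have "(snd x)\<^sup>2 \<le> (1 - a/2)\<^sup>2" using q2 unfolding qj_def by (smt (verit) zero_le_power2)
      moreover have "(fst x)\<^sup>2 \<le> ?d\<^sup>2" using 3 by (intro power2_le_iff_abs_le[THEN iffD2]) auto
      ultimately have "(fst x)\<^sup>2 + (snd x)\<^sup>2 < 1" using lt1 by linarith
      then show ?thesis using 3 unfolding mem_H_pipe by linarith
    qed
  qed
  then show ?thesis
    by (rule test_funI[OF smooth_trial[OF assms(1,3)] cK]) (use trial_support[OF assms] in blast)
qed

lemma pd_trial:
  assumes "0 < a" "L > 0" "qj (a/4) x > 0"
  shows "pd (trial L a)
     (- dstp (1 - fst x / L) / L * fj a (sqrt (qj (a/4) x)) +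
        stp (1 - fst x / L) * (dfj a (sqrt (qj (a/4) x)) * (mj (a/4) (fst x) * dmj (a/4) (fst x) / sqrt (qj (a/4) x))))
     (stp (1 - fst x / L) * (dfj a (sqrt (qj (a/4) x)) * (snd x / sqrt (qj (a/4) x)))) x"
proof -
  let ?d = "a/4"
  have d: "?d > 0" using assms by simp
  let ?m = "mj ?d (fst x)" and ?s = "sqrt (qj ?d x)"
  have pm: "pd (\<lambda>x. mj ?d (fst x)) (dmj ?d (fst x) * 1) (dmj ?d (fst x) * 0) x"
    by (rule pd_comp[OF mj_deriv[OF d] pd_fst])
  have pq: "pd (qj ?d) (2 * ?m * dmj ?d (fst x)) (2 * snd x) x"
    unfolding qj_def[abs_def] power2_eq_square
    by (rule pd_eq[OF pd_add[OF pd_mult[OF pm pm] pd_mult[OF pd_snd pd_snd]]]) auto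
  have ds: "((\<lambda>q. fj a (sqrt q)) has_real_derivative dfj a ?s * (inverse ?s / 2)) (at (qj ?d x))"
    by (rule DERIV_chain2[OF fj_deriv[OF assms(1)] DERIV_real_sqrt[OF assms(3)]])
  have dc: "((\<lambda>t. stp (1 - t / L)) has_real_derivative - dstp (1 - fst x / L) / L) (at (fst x))"
    by (rule DERIV_chain2[OF stp_deriv, THEN DERIV_cong]) (use assms(2) in \<open>auto intro!: derivative_eq_intros\<close>)
  show ?thesis
    unfolding trial_def[abs_def]
    by (rule pd_eq[OF pd_mult[OF pd_comp[OF dc pd_fst] pd_comp[OF ds pq]]]) (auto simp: field_simps)
qed

definition ij :: "real \<Rightarrow> real \<Rightarrow> pt \<Rightarrow> real" where
  "ij L a x = dotg (trial L a) (trial L a) x - pi\<^sup>2 * (trial L a x)\<^sup>2"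

text \<open>The pointwise limit of \<open>ij L a\<close> as \<open>a\<close> tends to 0. The terms
  with cos (2 pi r) in the half disc and cos (2 pi |x2|) in the arms integrate to zero; what
  survives is the slope of the longitudinal cut-off, of order 1/L.\<close>

definition ilim :: "real \<Rightarrow> pt \<Rightarrow> real" where
  "ilim L x = (if fst x < 0 then (if norm x < 1 then pi\<^sup>2 * cos (2 * pi * norm x) else 0)
     else if 0 < \<bar>snd x\<bar> \<and> \<bar>snd x\<bar> < 1 then (dstp (1 - fst x / L) / L * sin (pi * \<bar>snd x\<bar>))\<^sup>2
         + (stp (1 - fst x / L))\<^sup>2 * (pi\<^sup>2 * cos (2 * pi * \<bar>snd x\<bar>)) else 0)"

lemma ij_small:
  assumes "0 < a" "L > 0" "sqrt (qj (a/4) x) < a/2"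
  shows "ij L a x = 0"
proof -
  have cq: "continuous_on UNIV (\<lambda>x. sqrt (qj (a/4) x))"
    using assms(1) by (intro continuous_intros smoothOn_continuous[OF smooth_qj[OF _ open_UNIV]]) auto
  let ?V = "{x. sqrt (qj (a/4) x) < a/2}"
  have "open ?V" by (intro open_Collect_less cq continuous_on_const)
  have "pd (trial L a) 0 0 x"
    by (rule pd_cong[OF \<open>open ?V\<close> _ _ pd_const[of 0]]) (use assms fj_0[OF assms(1)] in \<open>auto simp: trial_def\<close>)
  from pdD(1,2)[OF this] show ?thesis using fj_0[OF assms(1)] assms(3) by (simp add: ij_def dotg_def trial_def)
qed

lemma ij_eq:
  assumes "0 < a" "L > 0" "qj (a/4) x > 0"
  defines "s \<equiv> sqrt (qj (a/4) x)" and "c \<equiv> stp (1 - fst x / L)" and "c' \<equiv> dstp (1 - fst x / L) / L"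
  shows "ij L a x = (- c' * fj a s + c * (dfj a s * (mj (a/4) (fst x) * dmj (a/4) (fst x) / s)))\<^sup>2
     + (c * (dfj a s * (snd x / s)))\<^sup>2 - pi\<^sup>2 * (c * fj a s)\<^sup>2"
  unfolding ij_def dotg_def pdD(1,2)[OF pd_trial[OF assms(1-3)]] trial_def s_def c_def c'_def
  by (simp add: power2_eq_square)

text \<open>The smoothing scale enters only through uniformly bounded factors, so one constant on
  one box dominates all these densities.\<close>

lemma ij_bound:
  assumes "\<And>t. \<bar>dstp t\<bar> \<le> C" "L > 0"
  obtains W where "W \<ge> 0" "\<And>a x. 0 < a \<Longrightarrow> a \<le> 1/10 \<Longrightarrow> \<bar>ij L a x\<bar> \<le> W * indicator (cbox (-1,-1) (L,1)) x"
proof -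
  have C: "C \<ge> 0" using assms(1)[of 0] by simp
  define B where "B = pi + 2 * (pi * C)"
  have B: "B \<ge> 0" using C by (simp add: B_def)
  define W where "W = (C / L * 1 + 1 * (B * (1 + C)))\<^sup>2 + (1 * (B * 1))\<^sup>2 + pi\<^sup>2 * 1"
  show ?thesis
  proof (rule that[of W])
    show W0: "W \<ge> 0" by (simp add: W_def)
    fix a :: real and x assume a: "0 < a" "a \<le> 1/10"
    define s where "s = sqrt (qj (a/4) x)"
    have wi: "W * indicator (cbox (-1,-1) (L,1)) x \<ge> 0" using W0 by simp
    consider "s < a/2" | "s \<ge> a/2" "s > 1 - a/2 \<or> fst x > L" | "s \<ge> a/2" "s \<le> 1 - a/2" "fst x \<le> L" by linarith
    then show "\<bar>ij L a x\<bar> \<le> W * indicator (cbox (-1,-1) (L,1)) x"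
    proof cases
      case 1
      then show ?thesis using ij_small[OF a(1) assms(2)] wi by (simp add: s_def)
    next
      case 2
      have "s > 0" using 2 a by linarith
      then have q: "qj (a/4) x > 0" by (simp add: s_def)
      have "ij L a x = 0"
      proof (cases "fst x > L")
        case True
        then have "1 - fst x / L \<le> 1/2" using assms(2) by (simp add: field_simps)
        then show ?thesis unfolding ij_eq[OF a(1) assms(2) q] using stp_0 dstp_0 by simp
      next
        case False
        then have "fj a s = 0 \<and> dfj a s = 0" using 2 by (intro fj_0 a) auto
        then show ?thesis unfolding ij_eq[OF a(1) assms(2) q] s_def[symmetric] by simp
      qed
      then show ?thesis using wi by simp
    next
      case 3
      have sp: "s > 0" using 3 a by linarith
      then have q: "qj (a/4) x > 0" by (simp add: s_def)
      have s2: "s\<^sup>2 = (mj (a/4) (fst x))\<^sup>2 + (snd x)\<^sup>2" using q by (simp add: s_def qj_def)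
      have m: "\<bar>mj (a/4) (fst x)\<bar> \<le> s" "\<bar>snd x\<bar> \<le> s"
        using s2 sp by (auto intro!: abs_le_square_iff[THEN iffD2, of _ s, simplified abs_of_pos[OF sp]])
      have ms: "\<bar>mj (a/4) (fst x) / s\<bar> \<le> 1" "\<bar>snd x / s\<bar> \<le> 1"
        using m sp by (simp_all add: abs_divide)
      have dm: "\<bar>dmj (a/4) (fst x)\<bar> \<le> 1 + C" using mj_bounds[of C "a/4"] assms(1) a by simp
      note f = fj_bounds[of C a s, OF assms(1) a(1), folded B_def]
      let ?c = "stp (1 - fst x / L)" and ?c' = "dstp (1 - fst x / L) / L"
      have c: "\<bar>?c\<bar> \<le> 1" "\<bar>?c'\<bar> \<le> C / L"
        using assms by (simp_all add: stp_le_1 stp_nonneg abs_divide divide_right_mono)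
      have "\<bar>mj (a/4) (fst x) * dmj (a/4) (fst x) / s\<bar> \<le> 1 * (1 + C)"
      proof -
        have "\<bar>mj (a/4) (fst x) / s * dmj (a/4) (fst x)\<bar> \<le> 1 * (1 + C)"
          unfolding abs_mult using ms dm by (intro mult_mono) auto
        then show ?thesis by simp
      qed
      then have "\<bar>dfj a s * (mj (a/4) (fst x) * dmj (a/4) (fst x) / s)\<bar> \<le> B * (1 + C)"
        unfolding abs_mult[of "dfj a s"] using f B by (intro mult_mono) auto
      then have "\<bar>?c * (dfj a s * (mj (a/4) (fst x) * dmj (a/4) (fst x) / s))\<bar> \<le> 1 * (B * (1 + C))"
        unfolding abs_mult[of ?c] using c by (intro mult_mono) auto
      moreover have "\<bar>- ?c' * fj a s\<bar> \<le> C / L * 1"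
        unfolding abs_mult using c f C assms(2) by (intro mult_mono) auto
      ultimately have "\<bar>- ?c' * fj a s + ?c * (dfj a s * (mj (a/4) (fst x) * dmj (a/4) (fst x) / s))\<bar> \<le> C / L * 1 + 1 * (B * (1 + C))"
        by (rule order_trans[OF abs_triangle_ineq add_mono, rotated])
      then have A1: "(- ?c' * fj a s + ?c * (dfj a s * (mj (a/4) (fst x) * dmj (a/4) (fst x) / s)))\<^sup>2 \<le> (C / L * 1 + 1 * (B * (1 + C)))\<^sup>2"
        by (intro abs_le_square_iff[THEN iffD1]) simp
      have "\<bar>dfj a s * (snd x / s)\<bar> \<le> B * 1"
        unfolding abs_mult[of "dfj a s"] using f B ms by (intro mult_mono) auto
      then have "\<bar>?c * (dfj a s * (snd x / s))\<bar> \<le> 1 * (B * 1)"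
        unfolding abs_mult[of ?c] using c by (intro mult_mono) auto
      then have A2: "(?c * (dfj a s * (snd x / s)))\<^sup>2 \<le> (1 * (B * 1))\<^sup>2"
        by (intro abs_le_square_iff[THEN iffD1]) simp
      have "\<bar>?c * fj a s\<bar> \<le> 1" unfolding abs_mult using c f by (intro mult_le_one) auto
      then have "(?c * fj a s)\<^sup>2 \<le> 1" by (simp add: abs_square_le_1)
      then have A3: "pi\<^sup>2 * (?c * fj a s)\<^sup>2 \<le> pi\<^sup>2 * 1" by (intro mult_left_mono) auto
      have gen: "\<bar>p + q - r\<bar> \<le> P + Q + R" if "0 \<le> p" "0 \<le> q" "0 \<le> r" "p \<le> P" "q \<le> Q" "r \<le> R" for p q r P Q R :: real
        using that by linarith
      have "\<bar>ij L a x\<bar> \<le> W" unfolding ij_eq[OF a(1) assms(2) q] s_def[symmetric] W_def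
        by (rule gen[OF _ _ _ A1 A2 A3]) auto
      moreover have "s \<le> 1" using 3(2) a(1) by linarith
      then have "x \<in> cbox (-1,-1) (L,1)" using qj_box[OF a, of x] 3(3) unfolding s_def
        by (cases x) (auto simp: cbox_Pair_eq abs_le_iff)
      ultimately show ?thesis by simp
    qed
  qed
qed

lemma cos_double_sq: "A\<^sup>2 * (cos t)\<^sup>2 - A\<^sup>2 * (sin t)\<^sup>2 = A\<^sup>2 * cos (2 * t)" for A :: real
  by (simp add: cos_double right_diff_distrib)

text \<open>Smoothing acts only within a distance of order \<open>a\<close> from the walls, the slit
  and the line x1 = 0, so at a fixed point the density eventually equals its limit.\<close>

lemma ij_limit:
  assumes "L > 0"
  shows "\<exists>a0>0. \<forall>a. 0 < a \<and> a \<le> a0 \<longrightarrow> ij L a x = ilim L x"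
proof (cases "fst x < 0")
  case True
  define r where "r = norm x"
  have r2: "r\<^sup>2 = (fst x)\<^sup>2 + (snd x)\<^sup>2" by (simp add: r_def norm_prod_def)
  have r0: "r > 0" using True by (auto simp: r_def)
  have c: "stp (1 - fst x / L) = 1" "dstp (1 - fst x / L) = 0"
    using True assms by (auto intro!: stp_1 dstp_0 simp: divide_nonpos_pos)
  have base: "qj (a/4) x = r\<^sup>2" "mj (a/4) (fst x) = - fst x" "dmj (a/4) (fst x) = -1" if "0 < a" "a \<le> - fst x" for a
    using mj_neg[of "a/4" "fst x"] that by (auto simp: qj_def r2)
  show ?thesis
  proof (cases "r < 1")
    case r1: True
    show ?thesis
    proof (intro exI[of _ "min (- fst x) (min r (1 - r))"] conjI allI impI)
      show "0 < min (- fst x) (min r (1 - r))" using True r0 r1 by simp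
      fix a assume a: "0 < a \<and> a \<le> min (- fst x) (min r (1 - r))"
      have b: "qj (a/4) x = r\<^sup>2" "mj (a/4) (fst x) = - fst x" "dmj (a/4) (fst x) = -1" using base a by auto
      have s: "sqrt (qj (a/4) x) = r" using b r0 by simp
      have f: "fj a r = sin (pi * r)" "dfj a r = pi * cos (pi * r)" using fj_sin[of a r] a by auto
      have "ij L a x = (pi * cos (pi * r) * (fst x / r))\<^sup>2 + (pi * cos (pi * r) * (snd x / r))\<^sup>2 - pi\<^sup>2 * (sin (pi * r))\<^sup>2"
        using ij_eq[of a L x] a assms r0 unfolding s b(2,3) f c by (simp add: b(1))
      also have "(pi * cos (pi * r) * (fst x / r))\<^sup>2 + (pi * cos (pi * r) * (snd x / r))\<^sup>2
          = pi\<^sup>2 * (cos (pi * r))\<^sup>2 * (((fst x)\<^sup>2 + (snd x)\<^sup>2) / r\<^sup>2)"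
        by (simp add: power_mult_distrib power_divide add_divide_distrib distrib_left)
      also have "\<dots> = pi\<^sup>2 * (cos (pi * r))\<^sup>2" using r0 by (simp flip: r2)
      finally have "ij L a x = pi\<^sup>2 * cos (2 * (pi * r))" by (simp add: cos_double_sq)
      then show "ij L a x = ilim L x" using True r1 by (simp add: ilim_def r_def mult.assoc)
    qed
  next
    case False
    show ?thesis
    proof (intro exI[of _ "- fst x"] conjI allI impI)
      show "0 < - fst x" using True by simp
      fix a assume a: "0 < a \<and> a \<le> - fst x"
      have b: "qj (a/4) x = r\<^sup>2" using base a by auto
      have s: "sqrt (qj (a/4) x) = r" using b r0 by simp
      have f: "fj a r = 0" "dfj a r = 0" using fj_0[of a r] a False by auto
      show "ij L a x = ilim L x" using ij_eq[of a L x] a assms r0 False True unfolding s f by (simp add: b ilim_def r_def)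
    qed
  qed
next
  case False
  have base: "qj (a/4) x = (snd x)\<^sup>2" "mj (a/4) (fst x) = 0" "dmj (a/4) (fst x) = 0" if "0 < a" for a
    using mj_0[of "a/4" "fst x"] that False by (auto simp: qj_def)
  define r where "r = \<bar>snd x\<bar>"
  have r2: "r\<^sup>2 = (snd x)\<^sup>2" by (simp add: r_def)
  show ?thesis
  proof (cases "0 < r \<and> r < 1")
    case True
    show ?thesis
    proof (intro exI[of _ "min r (1 - r)"] conjI allI impI)
      show "0 < min r (1 - r)" using True by simp
      fix a assume a: "0 < a \<and> a \<le> min r (1 - r)"
      have b: "qj (a/4) x = r\<^sup>2" "mj (a/4) (fst x) = 0" "dmj (a/4) (fst x) = 0" using base a r2 by auto
      have s: "sqrt (qj (a/4) x) = r" using b True by simp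
      have f: "fj a r = sin (pi * r)" "dfj a r = pi * cos (pi * r)" using fj_sin[of a r] a by auto
      let ?c = "stp (1 - fst x / L)" and ?c' = "dstp (1 - fst x / L) / L"
      have sr: "(snd x / r)\<^sup>2 = 1" using True unfolding r_def by (simp add: power_divide)
      have "ij L a x = (?c' * sin (pi * r))\<^sup>2 + (?c * (pi * cos (pi * r) * (snd x / r)))\<^sup>2 - pi\<^sup>2 * (?c * sin (pi * r))\<^sup>2"
        using ij_eq[of a L x] a assms True unfolding s b(2,3) f by (simp add: b(1))
      also have "(?c * (pi * cos (pi * r) * (snd x / r)))\<^sup>2 = ?c\<^sup>2 * (pi\<^sup>2 * (cos (pi * r))\<^sup>2)"
        unfolding power_mult_distrib sr by simp
      also have "(?c' * sin (pi * r))\<^sup>2 + ?c\<^sup>2 * (pi\<^sup>2 * (cos (pi * r))\<^sup>2) - pi\<^sup>2 * (?c * sin (pi * r))\<^sup>2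
         = (?c' * sin (pi * r))\<^sup>2 + ?c\<^sup>2 * (pi\<^sup>2 * (cos (pi * r))\<^sup>2 - pi\<^sup>2 * (sin (pi * r))\<^sup>2)"
        by (simp add: power_mult_distrib algebra_simps)
      finally show "ij L a x = ilim L x" unfolding cos_double_sq using False True by (simp add: ilim_def r_def mult.assoc)
    qed
  next
    case r: False
    show ?thesis
    proof (intro exI[of _ 1] conjI allI impI)
      fix a :: real assume a: "0 < a \<and> a \<le> 1"
      have b: "qj (a/4) x = r\<^sup>2" using base a r2 by auto
      have r0: "r \<ge> 0" by (simp add: r_def)
      have s: "sqrt (qj (a/4) x) = r" using b r0 by simp
      have z: "ilim L x = 0" using False r by (auto simp: ilim_def r_def)
      show "ij L a x = ilim L x"
      proof (cases "r = 0")
        case True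
        then show ?thesis using ij_small[of a L x] a assms s z by simp
      next
        case False
        then have "fj a r = 0" "dfj a r = 0" using fj_0[of a r] a r r0 by auto
        then show ?thesis using ij_eq[of a L x] a assms r0 False z unfolding s by (simp add: b)
      qed
    qed simp
  qed
qed

text \<open>A full period of the cosine integrates to zero across each arm, whatever the
  longitudinal weight \<open>f1\<close> is.\<close>

lemma integral_cos_strip:
  assumes [measurable]: "f1 \<in> borel_measurable borel" and "\<And>t. \<bar>f1 t\<bar> \<le> B" "\<And>t. t \<notin> {0..L} \<Longrightarrow> f1 t = 0"
  shows "(\<integral>x. f1 (fst x) * (indicator {y. 0 < \<bar>y\<bar> \<and> \<bar>y\<bar> < 1} (snd x) * cos (2 * pi * \<bar>snd x\<bar>)) \<partial>(lborel::pt measure)) = 0"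
    "integrable (lborel::pt measure) (\<lambda>x. f1 (fst x) * (indicator {y. 0 < \<bar>y\<bar> \<and> \<bar>y\<bar> < 1} (snd x) * cos (2 * pi * \<bar>snd x\<bar>)))"
proof -
  let ?f2 = "\<lambda>y::real. indicator {y. 0 < \<bar>y\<bar> \<and> \<bar>y\<bar> < 1} y * cos (2 * pi * \<bar>y\<bar>)"
  have B: "B \<ge> 0" using assms(2)[of 0] by simp
  have z: "(\<integral>y. ?f2 y \<partial>lborel) = 0"
  proof -
    have "(\<integral>y. ?f2 y \<partial>lborel) = (\<integral>y. cos (2 * pi * y) * indicator {-1..1} y \<partial>lborel)"
    proof (rule integral_cong_AE)
      show "AE y in lborel. ?f2 y = cos (2 * pi * y) * indicator {-1..1} y"
        using AE_lborel_singleton[of 0] AE_lborel_singleton[of 1] AE_lborel_singleton[of "-1"]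
        by eventually_elim (auto simp: indicator_def abs_real_def)
    qed measurable
    also have "\<dots> = sin (2 * pi * 1) / (2 * pi) - sin (2 * pi * (-1)) / (2 * pi)"
      by (rule integral_FTC_Icc_real) (auto intro!: derivative_eq_intros continuous_intros)
    finally show ?thesis by simp
  qed
  let ?g = "\<lambda>x::pt. f1 (fst x) * ?f2 (snd x)"
  have m: "?g \<in> borel_measurable (lborel \<Otimes>\<^sub>M lborel)" by measurable
  have b: "norm (?g x) \<le> norm (B * indicator (cbox (0,-1) (L,1)) x)" for x
  proof (cases "x \<in> cbox (0,-1) (L,1)")
    case True
    have "\<bar>f1 (fst x)\<bar> * \<bar>?f2 (snd x)\<bar> \<le> B * 1" using assms(2) B by (intro mult_mono) (auto simp: indicator_def)
    then show ?thesis using True B by (simp add: abs_mult)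
  next
    case False
    then have "fst x \<notin> {0..L} \<or> \<not> \<bar>snd x\<bar> < 1" by (cases x) (auto simp: cbox_Pair_eq abs_less_iff)
    then show ?thesis using assms(3) by (auto simp: indicator_def)
  qed
  show i: "integrable (lborel::pt measure) ?g"
  proof (rule Bochner_Integration.integrable_bound)
    show "integrable (lborel::pt measure) (\<lambda>x. B * indicator (cbox (0,-1) (L,1)) x)"
      using emeasure_lborel_cbox_finite[of "(0,-1)::pt" "(L,1)"] by (intro integrable_mult_right) simp
    show "?g \<in> borel_measurable (lborel::pt measure)" using m by (simp only: lborel_prod)
  qed (use b in auto)
  have "(\<integral>x. (\<integral>y. ?g (x,y) \<partial>lborel) \<partial>lborel) = integral\<^sup>L (lborel \<Otimes>\<^sub>M lborel) ?g"
    by (rule lborel_pair.integral_fst') (use i in \<open>simp add: lborel_prod\<close>)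
  then show "(\<integral>x. ?g x \<partial>(lborel::pt measure)) = 0" using z by (simp add: lborel_prod)
qed

text \<open>By dominated convergence. Both cosine terms drop out, and the slope of the cut-off
  contributes at most (C/L)^2 on a box of area 2 L.\<close>

lemma trial_energy:
  assumes "\<And>t. \<bar>dstp t\<bar> \<le> C" "L > 0"
  obtains J where "(\<lambda>j. En (pi\<^sup>2) (trial L (1 / (real j + 10)))) \<longlonglongrightarrow> J" "J \<le> 2 * C\<^sup>2 / L"
proof -
  define a where "a j = 1 / (real j + 10)" for j
  have a: "0 < a j" "a j \<le> 1/10" for j by (auto simp: a_def field_simps)
  have a0: "a \<longlonglongrightarrow> 0" unfolding a_def by real_asymp
  obtain W where W: "W \<ge> 0" "\<And>a x. 0 < a \<Longrightarrow> a \<le> 1/10 \<Longrightarrow> \<bar>ij L a x\<bar> \<le> W * indicator (cbox (-1,-1) (L,1)) x"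
    by (rule ij_bound[OF assms]) blast
  note t = test_trial[OF a assms(2)]
  have ii: "integrable lborel (ij L (a j))" for j
    unfolding ij_def[abs_def]
    using integrable_dotg[OF t t] integrable_test_sq[OF t] by (intro Bochner_Integration.integrable_diff integrable_mult_right)
  have En: "En (pi\<^sup>2) (trial L (a j)) = integral\<^sup>L lborel (ij L (a j))" for j
    unfolding ij_def[abs_def] En_def dir_def nsq_def
    using integrable_dotg[OF t t] integrable_test_sq[OF t] by simp
  have lim: "(\<lambda>j. ij L (a j) x) \<longlonglongrightarrow> ilim L x" for x
  proof -
    obtain e where e: "e > 0" "\<And>a. 0 < a \<Longrightarrow> a \<le> e \<Longrightarrow> ij L a x = ilim L x" using ij_limit[OF assms(2), of x] by blast
    have "\<forall>\<^sub>F j in sequentially. a j < e" using order_tendstoD(2)[OF a0 e(1)] .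
    then have "\<forall>\<^sub>F j in sequentially. ij L (a j) x = ilim L x" by eventually_elim (use e a in auto)
    then show ?thesis by (rule tendsto_eventually)
  qed
  have m: "ilim L \<in> borel_measurable lborel"
    by (rule borel_measurable_LIMSEQ_real[OF lim]) (use ii in auto)
  have iw: "integrable lborel (\<lambda>x::pt. W * indicator (cbox (-1,-1) (L,1)) x)"
    using emeasure_lborel_cbox_finite[of "(-1,-1)::pt" "(L,1)"] by (intro integrable_mult_right) simp
  have bd: "norm (ij L (a j) x) \<le> W * indicator (cbox (-1,-1) (L,1)) x" for j x using W(2)[OF a] by simp
  have L1: "(\<lambda>j. integral\<^sup>L lborel (ij L (a j))) \<longlonglongrightarrow> integral\<^sup>L lborel (ilim L)"
    by (rule integral_dominated_convergence[OF m _ iw]) (use ii lim bd in auto)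
  have il: "integrable lborel (ilim L)"
    by (rule integrable_dominated_convergence[OF m _ iw, where s="\<lambda>j. ij L (a j)"]) (use ii lim bd in auto)
  define f1 where "f1 t = indicator {0..L} t * ((stp (1 - t / L))\<^sup>2 * pi\<^sup>2)" for t
  have f1m: "f1 \<in> borel_measurable borel" unfolding f1_def[abs_def]
  proof -
    have "continuous_on UNIV stp" using stp_deriv by (meson DERIV_isCont continuous_at_imp_continuous_on)
    then have [measurable]: "stp \<in> borel_measurable borel" by (rule borel_measurable_continuous_onI)
    show "(\<lambda>t. indicator {0..L} t * ((stp (1 - t / L))\<^sup>2 * pi\<^sup>2)) \<in> borel_measurable borel" by measurable
  qed
  have stp2: "(stp y)\<^sup>2 \<le> 1" for y by (simp add: abs_square_le_1 stp_le_1 stp_nonneg)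
  have f1b: "\<bar>f1 t\<bar> \<le> 1 * pi\<^sup>2" for t
    using stp2[of "1 - t/L"] mult_right_mono[of "(stp (1 - t/L))\<^sup>2" 1 "pi\<^sup>2"] by (auto simp: f1_def indicator_def)
  have f10: "t \<notin> {0..L} \<Longrightarrow> f1 t = 0" for t by (auto simp: f1_def indicator_def)
  note S = integral_cos_strip[OF f1m f1b f10]
  let ?S = "\<lambda>x::pt. f1 (fst x) * (indicator {y. 0 < \<bar>y\<bar> \<and> \<bar>y\<bar> < 1} (snd x) * cos (2 * pi * \<bar>snd x\<bar>))"
  let ?A = "{p::pt. fst p < 0 \<and> norm p < 1}"
  let ?D = "\<lambda>x. indicator ?A x * cos (2 * pi * norm x)"
  have iD: "integrable lborel ?D"
  proof -
    have "?A \<in> sets borel" by (intro borel_open open_Collect_conj open_Collect_less continuous_intros)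
    moreover have "emeasure lborel ?A < \<infinity>" by (rule emeasure_bounded_finite, rule bounded_subset[of "ball 0 1"]) auto
    moreover have "integrable lborel (\<lambda>p::pt. indicator S p * cos (2 * pi * norm p))"
      if S: "S \<in> sets borel" "emeasure lborel S < \<infinity>" for S
    proof (rule Bochner_Integration.integrable_bound[of lborel "indicat_real S"])
      show "integrable lborel (indicat_real S)" using S by simp
    qed (use S in \<open>auto simp: indicator_def abs_le_iff\<close>)
    ultimately show ?thesis by blast
  qed
  have C: "C \<ge> 0" using assms(1)[of 0] by simp
  have iE: "integrable lborel (\<lambda>x::pt. (C / L)\<^sup>2 * indicator (cbox (0,-1) (L,1)) x)"
    using emeasure_lborel_cbox_finite[of "(0,-1)::pt" "(L,1)"] by (intro integrable_mult_right) simp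
  have "ilim L x \<le> pi\<^sup>2 * ?D x + ?S x + (C / L)\<^sup>2 * indicator (cbox (0,-1) (L,1)) x" for x
  proof (cases "fst x < 0")
    case True
    then have "f1 (fst x) = 0" by (simp add: f1_def)
    then show ?thesis using True by (auto simp: ilim_def indicator_def)
  next
    case False
    then have D0: "?D x = 0" by simp
    show ?thesis
    proof (cases "0 < \<bar>snd x\<bar> \<and> \<bar>snd x\<bar> < 1")
      case True
      show ?thesis
      proof (cases "fst x \<le> L")
        case xL: True
        have "x \<in> cbox (0,-1) (L,1)" using True xL False by (cases x) (auto simp: cbox_Pair_eq abs_less_iff)
        moreover have "(dstp (1 - fst x / L) / L * sin (pi * \<bar>snd x\<bar>))\<^sup>2 \<le> (C / L)\<^sup>2"
        proof -
          have "\<bar>dstp (1 - fst x / L) / L * sin (pi * \<bar>snd x\<bar>)\<bar> \<le> (C / L) * 1"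
            unfolding abs_mult using assms C by (intro mult_mono) (auto simp: abs_divide divide_right_mono)
          then show ?thesis using C assms(2) by (intro abs_le_square_iff[THEN iffD1]) simp
        qed
        moreover have "ilim L x = (dstp (1 - fst x / L) / L * sin (pi * \<bar>snd x\<bar>))\<^sup>2 + ?S x"
          using False True xL by (simp add: ilim_def f1_def)
        ultimately show ?thesis unfolding D0 by simp
      next
        case xL: False
        then have "1 - fst x / L \<le> 1/2" using assms(2) by (simp add: field_simps)
        then have "ilim L x = 0" using False stp_0 dstp_0 by (simp add: ilim_def)
        moreover have "f1 (fst x) = 0" using xL by (simp add: f1_def)
        ultimately show ?thesis unfolding D0 by simp
      qed
    next
      case sx: False
      then have "ilim L x = 0" using False unfolding ilim_def by (simp only: if_False)
      moreover have "indicator {y. 0 < \<bar>y\<bar> \<and> \<bar>y\<bar> < 1} (snd x) = (0::real)" using sx by simp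
      ultimately show ?thesis unfolding D0 by (simp only:) simp
    qed
  qed
  then have "integral\<^sup>L lborel (ilim L) \<le> (\<integral>x. pi\<^sup>2 * ?D x + ?S x + (C / L)\<^sup>2 * indicator (cbox (0,-1) (L,1)) x \<partial>lborel)"
    by (intro integral_mono il Bochner_Integration.integrable_add integrable_mult_right iD S(2) iE)
  also have "\<dots> = (C / L)\<^sup>2 * measure lborel (cbox (0,-1) (L,1) :: pt set)"
    using iD S iE half_disc_integral_cos by simp
  also have "measure lborel (cbox (0,-1) (L,1) :: pt set) = L * 2"
    using assms(2) by (simp add: content_Pair)
  also have "(C / L)\<^sup>2 * (L * 2) = 2 * C\<^sup>2 / L" using assms(2) by (simp add: power2_eq_square field_simps)
  finally show thesis using that[of "integral\<^sup>L lborel (ilim L)"] L1 by (simp add: En flip: a_def)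
qed

section \<open>The trial function is no eigenfunction\<close>

lemma lap_cong:
  assumes "open U" "x \<in> U" "\<And>y. y \<in> U \<Longrightarrow> f y = g y" "smoothOn U f"
  shows "lap g x = lap f x"
proof -
  note d = smoothOn_dx[OF assms(4)]
  have e: "dx1 g y = dx1 f y" "dx2 g y = dx2 f y" if "y \<in> U" for y
    using dx_cong(1,2)[OF assms(1) that assms(3) smoothOn_differentiable[OF assms(4) that]] by auto
  have "dx1 (dx1 g) x = dx1 (dx1 f) x"
    by (rule dx_cong(1)[OF assms(1,2) _ smoothOn_differentiable[OF d(1) assms(2)]]) (simp add: e)
  moreover have "dx2 (dx2 g) x = dx2 (dx2 f) x"
    by (rule dx_cong(2)[OF assms(1,2) _ smoothOn_differentiable[OF d(2) assms(2)]]) (simp add: e)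
  ultimately show ?thesis by (simp add: lap_def)
qed

text \<open>In this region neither smoothing nor cut-off acts and the function is sin (pi r). What
  remains is the first-order term of the radial Laplacian, positive for r < 1/2. The computation
  runs in s = r^2 in order to use \<open>dsq\<close>.\<close>

lemma lap_trial:
  assumes "0 < a" "a \<le> 1/10" "L > 0" "fst x < - 1/10" "dsq (0,0) x < 1/4"
  shows "lap (trial L a) x + pi\<^sup>2 * trial L a x = pi * cos (pi * sqrt (dsq (0,0) x)) / sqrt (dsq (0,0) x)"
proof -
  let ?q = "dsq (0,0)"
  let ?U = "{x::pt. fst x < - 1/10} \<inter> {x. ?q x < 1/4}"
  have cq: "continuous_on UNIV ?q" by (rule smoothOn_continuous[OF smoothOn_dsq[OF open_UNIV]])
  have oU: "open ?U" by (intro open_Int open_Collect_less cq continuous_intros)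
  have xU: "x \<in> ?U" using assms by simp
  have pos: "?q y > 1/100" if "y \<in> ?U" for y
  proof -
    have "(1/10)\<^sup>2 < (- fst y)\<^sup>2" using that by (intro power_strict_mono) auto
    then show ?thesis by (simp add: dsq_def power2_eq_square) (smt (verit) zero_le_square)
  qed
  define F where "F s = sin (pi * sqrt s)" for s
  have eq: "F (?q y) = trial L a y" if y: "y \<in> ?U" for y
  proof -
    have m: "mj (a/4) (fst y) = - fst y" using mj_neg[of "a/4" "fst y"] y assms by simp
    then have q: "qj (a/4) y = ?q y" by (simp add: qj_def dsq_def)
    have "stp (1 - fst y / L) = 1" using y assms(3) by (intro stp_1) (auto simp: divide_nonpos_pos)
    moreover have "sqrt ((1/10)\<^sup>2) \<le> sqrt (?q y)" using pos[OF y] by (intro real_sqrt_le_mono) (simp add: power2_eq_square)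
    then have "a \<le> sqrt (?q y)" using assms(2) by simp
    moreover have "sqrt (?q y) \<le> sqrt ((1/2)\<^sup>2)" using y by (intro real_sqrt_le_mono) (simp add: power2_eq_square)
    then have "sqrt (?q y) \<le> 1 - a" using assms(2) by simp
    ultimately show ?thesis using fj_sin[OF assms(1)] by (simp add: trial_def q F_def)
  qed
  define F1 where "F1 s = pi * cos (pi * sqrt s) / (2 * sqrt s)" for s
  have dF: "(F has_real_derivative F1 s) (at s)" if "s > 0" for s
    unfolding F_def[abs_def] F1_def using that by (auto intro!: derivative_eq_intros simp: field_simps)
  define s where "s = ?q x"
  define r where "r = sqrt s"
  have s0: "s > 0" using pos[OF xU] by (simp add: s_def)
  then have r0: "r > 0" "r * r = s" by (simp_all add: r_def)
  have dF1: "(F1 has_real_derivative (- (pi\<^sup>2 * sin (pi * r)) / (4 * s) - pi * cos (pi * r) / (4 * s * r))) (at s)"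
  proof -
    have dr: "(sqrt has_real_derivative 1 / (2 * r)) (at s)" using DERIV_real_sqrt[OF s0] by (simp add: r_def field_simps)
    have "((\<lambda>y. pi * cos (pi * y) / (2 * y)) has_real_derivative (- (pi\<^sup>2 * sin (pi * r)) / (2 * r) - pi * cos (pi * r) / (2 * r * r))) (at r)"
      using r0(1) by (auto intro!: derivative_eq_intros simp: field_simps power2_eq_square)
    from DERIV_chain2[OF this[unfolded r_def] dr[unfolded r_def]]
    have "(F1 has_real_derivative (- (pi\<^sup>2 * sin (pi * r)) / (2 * r) - pi * cos (pi * r) / (2 * r * r)) * (1 / (2 * r))) (at s)"
      unfolding F1_def[abs_def] r_def .
    moreover have "(- (pi\<^sup>2 * sin (pi * r)) / (2 * r) - pi * cos (pi * r) / (2 * r * r)) * (1 / (2 * r))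
       = - (pi\<^sup>2 * sin (pi * r)) / (4 * s) - pi * cos (pi * r) / (4 * s * r)"
      using r0 by (simp add: field_simps flip: r0(2))
    ultimately show ?thesis by simp
  qed
  have sm: "smoothOn ?U (\<lambda>y. F (?q y))" unfolding F_def
    by (intro smoothOn_sin smoothOn_mult smoothOn_const smoothOn_sqrt smoothOn_dsq oU) (use pos in \<open>force\<close>)
  have "lap (trial L a) x = lap (\<lambda>y. F (?q y)) x" by (rule lap_cong[OF oU xU eq sm])
  also have "\<dots> = (- (pi\<^sup>2 * sin (pi * r)) / (4 * s) - pi * cos (pi * r) / (4 * s * r)) * (4 * s) + F1 s * 4"
  proof -
    have p0: "?q y > 0" if "y \<in> ?U" for y using pos[OF that] by linarith
    show ?thesis using lap_comp_on[OF oU xU smoothOn_dsq[OF oU] dF[OF p0] dF1[unfolded s_def]]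
      unfolding dotg_dsq lap_dsq s_def by (simp only:)
  qed
  also have "\<dots> = - pi\<^sup>2 * sin (pi * r) + pi * cos (pi * r) / r"
    using r0 s0 unfolding F1_def r_def[symmetric] by (simp add: field_simps)
  also have "sin (pi * r) = trial L a x" using eq[OF xU] by (simp add: F_def r_def s_def)
  finally show ?thesis by (simp add: r_def s_def)
qed

text \<open>Otherwise the form at level pi^2 is semidefinite on the pipe, and Cauchy-Schwarz bounds
  the square of its value at a fixed bump and the trial function by a quantity of order 1/L. But
  this value is - b for all cut-off lengths and smoothing scales, with b > 0.\<close>

lemma lambda1_H_less: "lambda1 H_pipe < pi\<^sup>2"
proof (rule ccontr)
  assume "\<not> lambda1 H_pipe < pi\<^sup>2"
  then have l: "pi\<^sup>2 \<le> lambda1 H_pipe" by simp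
  have E0: "En (pi\<^sup>2) w \<ge> 0" if "test_fun H_pipe w" for w
    using lambda1_le[OF that] mult_right_mono[OF l nsq_nonneg[of w]] by (simp add: En_def)
  \<comment> \<open>The disc of radius 1/8 about (-1/4, 0) lies where x1 < -1/10 and r < 2/5, inside
    the region covered by \<open>lap_trial\<close>.\<close>
  let ?p = "bump (-1/4,0) ((1/8)\<^sup>2) 1"
  have sup: "fst x < -1/10" "dsq (0,0) x < 4/25" if "dsq (-1/4,0) x \<le> (1/8)\<^sup>2" for x
  proof -
    have a: "(fst x + 1/4)\<^sup>2 + (snd x)\<^sup>2 \<le> (1/8)\<^sup>2" using that by (simp add: dsq_def)
    then have "(fst x + 1/4)\<^sup>2 \<le> (1/8)\<^sup>2" by (smt (verit) zero_le_power2)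
    then have b: "\<bar>fst x + 1/4\<bar> \<le> 1/8" using abs_le_square_iff[of "fst x + 1/4" "1/8"] by simp
    then show "fst x < -1/10" by linarith
    have "dsq (0,0) x = (fst x + 1/4)\<^sup>2 + (snd x)\<^sup>2 - fst x / 2 - 1/16" by (simp add: dsq_def power2_eq_square algebra_simps)
    moreover have "(1/8)\<^sup>2 = (1/64::real)" by (simp add: power2_eq_square)
    ultimately show "dsq (0,0) x < 4/25" using a b by linarith
  qed
  have ss: "cball (-1/4,0) (1/8) \<subseteq> H_pipe"
  proof
    fix x :: pt assume "x \<in> cball (-1/4,0) (1/8)"
    then have "dsq (-1/4,0) x \<le> (1/8)\<^sup>2" unfolding dsq_dist by (intro power_mono) auto
    from sup[OF this] show "x \<in> H_pipe" by (auto simp: mem_H_pipe dsq_def)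
  qed
  have tp: "test_fun H_pipe ?p" using test_bump[of 1 "1/8" "(-1/4,0)" H_pipe] ss by simp
  have npos: "nsq ?p > 0" by (rule nsq_pos[OF tp, of "(-1/4,0)"]) (use bump_pos[of 1 "(-1/4,0)" "(-1/4,0)" "(1/8)\<^sup>2"] in \<open>auto simp: dsq_def\<close>)
  define k where "k x = ?p x * (pi * cos (pi * sqrt (dsq (0,0) x)) / sqrt (dsq (0,0) x))" for x
  define b where "b = integral\<^sup>L lborel k"
  have keq: "?p x * (lap (trial L a) x + pi\<^sup>2 * trial L a x) = k x" if "0 < a" "a \<le> 1/10" "L > 0" for L a x
  proof (cases "dsq (-1/4,0) x \<le> (1/8)\<^sup>2")
    case True
    then show ?thesis unfolding k_def using lap_trial[OF that] sup[OF True] by simp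
  next
    case False
    then have "?p x = 0" by (intro bump_0) auto
    then show ?thesis by (simp add: k_def)
  qed
  have ik: "integrable lborel k"
    using Bl_green(1)[OF tp smooth_trial[of "1/10" 1], of "pi\<^sup>2"] keq[of "1/10" 1] by simp
  define c where "c = cos (pi * (2/5))"
  have c: "c > 0" unfolding c_def by (rule cos_gt_zero) auto
  have kl: "k x \<ge> c * (?p x)\<^sup>2" for x
  proof (cases "dsq (-1/4,0) x \<le> (1/8)\<^sup>2")
    case False
    then have "?p x = 0" by (intro bump_0) auto
    then show ?thesis by (simp add: k_def)
  next
    case True
    define r where "r = sqrt (dsq (0,0) x)"
    have "r < sqrt ((2/5)\<^sup>2)" unfolding r_def using sup(2)[OF True] by (intro real_sqrt_less_mono) (simp add: power2_eq_square)
    then have r: "r < 2/5" by simp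
    have "(fst x)\<^sup>2 > 0" using sup(1)[OF True] by simp
    then have r0: "r > 0" by (simp add: r_def dsq_def add_pos_nonneg)
    have cr: "c \<le> cos (pi * r)" unfolding c_def using r r0 by (intro cos_monotone_0_pi_le) auto
    have pi1: "1 \<le> pi / r" using r r0 pi_gt3 by (simp add: pos_le_divide_eq)
    have p01: "0 \<le> ?p x" "?p x \<le> 1" by (simp_all add: bump_nonneg) (simp add: bump_def ee_le_1)
    have "c * (?p x)\<^sup>2 \<le> c * ?p x" using c p01 by (intro mult_left_mono) (auto simp: power2_eq_square mult_left_le)
    also have "\<dots> \<le> (pi / r * cos (pi * r)) * ?p x"
    proof (intro mult_right_mono p01)
      have "1 * c \<le> pi / r * cos (pi * r)" using pi1 cr c by (intro mult_mono) auto
      then show "c \<le> pi / r * cos (pi * r)" by simp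
    qed
    finally show ?thesis by (simp add: k_def r_def mult_ac)
  qed
  have "c * nsq ?p = (\<integral>x. c * (?p x)\<^sup>2 \<partial>lborel)" by (simp add: nsq_def)
  also have "\<dots> \<le> b" unfolding b_def using integrable_test_sq[OF tp] by (intro integral_mono integrable_mult_right ik kl)
  finally have b: "b > 0" using c npos by (meson less_le_trans mult_pos_pos)
  obtain C where C: "C \<ge> 1" "\<And>t. \<bar>dstp t\<bar> \<le> C" by (rule dstp_bounded) blast
  let ?E = "En (pi\<^sup>2) ?p"
  have key: "b\<^sup>2 \<le> ?E * (2 * C\<^sup>2 / L)" if L: "L > 0" for L
  proof -
    obtain J where J: "(\<lambda>j. En (pi\<^sup>2) (trial L (1 / (real j + 10)))) \<longlonglongrightarrow> J" "J \<le> 2 * C\<^sup>2 / L"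
      by (rule trial_energy[OF C(2) L]) blast
    have "b\<^sup>2 \<le> ?E * En (pi\<^sup>2) (trial L (1 / (real j + 10)))" for j
    proof -
      have a: "0 < 1 / (real j + 10)" "1 / (real j + 10) \<le> 1/10" by (auto simp: field_simps)
      note t = test_trial[OF a L]
      have "Bl (pi\<^sup>2) ?p (trial L (1 / (real j + 10))) = - b"
        using Bl_green(2)[OF tp smooth_trial[OF a(1) L]] keq[OF a L] by (simp add: b_def)
      then show ?thesis using En_cauchy_schwarz[OF E0 tp t] by simp
    qed
    then have "b\<^sup>2 \<le> ?E * J" by (intro LIMSEQ_le_const[OF tendsto_mult_left[OF J(1)]]) auto
    also have "\<dots> \<le> ?E * (2 * C\<^sup>2 / L)" by (intro mult_left_mono J(2) E0 tp)
    finally show ?thesis .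
  qed
  \<comment> \<open>The length L = M / b^2 + 1 makes b^2 L exceed M.\<close>
  define M where "M = ?E * (2 * C\<^sup>2)"
  have M0: "M \<ge> 0" unfolding M_def by (intro mult_nonneg_nonneg E0 tp) auto
  have b2: "b\<^sup>2 > 0" using b by simp
  have "b\<^sup>2 \<le> M / (M / b\<^sup>2 + 1)" using key[of "M / b\<^sup>2 + 1"] M0 b2 by (simp add: M_def add_nonneg_pos)
  then have "b\<^sup>2 * (M / b\<^sup>2 + 1) \<le> M" using M0 b2 by (simp add: pos_le_divide_eq add_nonneg_pos)
  then show False using b2 by (simp add: distrib_left)
qed

subsection \<open>Opening a tube\<close>

text \<open>With q = r^2 / a^2 and y the depth below the wall, y GG(q) / a^2 is the dipole y / r^2
  for r >= a and vanishes near r = 0.\<close>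

definition GG :: "real \<Rightarrow> real" where "GG q = stp q / q"

lemma smooth1_GG: "smooth1 UNIV GG"
proof -
  let ?f = "\<lambda>x::pt. GG (fst x)"
  let ?U = "{x::pt. fst x > 0}" and ?V = "{x::pt. fst x < 1/2}"
  have o: "open ?U" "open ?V" by (intro open_Collect_less continuous_intros)+
  have "smoothOn ?U ?f" unfolding GG_def
    by (intro smoothOn_divide smoothOn_stp smoothOn_fst o) auto
  moreover have "smoothOn ?V ?f"
    by (rule smoothOn_cong[OF o(2), of "\<lambda>x. 0"]) (auto simp: GG_def stp_0 smoothOn_const)
  ultimately have "smoothOn (?U \<union> ?V) ?f" using smoothOn_Un o by blast
  moreover have "?U \<union> ?V = UNIV" by auto
  ultimately show ?thesis using smooth1_slice[of ?f] by simp
qed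

lemma GG_bounds: "q > 0 \<Longrightarrow> 0 \<le> GG q \<and> GG q \<le> 1 / q" "q \<ge> 1 \<Longrightarrow> GG q = 1 / q" "q \<le> 1/2 \<Longrightarrow> GG q = 0"
  by (auto simp: GG_def stp_nonneg stp_le_1 stp_1 stp_0 divide_right_mono)

definition G1 :: "real \<Rightarrow> real" where "G1 = deriv GG"
definition G2 :: "real \<Rightarrow> real" where "G2 = deriv G1"

lemma GG_deriv: "(GG has_real_derivative G1 q) (at q)" "(G1 has_real_derivative G2 q) (at q)" "continuous_on UNIV G2"
proof -
  obtain F1 F2 where F: "\<And>t. (GG has_real_derivative F1 t) (at t)" "\<And>t. (F1 has_real_derivative F2 t) (at t)" "continuous_on UNIV F2"
    by (rule smooth1_imp_deriv[OF smooth1_GG]) blast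
  have 1: "G1 = F1" unfolding G1_def using F(1) DERIV_imp_deriv by blast
  have 2: "G2 = F2" unfolding G2_def 1 using F(2) DERIV_imp_deriv by blast
  show "(GG has_real_derivative G1 q) (at q)" "(G1 has_real_derivative G2 q) (at q)" "continuous_on UNIV G2"
    using F 1 2 by auto
qed

text \<open>Up to the factor 4 y / a^4 this expression is the Laplacian of the regularised dipole;
  the coefficient 2 of \<open>G1\<close>, instead of 1, comes from the cross term with y. For GG(q)
  = 1/q it vanishes.\<close>

lemma GG_harmonic: "q > 1 \<Longrightarrow> q * G2 q + 2 * G1 q = 0"
proof -
  assume q: "q > 1"
  have g1: "G1 t = - 1 / t\<^sup>2" if "t > 1" for t
  proof (rule DERIV_unique[OF GG_deriv(1)])
    have "((\<lambda>t. 1 / t) has_real_derivative - 1 / t\<^sup>2) (at t)"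
      using that by (auto intro!: derivative_eq_intros simp: power2_eq_square)
    then show "(GG has_real_derivative - 1 / t\<^sup>2) (at t)"
      by (rule has_field_derivative_transform_within_open[of _ _ _ "{1<..}"]) (use that GG_bounds(2) in auto)
  qed
  have "((\<lambda>t. - 1 / t\<^sup>2) has_real_derivative 2 / q^3) (at q)"
    using q by (auto intro!: derivative_eq_intros simp: power2_eq_square power3_eq_cube field_simps)
  then have "(G1 has_real_derivative 2 / q^3) (at q)"
    by (rule has_field_derivative_transform_within_open[of _ _ _ "{1<..}"]) (use q g1 in auto)
  then have "G2 q = 2 / q^3" using GG_deriv(2) DERIV_unique by blast
  moreover have "q * (2 / q^3) + 2 * (- 1 / q\<^sup>2) = 0" using q by (simp add: power2_eq_square power3_eq_cube)
  ultimately show ?thesis by (simp only: g1[OF q])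
qed

lemma GG_lap_bounded: obtains C where "C \<ge> 0" "\<And>q. 0 \<le> q \<Longrightarrow> q \<le> 1 \<Longrightarrow> \<bar>q * G2 q + 2 * G1 q\<bar> \<le> C"
proof -
  have "continuous_on UNIV G1" using GG_deriv(2) by (meson DERIV_isCont continuous_at_imp_continuous_on)
  then have "continuous_on {0..1} (\<lambda>q. q * G2 q + 2 * G1 q)"
    using GG_deriv(3) by (intro continuous_intros) (auto intro: continuous_on_subset)
  then have "bounded ((\<lambda>q. q * G2 q + 2 * G1 q) ` {0..1})"
    by (intro compact_imp_bounded compact_continuous_image) auto
  then obtain B where B: "\<And>q. q \<in> {0..1} \<Longrightarrow> \<bar>q * G2 q + 2 * G1 q\<bar> \<le> B" unfolding bounded_iff by fastforce
  show ?thesis by (rule that[of "\<bar>B\<bar>"]) (use B in force)+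
qed

text \<open>Convex, so that it preserves subharmonicity, and with slope at most 1, so that it does
  not amplify a negative Laplacian. \<open>ee\<close> alone turns concave beyond 1/2; the factor
  \<open>s\<close> prevents this.\<close>

definition FF :: "real \<Rightarrow> real" where "FF s = s * ee s"
definition FF1 :: "real \<Rightarrow> real" where "FF1 s = ee s + s * ee1 s"
definition FF2 :: "real \<Rightarrow> real" where "FF2 s = 2 * ee1 s + s * ee2 s"

lemma FF_deriv: "(FF has_real_derivative FF1 s) (at s)" "(FF1 has_real_derivative FF2 s) (at s)"
  unfolding FF_def[abs_def] FF1_def[abs_def] FF2_def
  by (auto intro!: derivative_eq_intros ee_deriv ee1_deriv)

lemma FF_0: "s \<le> 0 \<Longrightarrow> FF s = 0" by (simp add: FF_def ee_0)

lemma FF_nonneg: "FF s \<ge> 0" by (simp add: FF_def ee_def)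

lemma FF_ge: "s \<ge> 1 \<Longrightarrow> FF s \<ge> exp (-1)"
proof -
  assume s: "s \<ge> 1"
  have "1 * ee 1 \<le> s * ee s" using s by (intro mult_mono ee_mono) (auto simp: ee_nonneg)
  then show ?thesis by (simp add: FF_def ee_def)
qed

lemma FF1_bounds: "0 \<le> FF1 s \<and> FF1 s \<le> 1"
proof (cases "s \<le> 0")
  case False
  then have s: "s > 0" by simp
  have e: "FF1 s = exp (- (1/s)) * (1 + 1/s)" using s by (simp add: FF1_def ee_def ee1_def field_simps power2_eq_square)
  have "1 + 1/s \<le> exp (1/s)" by (rule exp_ge_add_one_self)
  then have "exp (- (1/s)) * (1 + 1/s) \<le> exp (- (1/s)) * exp (1/s)" by (intro mult_left_mono) auto
  then show ?thesis using s by (simp add: e exp_minus field_simps)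
qed (simp add: FF1_def ee_def ee1_def)

lemma FF2_nonneg: "FF2 s \<ge> 0"
proof (cases "s \<le> 0")
  case False
  then have s: "s > 0" by simp
  have "FF2 s = exp (-1/s) / s^3" using s by (simp add: FF2_def ee1_def ee2_def field_simps power2_eq_square power3_eq_cube power4_eq_xxxx)
  then show ?thesis using s by simp
qed (simp add: FF2_def ee1_def ee2_def)

lemma lap_mult:
  assumes "smoothOn UNIV f" "smoothOn UNIV g"
  shows "lap (\<lambda>x. f x * g x) x = f x * lap g x + 2 * dotg f g x + g x * lap f x"
proof -
  note f = smoothOn_pd[OF assms(1) UNIV_I] and g = smoothOn_pd[OF assms(2) UNIV_I]
  note f1 = smoothOn_pd[OF smoothOn_dx(1)[OF assms(1)] UNIV_I] and f2 = smoothOn_pd[OF smoothOn_dx(2)[OF assms(1)] UNIV_I]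
  note g1 = smoothOn_pd[OF smoothOn_dx(1)[OF assms(2)] UNIV_I] and g2 = smoothOn_pd[OF smoothOn_dx(2)[OF assms(2)] UNIV_I]
  have e: "dx1 (\<lambda>x. f x * g x) = (\<lambda>x. dx1 f x * g x + f x * dx1 g x)" "dx2 (\<lambda>x. f x * g x) = (\<lambda>x. dx2 f x * g x + f x * dx2 g x)"
    by (rule ext, rule pdD[OF pd_mult[OF f g]])+
  show ?thesis unfolding lap_def e dotg_def
    using pdD(1)[OF pd_add[OF pd_mult[OF f1 g] pd_mult[OF f g1]], of x] pdD(2)[OF pd_add[OF pd_mult[OF f2 g] pd_mult[OF f g2]], of x]
    by (simp add: algebra_simps)
qed

text \<open>A dipole \<open>y / r\<^sup>2\<close> at the wall point \<open>(p, 1)\<close>, regularised at scale \<open>a\<close>. It is harmonic off the ball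
  of radius \<open>a\<close> and vanishes on the wall; cutting it off convexly keeps it subharmonic.\<close>

definition dip :: "real \<Rightarrow> real \<Rightarrow> pt \<Rightarrow> real" where
  "dip p a x = (1 - snd x) * (GG (dsq (p,1) x / a\<^sup>2) / a\<^sup>2)"
definition far :: "real \<Rightarrow> real \<Rightarrow> pt \<Rightarrow> real" where "far p a x = FF (dip p a x - 2)"

lemma smooth_dip_factor: "smoothOn UNIV (\<lambda>x. GG (dsq (p,1) x / a\<^sup>2) / a\<^sup>2)"
proof -
  have "smoothOn UNIV (\<lambda>x. (1/a\<^sup>2) * dsq (p,1) x)" by (intro smoothOn_mult smoothOn_const smoothOn_dsq open_UNIV)
  from smoothOn_comp[OF open_UNIV smooth1_GG this] have "smoothOn UNIV (\<lambda>x. (1/a\<^sup>2) * GG ((1/a\<^sup>2) * dsq (p,1) x))"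
    by (intro smoothOn_mult smoothOn_const open_UNIV) auto
  then show ?thesis by simp
qed

lemma smooth_dip: "smoothOn UNIV (dip p a)"
  unfolding dip_def[abs_def]
  by (intro smoothOn_mult smoothOn_diff smoothOn_const smoothOn_snd smooth_dip_factor open_UNIV)

lemma smooth_far: "smoothOn UNIV (far p a)"
proof -
  have "smoothOn UNIV (\<lambda>x. (dip p a x - 2) * ee (dip p a x - 2))"
    by (intro smoothOn_mult smoothOn_ee smoothOn_diff smoothOn_const smooth_dip open_UNIV)
  then show ?thesis unfolding far_def[abs_def] FF_def .
qed

lemma lap_dip:
  fixes a p :: real
  assumes "a > 0"
  defines "q \<equiv> (\<lambda>x. dsq (p,1) x / a\<^sup>2)"
  shows "lap (dip p a) x = 4 * (1 - snd x) / a^4 * (q x * G2 (q x) + 2 * G1 (q x))"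
proof -
  let ?g = "\<lambda>x. GG (dsq (p,1) x / a\<^sup>2) / a\<^sup>2"
  define F1 where "F1 s = G1 (s / a\<^sup>2) / a^4" for s
  have d1: "((\<lambda>s. GG (s / a\<^sup>2) / a\<^sup>2) has_real_derivative F1 s) (at s)" for s
  proof -
    have "((\<lambda>s. GG (s / a\<^sup>2)) has_real_derivative G1 (s / a\<^sup>2) * (1 / a\<^sup>2)) (at s)"
      by (rule DERIV_chain2[OF GG_deriv(1) DERIV_cdivide[OF DERIV_ident]])
    from DERIV_cdivide[OF this, of "a\<^sup>2"] show ?thesis by (rule DERIV_cong) (simp add: F1_def eval_nat_numeral)
  qed
  have d2: "(F1 has_real_derivative G2 (s / a\<^sup>2) / a^6) (at s)" for s
  proof -
    have "((\<lambda>s. G1 (s / a\<^sup>2)) has_real_derivative G2 (s / a\<^sup>2) * (1 / a\<^sup>2)) (at s)"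
      by (rule DERIV_chain2[OF GG_deriv(2) DERIV_cdivide[OF DERIV_ident]])
    from DERIV_cdivide[OF this, of "a^4"] show ?thesis unfolding F1_def[abs_def]
      by (rule DERIV_cong) (simp add: eval_nat_numeral)
  qed
  have lg: "lap ?g x = G2 (q x) / a^6 * (4 * dsq (p,1) x) + G1 (q x) / a^4 * 4"
    using lap_comp_on[OF open_UNIV UNIV_I smoothOn_dsq[OF open_UNIV] d1 d2] unfolding dotg_dsq lap_dsq q_def F1_def by (simp only:)
  have g2: "dx2 ?g x = F1 (dsq (p,1) x) * dx2 (dsq (p,1)) x"
    by (rule pd_comp_on(2)[OF open_UNIV UNIV_I smoothOn_dsq[OF open_UNIV] d1])
  have y: "pd (\<lambda>x. 1 - snd x) 0 (-1) x" for x using pd_affine[OF pd_snd, of 1 "-1"] by simp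
  have ey: "dx1 (\<lambda>x::pt. 1 - snd x) = (\<lambda>x. 0)" "dx2 (\<lambda>x::pt. 1 - snd x) = (\<lambda>x. -1)"
    by (rule ext, rule pdD[OF y])+
  have ly: "lap (\<lambda>x::pt. 1 - snd x) x = 0" unfolding lap_def ey using pdD(1,2)[OF pd_const] by simp
  have sy: "smoothOn UNIV (\<lambda>x::pt. 1 - snd x)" by (intro smoothOn_diff smoothOn_const smoothOn_snd open_UNIV)
  have "lap (dip p a) x = (1 - snd x) * lap ?g x + 2 * dotg (\<lambda>x. 1 - snd x) ?g x"
    unfolding dip_def[abs_def] lap_mult[OF sy smooth_dip_factor] ly by simp
  also have "dotg (\<lambda>x. 1 - snd x) ?g x = G1 (q x) / a^4 * (2 * (1 - snd x))"
    unfolding dotg_def ey g2 dx_dsq F1_def q_def by (simp add: algebra_simps)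
  finally have l: "lap (dip p a) x = (1 - snd x) * lap ?g x + 2 * (G1 (q x) / a^4 * (2 * (1 - snd x)))" .
  have "G2 (q x) / a^6 * (4 * dsq (p,1) x) = 4 * (q x * G2 (q x)) / a^4"
    using assms(1) by (simp add: q_def eval_nat_numeral mult_ac)
  then show ?thesis unfolding l lg by (simp add: add_divide_distrib diff_divide_distrib algebra_simps)
qed

text \<open>The chain rule also yields \<open>FF2\<close> times the squared gradient, which
  convexity allows to be dropped.\<close>

lemma lap_far_ge: "lap (far p a) x \<ge> FF1 (dip p a x - 2) * lap (dip p a) x"
proof -
  have d1: "((\<lambda>s. FF (s - 2)) has_real_derivative FF1 (s - 2)) (at s)" for s
    by (rule DERIV_chain2[OF FF_deriv(1), THEN DERIV_cong]) (auto intro!: derivative_eq_intros)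
  have d2: "((\<lambda>s. FF1 (s - 2)) has_real_derivative FF2 (s - 2)) (at s)" for s
    by (rule DERIV_chain2[OF FF_deriv(2), THEN DERIV_cong]) (auto intro!: derivative_eq_intros)
  have "lap (far p a) x = FF2 (dip p a x - 2) * dotg (dip p a) (dip p a) x + FF1 (dip p a x - 2) * lap (dip p a) x"
    unfolding far_def[abs_def] by (rule lap_comp_on[OF open_UNIV UNIV_I smooth_dip d1 d2])
  moreover have "FF2 (dip p a x - 2) * dotg (dip p a) (dip p a) x \<ge> 0"
    by (intro mult_nonneg_nonneg FF2_nonneg) (simp add: dotg_def)
  ultimately show ?thesis by simp
qed

text \<open>Away from its core the dipole is at least 2 exactly on the disc r^2 <= y / 2, of
  diameter 1/2 and tangent to the wall at (p, 1). The regularised one vanishes near the point of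
  tangency, so its level set is compact in the open arm.\<close>

lemma far_support:
  assumes "a > 0" "dip p a x \<ge> 2"
  shows "dsq (p,1) x \<le> (1 - snd x) / 2" "0 < 1 - snd x" "1 - snd x \<le> 1/2" "\<bar>fst x - p\<bar> \<le> 1/2"
proof -
  let ?y = "1 - snd x" and ?s = "dsq (p,1) x"
  have G0: "GG (?s / a\<^sup>2) \<noteq> 0" using assms by (auto simp: dip_def)
  then have "?s / a\<^sup>2 > 0" using GG_bounds(3)[of "?s / a\<^sup>2"] by linarith
  then have s: "?s > 0" using assms(1) by (simp add: zero_less_divide_iff)
  have g: "0 \<le> GG (?s / a\<^sup>2) / a\<^sup>2" "GG (?s / a\<^sup>2) / a\<^sup>2 \<le> 1 / ?s"
    using GG_bounds(1)[OF \<open>?s / a\<^sup>2 > 0\<close>] assms(1) by (auto simp: field_simps)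
  show y0: "0 < ?y"
  proof (rule ccontr)
    assume "\<not> 0 < ?y"
    then have "dip p a x \<le> 0" unfolding dip_def using g by (intro mult_nonpos_nonneg) auto
    then show False using assms(2) by simp
  qed
  have "2 \<le> ?y * (1 / ?s)" using assms(2) mult_left_mono[OF g(2), of ?y] y0 by (simp add: dip_def)
  then show d: "?s \<le> ?y / 2" using s by (simp add: field_simps)
  have e: "?s = (fst x - p)\<^sup>2 + ?y\<^sup>2" by (simp add: dsq_def power2_commute)
  have "?y\<^sup>2 \<le> ?y / 2" using d e zero_le_power2[of "fst x - p"] by linarith
  then have "?y * ?y \<le> ?y * (1/2)" by (simp add: power2_eq_square)
  then show y1: "?y \<le> 1/2" using y0 by (simp only: mult_le_cancel_left_pos)
  have "A \<le> 1/4" if "s \<le> y / 2" "s = A + B" "y \<le> 1/2" "0 \<le> B" for A B s y :: real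
    using that by linarith
  from this[OF d e y1 zero_le_power2] have "(fst x - p)\<^sup>2 \<le> 1/4" .
  then have "(fst x - p)\<^sup>2 \<le> (1/2)\<^sup>2" by (simp add: power2_eq_square)
  then show "\<bar>fst x - p\<bar> \<le> 1/2" using abs_le_square_iff[of "fst x - p" "1/2"] by simp
qed

lemma test_far:
  assumes "a > 0" "p \<ge> 2" "p \<le> 3" shows "test_fun H_pipe (far p a)"
proof -
  let ?K = "{x. dip p a x \<ge> 2}"
  have "closed ?K" using smoothOn_continuous[OF smooth_dip] by (intro closed_Collect_le continuous_on_const)
  moreover have "bounded ?K"
  proof (rule bounded_subset[of "cbox (1,0) (4,1)"])
    show "?K \<subseteq> cbox (1,0) (4,1)"
    proof
      fix x assume "x \<in> ?K"
      then have "0 < 1 - snd x" "1 - snd x \<le> 1/2" "\<bar>fst x - p\<bar> \<le> 1/2" using far_support[OF assms(1), of p x] by auto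
      then have "1 \<le> fst x \<and> fst x \<le> 4 \<and> 0 \<le> snd x \<and> snd x \<le> 1" using assms by linarith
      then show "x \<in> cbox (1,0) (4,1)" by (cases x) (auto simp: cbox_Pair_eq)
    qed
  qed simp
  ultimately have cK: "compact ?K" by (simp add: compact_eq_bounded_closed)
  have KH: "?K \<subseteq> H_pipe"
  proof
    fix x assume "x \<in> ?K"
    then have "0 < 1 - snd x" "1 - snd x \<le> 1/2" "\<bar>fst x - p\<bar> \<le> 1/2" using far_support[OF assms(1), of p x] by auto
    then show "x \<in> H_pipe" using assms(2) unfolding mem_H_pipe by linarith
  qed
  show ?thesis by (rule test_funI[OF smooth_far cK KH]) (auto simp: far_def FF_0)
qed

text \<open>For every \<open>p\<close> from 2 to 21/10 the points of this ball have depth y between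
  1/5 and 3/10 and horizontal distance at most 1/10 from \<open>p\<close>. There y / r^2 >= 3, one
  above the cut-off level 2.\<close>

abbreviation target :: "pt set" where "target \<equiv> ball (41/20, 3/4) (1/20)"

lemma far_target:
  assumes "0 < a" "a \<le> 1/10" "2 \<le> p" "p \<le> 21/10" "x \<in> target"
  shows "far p a x \<ge> exp (-1)"
proof -
  have "\<bar>fst x - 41/20\<bar> < 1/20" "\<bar>snd x - 3/4\<bar> < 1/20"
    using assms(5) dist_fst_le[of "(41/20,3/4)" x] dist_snd_le[of "(41/20,3/4)" x]
    by (simp_all add: dist_real_def abs_minus_commute)
  then have x: "\<bar>fst x - p\<bar> \<le> 1/10" and y: "1/5 \<le> 1 - snd x" "1 - snd x \<le> 3/10" using assms by (auto simp: abs_if split: if_splits)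
  let ?y = "1 - snd x" and ?s = "dsq (p,1) x"
  have e: "?s = (fst x - p)\<^sup>2 + ?y\<^sup>2" by (simp add: dsq_def power2_commute)
  have x2: "(fst x - p)\<^sup>2 \<le> (1/10)\<^sup>2" using x by (intro abs_le_square_iff[THEN iffD1]) simp
  have y2: "(1/5)\<^sup>2 \<le> ?y\<^sup>2" using y by (intro power_mono) auto
  have s1: "a\<^sup>2 \<le> ?s"
  proof -
    have "a\<^sup>2 \<le> (1/5)\<^sup>2" using assms by (intro power_mono) auto
    then show ?thesis using e y2 zero_le_power2[of "fst x - p"] by linarith
  qed
  have s0: "?s > 0" using s1 assms(1) by (smt (verit) zero_less_power)
  have "3 * ?s \<le> ?y"
  proof -
    \<comment> \<open>This says y^2 <= y / 2 - 3/50; with a horizontal part of at most 1/100 and y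
      <= 3/10 it gives 3 r^2 <= y.\<close>
    have "0 \<le> (?y - 1/5) * (3/10 - ?y)" using y by (intro mult_nonneg_nonneg) auto
    then have "?y\<^sup>2 \<le> ?y / 2 - 3/50" by (simp add: power2_eq_square algebra_simps)
    moreover have "(fst x - p)\<^sup>2 \<le> 1/100" using x2 by (simp add: power2_eq_square)
    moreover have "3 * s \<le> y" if "B \<le> y / 2 - 3/50" "A \<le> 1/100" "s = A + B" "y \<le> 3/10" for A B s y :: real
      using that by linarith
    ultimately show ?thesis using e y(2) by blast
  qed
  then have "3 \<le> ?y / ?s" using s0 by (simp add: pos_le_divide_eq)
  moreover have "dip p a x = ?y / ?s"
  proof -
    have "?s / a\<^sup>2 \<ge> 1" using s1 assms(1) by simp
    then show ?thesis using GG_bounds(2) assms(1) by (simp add: dip_def)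
  qed
  ultimately have "dip p a x - 2 \<ge> 1" by simp
  then show ?thesis unfolding far_def by (rule FF_ge)
qed

text \<open>The centre lies e/2 above the wall, inside the tube, and the radius is e / sqrt 2. So
  only the outer rim of the bump, where it is subharmonic, reaches into the pipe.\<close>

definition near :: "real \<Rightarrow> real \<Rightarrow> pt \<Rightarrow> real" where
  "near p e = bump (p, 1 + e/2) (e\<^sup>2/2) (e\<^sup>2)"

text \<open>Let \<tau> be the squared distance to the centre divided by e^2. Below the wall \<tau>
  >= 1/4, and the bracket of \<open>lap_bump\<close> is \<tau>^2 + \<tau> - 1/4 >= 1/16. On the
  dipole core of radius e/8 also \<tau> <= 25/64, so t >= 1/10 and the exponential is at least exp
  (-10).\<close>

lemma near_lap:
  assumes "e > 0" "snd x \<le> 1"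
  shows "lap (near p e) x \<ge> 0" "dsq (p,1) x \<le> (e/8)\<^sup>2 \<Longrightarrow> lap (near p e) x \<ge> exp (-10) / (4 * e\<^sup>2)"
proof -
  have e2: "e\<^sup>2 > 0" using assms(1) by simp
  let ?c = "(p, 1 + e/2)"
  define \<tau> where "\<tau> = dsq ?c x / e\<^sup>2"
  define t where "t = (e\<^sup>2/2 - dsq ?c x) / e\<^sup>2"
  have t: "t = 1/2 - \<tau>" using e2 by (simp add: t_def \<tau>_def diff_divide_distrib)
  define y where "y = 1 - snd x"
  have y: "y \<ge> 0" using assms(2) by (simp add: y_def)
  have ds: "dsq ?c x = dsq (p,1) x + e * y + e\<^sup>2 / 4" by (simp add: dsq_def y_def power2_eq_square algebra_simps)
  have "dsq ?c x \<ge> e\<^sup>2 / 4" using ds y assms(1) dsq_nonneg[of "(p,1)" x] by simp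
  then have \<tau>: "\<tau> \<ge> 1/4" unfolding \<tau>_def using e2 by (simp add: pos_le_divide_eq)
  have K: "\<tau> * (1 - 2 * t) - t\<^sup>2 \<ge> 1/16"
  proof -
    have "\<tau> * (1 - 2 * t) - t\<^sup>2 = \<tau> * \<tau> + \<tau> - 1/4" unfolding t by (simp add: power2_eq_square algebra_simps)
    moreover have "1/4 * (1/4) \<le> \<tau> * \<tau>" using \<tau> by (intro mult_mono) auto
    ultimately show ?thesis using \<tau> by simp
  qed
  have l: "lap (near p e) x = (if t \<le> 0 then 0 else exp (-1/t) * (4 / (e\<^sup>2 * t^4)) * (\<tau> * (1 - 2 * t) - t\<^sup>2))"
    unfolding near_def lap_bump[OF e2] Let_def t_def \<tau>_def ..
  show "lap (near p e) x \<ge> 0" unfolding l using K e2 by (auto intro!: mult_nonneg_nonneg)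
  assume r: "dsq (p,1) x \<le> (e/8)\<^sup>2"
  have "dsq (p,1) x = (fst x - p)\<^sup>2 + y\<^sup>2" by (simp add: dsq_def y_def power2_commute)
  then have "y\<^sup>2 \<le> (e/8)\<^sup>2" using r zero_le_power2[of "fst x - p"] by linarith
  then have "y \<le> e/8" using power2_le_imp_le[of y "e/8"] assms(1) by simp
  then have "e * y \<le> e * (e/8)" using assms(1) by (intro mult_left_mono) auto
  then have "dsq ?c x \<le> e\<^sup>2 * (1/64 + 1/8 + 1/4)" unfolding ds using r by (simp add: power2_eq_square algebra_simps)
  then have "\<tau> \<le> 1/64 + 1/8 + 1/4" unfolding \<tau>_def using e2 by (simp add: pos_divide_le_eq mult.commute)
  then have t1: "1/10 \<le> t" "t \<le> 1" using t \<tau> by auto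
  have "exp (-10) * (4 / e\<^sup>2) * (1/16) \<le> exp (-1/t) * (4 / (e\<^sup>2 * t^4)) * (\<tau> * (1 - 2 * t) - t\<^sup>2)"
  proof (intro mult_mono K)
    have "1 / t \<le> 10" using t1 by (simp add: pos_divide_le_eq)
    then show "exp (-10) \<le> exp (-1/t)" by simp
    have "t^4 \<le> 1" using t1 by (intro power_le_one) auto
    then have "e\<^sup>2 * t^4 \<le> e\<^sup>2 * 1" using e2 by (intro mult_left_mono) auto
    then show "4 / e\<^sup>2 \<le> 4 / (e\<^sup>2 * t^4)" using e2 t1 by (intro divide_left_mono) auto
  qed (use e2 t1 in auto)
  then show "lap (near p e) x \<ge> exp (-10) / (4 * e\<^sup>2)" unfolding l using t1 by simp
qed

lemma smooth_near: "smoothOn UNIV (near p e)" unfolding near_def by (rule smooth_bump)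

text \<open>The constant \<open>\<theta>\<close> does not depend on the width of the tube: the negative part of the
  Laplacian of the regularised dipole is absorbed by the bump across the opening.\<close>

lemma near_far_subharmonic:
  obtains \<theta> where "\<theta> > 0"
    "\<And>e p x. e > 0 \<Longrightarrow> snd x \<le> 1 \<Longrightarrow> lap (near p e) x + \<theta> * e * lap (far p (e/8)) x \<ge> 0"
proof -
  obtain C where C: "C \<ge> 0" "\<And>q. 0 \<le> q \<Longrightarrow> q \<le> 1 \<Longrightarrow> \<bar>q * G2 q + 2 * G1 q\<bar> \<le> C" by (rule GG_lap_bounded) blast
  \<comment> \<open>On the core the depth is at most a = e/8, so the Laplacian of the dipole is at
    most 4 C / a^3 = 2048 C / e^3 in modulus. Times \<theta> e it must stay below exp (-10) / (4
    e^2), whence 8192, four times 2048.\<close>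
  define \<theta> :: real where "\<theta> = exp (-10) / (8192 * (C + 1))"
  have \<theta>: "\<theta> > 0" using C(1) by (simp add: \<theta>_def)
  have \<theta>C: "\<theta> * (8192 * C) \<le> exp (-10)"
  proof -
    have "\<theta> * (8192 * C) \<le> \<theta> * (8192 * (C + 1))" using \<theta> by simp
    also have "\<dots> = exp (-10)" using C(1) by (simp add: \<theta>_def)
    finally show ?thesis .
  qed
  show ?thesis
  proof (rule that[OF \<theta>])
    fix e p :: real and x :: pt
    assume e: "e > 0" and x: "snd x \<le> 1"
    let ?a = "e/8" and ?q = "dsq (p,1) x / (e/8)\<^sup>2" and ?y = "1 - snd x"
    have a: "?a > 0" using e by simp
    have f1: "0 \<le> FF1 (dip p ?a x - 2)" "FF1 (dip p ?a x - 2) \<le> 1" using FF1_bounds by auto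
    show "lap (near p e) x + \<theta> * e * lap (far p ?a) x \<ge> 0"
    proof (cases "dsq (p,1) x \<le> ?a\<^sup>2")
      case False
      then have "?q > 1" using a by (simp add: pos_less_divide_eq)
      then have "lap (dip p ?a) x = 0" unfolding lap_dip[OF a] by (simp only: GG_harmonic mult_zero_right)
      then have "lap (far p ?a) x \<ge> 0" using lap_far_ge[of p ?a x] by simp
      then show ?thesis using near_lap(1)[OF e x] \<theta> e by simp
    next
      case True
      have q: "0 \<le> ?q" "?q \<le> 1" using True a dsq_nonneg[of "(p,1)" x] by (simp_all add: pos_divide_le_eq)
      have "dsq (p,1) x = (fst x - p)\<^sup>2 + ?y\<^sup>2" by (simp add: dsq_def power2_commute)
      then have "?y\<^sup>2 \<le> ?a\<^sup>2" using True zero_le_power2[of "fst x - p"] by linarith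
      then have y: "0 \<le> ?y" "?y \<le> ?a" using x a power2_le_imp_le[of ?y ?a] by auto
      have "\<bar>4 * ?y / ?a^4\<bar> = 4 * ?y / ?a^4" using y a by (intro abs_of_nonneg divide_nonneg_nonneg) auto
      also have "\<dots> \<le> 4 * ?a / ?a^4" using y by (intro divide_right_mono) auto
      finally have k1: "\<bar>4 * ?y / ?a^4\<bar> \<le> 4 * ?a / ?a^4" .
      have "\<bar>lap (dip p ?a) x\<bar> \<le> (4 * ?a / ?a^4) * C"
        unfolding lap_dip[OF a] abs_mult[of "4 * ?y / ?a^4"]
        by (rule mult_mono[OF k1 C(2)[OF q]]) (use a in auto)
      also have "(4 * ?a / ?a^4) * C = 2048 * C / e^3" using e by (simp add: field_simps eval_nat_numeral)
      finally have ld: "\<bar>lap (dip p ?a) x\<bar> \<le> 2048 * C / e^3" .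
      have "\<bar>FF1 (dip p ?a x - 2) * lap (dip p ?a) x\<bar> \<le> 1 * (2048 * C / e^3)"
        unfolding abs_mult using f1 ld by (intro mult_mono) auto
      then have "lap (far p ?a) x \<ge> - (2048 * C / e^3)" using lap_far_ge[of p ?a x] by linarith
      then have "\<theta> * e * lap (far p ?a) x \<ge> \<theta> * e * (- (2048 * C / e^3))" using \<theta> e by (intro mult_left_mono) auto
      also have "\<theta> * e * (- (2048 * C / e^3)) = - (\<theta> * (8192 * C)) / (4 * e\<^sup>2)" using e by (simp add: field_simps eval_nat_numeral)
      finally have "\<theta> * e * lap (far p ?a) x \<ge> - (\<theta> * (8192 * C)) / (4 * e\<^sup>2)" by simp
      moreover have "- (\<theta> * (8192 * C)) / (4 * e\<^sup>2) \<ge> - exp (-10) / (4 * e\<^sup>2)" using \<theta>C by (intro divide_right_mono) auto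
      ultimately show ?thesis using near_lap(2)[OF e x True] by simp
    qed
  qed
qed

text \<open>The sum of \<open>near\<close> and \<theta> e times \<open>far\<close> is subharmonic in
  the pipe, so testing with it leaves the zero-order term, at least a multiple of e times the mass
  on \<open>target\<close>. Since \<open>far\<close> is a test function on the pipe, its share is a
  mere error by \<open>nearmin_Bl\<close>; \<open>near\<close> crosses the wall and carries the
  gain.\<close>

lemma near_gain:
  obtains \<theta> where "\<theta> > 0"
    "\<And>e p u \<eta>. 0 < e \<Longrightarrow> e \<le> 1/2 \<Longrightarrow> 2 \<le> p \<Longrightarrow> p \<le> 21/10 \<Longrightarrow> nearmin \<eta> u \<Longrightarrow>
      Bl (lambda1 H_pipe) u (near p e) \<le> - (\<theta> * e * mass target u) + e * (sqrt (En (lambda1 H_pipe) (far p (e/8))) * sqrt \<eta>)"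
proof -
  let ?l = "lambda1 H_pipe"
  have l: "?l > 0" using lambda1_H_pos by linarith
  obtain \<theta>0 where \<theta>0: "\<theta>0 > 0" "\<And>e p x. e > 0 \<Longrightarrow> snd x \<le> 1 \<Longrightarrow> lap (near p e) x + \<theta>0 * e * lap (far p (e/8)) x \<ge> 0"
    by (rule near_far_subharmonic) blast
  \<comment> \<open>Capping at 1 removes \<theta> from the error term. A smaller factor keeps
    subharmonicity, because the Laplacian of \<open>near\<close> is non-negative by itself.\<close>
  define \<theta> where "\<theta> = min \<theta>0 1"
  have \<theta>: "\<theta> > 0" "\<theta> \<le> 1" "\<theta> \<le> \<theta>0" using \<theta>0(1) by (auto simp: \<theta>_def)
  have sub: "lap (near p e) x + \<theta> * e * lap (far p (e/8)) x \<ge> 0" if "e > 0" "snd x \<le> 1" for e p x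
  proof -
    have n: "lap (near p e) x \<ge> 0" by (rule near_lap(1)[OF that])
    show ?thesis
    proof (cases "lap (far p (e/8)) x \<ge> 0")
      case True then show ?thesis using n \<theta> that by simp
    next
      case False
      then have "\<theta>0 * e * lap (far p (e/8)) x \<le> \<theta> * e * lap (far p (e/8)) x"
        using \<theta> that by (intro mult_right_mono_neg mult_right_mono) auto
      then show ?thesis using \<theta>0(2)[OF that, of p] by linarith
    qed
  qed
  show ?thesis
  proof (rule that[of "\<theta> * ?l * exp (-1)"])
    show "\<theta> * ?l * exp (-1) > 0" using \<theta> l by simp
    fix e p \<eta> :: real and u
    assume e: "0 < e" "e \<le> 1/2" and p: "2 \<le> p" "p \<le> 21/10" and nm: "nearmin \<eta> u"
    note u = nearminD(1,2)[OF nm]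
    let ?n = "near p e" and ?f = "far p (e/8)"
    have tf: "test_fun H_pipe ?f" using e p by (intro test_far) auto
    note gn = Bl_green[OF u(1) smooth_near[of p e], of ?l] and gf = Bl_green[OF u(1) smooth_far[of p "e/8"], of ?l]
    have mt: "target \<in> sets borel" by (intro borel_open open_ball)
    have "\<theta> * ?l * exp (-1) * e * mass target u = (\<integral>x. \<theta> * ?l * exp (-1) * e * (indicator target x * u x) \<partial>lborel)"
      unfolding mass_def by simp
    also have "\<dots> \<le> (\<integral>x. u x * (lap ?n x + ?l * ?n x) + \<theta> * e * (u x * (lap ?f x + ?l * ?f x)) \<partial>lborel)"
    proof (intro integral_mono integrable_mult_right integrable_mass[OF u(1) mt] Bochner_Integration.integrable_add gn(1) gf(1))
      fix x
      show "\<theta> * ?l * exp (-1) * e * (indicator target x * u x) \<le> u x * (lap ?n x + ?l * ?n x) + \<theta> * e * (u x * (lap ?f x + ?l * ?f x))"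
      proof (cases "x \<in> H_pipe")
        case False
        then show ?thesis using test_fun_outside[OF u(1) False] by simp
      next
        case True
        have s: "snd x \<le> 1" using H_pipe_snd[OF True] by simp
        have f0: "?f x \<ge> 0" by (simp add: far_def FF_nonneg)
        have "exp (-1) * indicator target x \<le> ?f x"
          using far_target[of "e/8" p x] e p f0 by (cases "x \<in> target") (simp_all del: mem_ball)
        then have "(\<theta> * e * ?l) * (exp (-1) * indicator target x) \<le> (\<theta> * e * ?l) * ?f x"
          using \<theta> e l by (intro mult_left_mono) auto
        moreover have "?l * ?n x \<ge> 0" using l by (simp add: near_def bump_nonneg)
        ultimately have "\<theta> * ?l * exp (-1) * e * indicator target x \<le> (lap ?n x + ?l * ?n x) + \<theta> * e * (lap ?f x + ?l * ?f x)"
          using sub[OF e(1) s, of p] by (simp add: algebra_simps)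
        from mult_left_mono[OF this u(2)[of x]] show ?thesis by (simp add: algebra_simps)
      qed
    qed
    also have "\<dots> = - Bl ?l u ?n - \<theta> * e * Bl ?l u ?f" using gn gf by simp
    finally have 1: "Bl ?l u ?n \<le> - (\<theta> * ?l * exp (-1) * e * mass target u) - \<theta> * e * Bl ?l u ?f" by simp
    have "\<bar>\<theta> * e * Bl ?l u ?f\<bar> \<le> 1 * e * (sqrt (En ?l ?f) * sqrt \<eta>)"
      unfolding abs_mult using nearmin_Bl[OF nm tf] \<theta> e by (intro mult_mono) auto
    then show "Bl ?l u ?n \<le> - (\<theta> * ?l * exp (-1) * e * mass target u) + e * (sqrt (En ?l ?f) * sqrt \<eta>)"
      using 1 by linarith
  qed
qed

subsection \<open>Geometry of the perturbed pipe\<close>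

lemma mem_H_pert:
  "x \<in> H_pert e n \<longleftrightarrow> x \<in> H_pipe \<or> (\<exists>i\<le>n. \<bar>fst x - (2 + real i / real n)\<bar> < e \<and> 1 \<le> snd x \<and> snd x < 2)"
proof -
  have t: "x \<in> T_tube e n i \<longleftrightarrow> \<bar>fst x - (2 + real i / real n)\<bar> < e \<and> 1 \<le> snd x \<and> snd x < 2" for i
    by (cases x) (auto simp: T_tube_def abs_diff_less_iff)
  show ?thesis by (simp only: H_pert_def Un_iff UN_iff t atLeastAtMost_iff Bex_def le0 simp_thms)
qed

text \<open>A tube contains its bottom x2 = 1 and so is not open. Extended down to x2 > 0 it is, and
  the added part lies in the pipe, since e < 1 keeps x1 positive.\<close>

lemma H_pert_Un:
  assumes "e < 1"
  shows "H_pert e n = H_pipe \<union> (\<Union>i\<in>{0..n}. {2 + real i / real n - e<..<2 + real i / real n + e} \<times> {0<..<2})" (is "_ = ?R")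
proof (rule set_eqI)
  fix x :: pt
  have p: "\<bar>fst x - (2 + real i / real n)\<bar> < e \<Longrightarrow> 0 \<le> fst x" for i
  proof -
    assume "\<bar>fst x - (2 + real i / real n)\<bar> < e"
    moreover have "real i / real n \<ge> 0" by simp
    ultimately show ?thesis using assms by linarith
  qed
  have R: "x \<in> ?R \<longleftrightarrow> x \<in> H_pipe \<or> (\<exists>i\<le>n. \<bar>fst x - (2 + real i / real n)\<bar> < e \<and> 0 < snd x \<and> snd x < 2)"
  proof -
    have t: "x \<in> {2 + real i / real n - e<..<2 + real i / real n + e} \<times> {0<..<2} \<longleftrightarrow>
      \<bar>fst x - (2 + real i / real n)\<bar> < e \<and> 0 < snd x \<and> snd x < 2" for i
      by (cases x) (auto simp: abs_diff_less_iff)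
    show ?thesis by (simp only: Un_iff UN_iff t atLeastAtMost_iff Bex_def le0 simp_thms)
  qed
  have H: "0 \<le> fst x \<Longrightarrow> 0 < snd x \<Longrightarrow> snd x < 1 \<Longrightarrow> x \<in> H_pipe" by (simp add: mem_H_pipe)
  show "x \<in> H_pert e n \<longleftrightarrow> x \<in> ?R"
  proof
    assume "x \<in> H_pert e n"
    then show "x \<in> ?R" unfolding R mem_H_pert by force
  next
    assume "x \<in> ?R"
    then show "x \<in> H_pert e n" unfolding R mem_H_pert using p H by (meson not_le)
  qed
qed

lemma open_H_pert: "e < 1 \<Longrightarrow> open (H_pert e n)"
  unfolding H_pert_Un by (intro open_Un open_UN ballI open_Times open_H_pipe open_greaterThanLessThan)

lemma connected_H_pert:
  assumes "0 < e" "e < 1" shows "connected (H_pert e n)"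
  unfolding H_pert_Un[OF assms(2)]
proof (rule connected_Un_UN[OF connected_H_pipe])
  fix X assume "X \<in> (\<lambda>i. {2 + real i / real n - e<..<2 + real i / real n + e} \<times> {0<..<2::real}) ` {0..n}"
  then obtain i where X: "X = {2 + real i / real n - e<..<2 + real i / real n + e} \<times> {0<..<2::real}" by blast
  show "connected X" unfolding X by (intro connected_Times connected_Ioo)
  have "(2 + real i / real n, 1/2) \<in> H_pipe \<inter> X" using assms by (simp add: X mem_H_pipe)
  then show "H_pipe \<inter> X \<noteq> {}" by blast
qed

text \<open>If \<open>a\<close> lies over an opening, the end of that opening on the side of
  \<open>a\<close> belongs to the wall: openings are open intervals, and their spacing 1/n exceeds 2
  e.\<close>

lemma wall_point:
  assumes "n \<ge> 1" "0 < e" "e < 1 / (2 * real n)"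
  obtains t where "\<bar>t - a\<bar> \<le> e" "\<And>i. i \<le> n \<Longrightarrow> \<not> \<bar>t - (2 + real i / real n)\<bar> < e"
proof (cases "\<exists>i\<le>n. \<bar>a - (2 + real i / real n)\<bar> < e")
  case False
  then show ?thesis using that[of a] assms by auto
next
  case True
  then obtain i where i: "i \<le> n" "\<bar>a - (2 + real i / real n)\<bar> < e" by blast
  define p where "p j = 2 + real j / real n" for j
  define t where "t = (if a \<ge> p i then p i + e else p i - e)"
  have sep: "\<bar>p i - p j\<bar> > 2 * e" if "j \<noteq> i" for j
  proof -
    have "1 \<le> \<bar>real i - real j\<bar>" using that by linarith
    then have "1 / real n \<le> \<bar>real i - real j\<bar> / real n" by (intro divide_right_mono) auto
    also have "\<dots> = \<bar>p i - p j\<bar>" by (simp add: p_def abs_divide flip: diff_divide_distrib)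
    finally have "1 / real n \<le> \<bar>p i - p j\<bar>" .
    moreover have "2 * e < 1 / real n" using assms by (simp add: field_simps)
    ultimately show ?thesis by linarith
  qed
  show ?thesis
  proof (rule that[of t])
    show "\<bar>t - a\<bar> \<le> e" using i(2) by (auto simp: t_def p_def[symmetric] abs_if split: if_splits)
    fix j assume "j \<le> n"
    have ti: "\<bar>t - p i\<bar> = e" using assms(2) by (simp add: t_def)
    have "\<not> \<bar>t - p j\<bar> < e"
    proof (cases "j = i")
      case True then show ?thesis using ti by simp
    next
      case False then show ?thesis using sep[OF False] ti by linarith
    qed
    then show "\<not> \<bar>t - (2 + real j / real n)\<bar> < e" by (simp add: p_def)
  qed
qed

text \<open>The critical centres lie in the upper arm, at height b: the slit is at distance b and
  some wall point at distance at most sqrt (e^2 + (1 - b)^2). The two agree at b = (1 + e^2) / 2,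
  whatever the number of tubes. Elsewhere 1/2 is an upper bound.\<close>

lemma ball_in_H_pert:
  assumes "n \<ge> 1" "0 < e" "e < 1 / (2 * real n)" "x \<in> H_pert e n" "ball x r \<subseteq> H_pert e n"
  shows "r \<le> (1 + e\<^sup>2) / 2"
proof -
  have "1 / (2 * real n) \<le> 1/2" using assms(1) by (simp add: field_simps)
  then have e: "e < 1/2" using assms(3) by linarith
  have "1 / 2 \<le> (1 + e\<^sup>2) / 2" by (intro divide_right_mono) auto
  then have e2: "s \<le> (1 + e\<^sup>2) / 2" if "s \<le> 1 / 2" for s using that by (rule order_trans[rotated])
  obtain a b where x: "x = (a,b)" by (cases x)
  have far: "r \<le> dist x z" if "z \<notin> H_pert e n" for z using assms(5) that by (meson mem_ball not_le subsetD)
  have tubepos: "\<not> \<bar>s - (2 + real i / real n)\<bar> < e" if "s \<le> 0" for s i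
  proof -
    have "real i / real n \<ge> 0" by simp
    then show ?thesis using that e by linarith
  qed
  consider "a < 0" | "a \<ge> 0" "b \<le> 0" | "a \<ge> 0" "b > 0" "b < 1" | "a \<ge> 0" "b \<ge> 1" by linarith
  then show ?thesis
  proof cases
    case 1
    then have xH: "a\<^sup>2 + b\<^sup>2 < 1" using assms(4) tubepos[of a] by (auto simp: mem_H_pert mem_H_pipe x)
    define s where "s = norm x"
    have s2: "s\<^sup>2 = a\<^sup>2 + b\<^sup>2" by (simp add: s_def x norm_Pair)
    have s0: "s > 0" using 1 by (auto simp: s_def x zero_prod_def)
    have s1: "s < 1" using xH s2 s0 by (metis abs_square_less_1 abs_of_pos)
    have "(0,0) \<notin> H_pert e n" by (simp add: mem_H_pert mem_H_pipe)
    from far[OF this] have r1: "r \<le> s" by (simp add: s_def dist_norm flip: zero_prod_def)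
    let ?z = "(1/s) *\<^sub>R x"
    have nz: "(fst ?z)\<^sup>2 + (snd ?z)\<^sup>2 = 1" using s0 by (simp add: x power_divide s2[symmetric] flip: add_divide_distrib)
    have "fst ?z < 0" using 1 s0 by (simp add: x divide_neg_pos)
    then have "?z \<notin> H_pert e n" using nz tubepos[of "fst ?z"] by (auto simp: mem_H_pert mem_H_pipe)
    from far[OF this] have "r \<le> norm ((1 - 1/s) *\<^sub>R x)" by (simp add: dist_norm scaleR_diff_left)
    also have "\<dots> = \<bar>1 - 1/s\<bar> * s" by (simp add: s_def)
    also have "\<dots> = 1 - s" using s0 s1 by (simp add: abs_if field_simps)
    finally have "r \<le> 1 - s" .
    with r1 show ?thesis by (intro e2) linarith
  next
    case 2
    have "(a,0) \<notin> H_pert e n" using 2 by (simp add: mem_H_pert mem_H_pipe)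
    from far[OF this] have r1: "r \<le> - b" using 2 by (simp add: x dist_Pair_Pair dist_real_def)
    have "(a,-1) \<notin> H_pert e n" using 2 by (simp add: mem_H_pert mem_H_pipe)
    from far[OF this] have "r \<le> \<bar>b + 1\<bar>" by (simp add: x dist_Pair_Pair dist_real_def)
    moreover have "\<bar>b\<bar> < 1" using 2 assms(4) by (auto simp: mem_H_pert mem_H_pipe x)
    ultimately show ?thesis using r1 by (intro e2) linarith
  next
    case 3
    have "(a,0) \<notin> H_pert e n" using 3 by (simp add: mem_H_pert mem_H_pipe)
    from far[OF this] have r1: "r \<le> b" using 3 by (simp add: x dist_Pair_Pair dist_real_def)
    obtain t where t: "\<bar>t - a\<bar> \<le> e" "\<And>i. i \<le> n \<Longrightarrow> \<not> \<bar>t - (2 + real i / real n)\<bar> < e" by (rule wall_point[OF assms(1-3)]) blast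
    have "(t,1) \<notin> H_pert e n" using t(2) zero_le_power2[of t] by (auto simp: mem_H_pert mem_H_pipe simp del: zero_le_power2)
    from far[OF this] have r2: "r \<le> sqrt ((a - t)\<^sup>2 + (b - 1)\<^sup>2)" by (simp add: x dist_Pair_Pair dist_real_def)
    show ?thesis
    proof (cases "b \<le> (1 + e\<^sup>2) / 2")
      case True then show ?thesis using r1 by simp
    next
      case False
      have "(a - t)\<^sup>2 \<le> e\<^sup>2" using t(1) assms(2) by (intro abs_le_square_iff[THEN iffD1]) auto
      moreover have "(b - 1)\<^sup>2 \<le> ((1 - e\<^sup>2) / 2)\<^sup>2" using False 3
        by (intro abs_le_square_iff[THEN iffD1]) (auto simp: abs_if)
      ultimately have "(a - t)\<^sup>2 + (b - 1)\<^sup>2 \<le> e\<^sup>2 + ((1 - e\<^sup>2) / 2)\<^sup>2" by (rule add_mono)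
      also have "\<dots> = ((1 + e\<^sup>2) / 2)\<^sup>2" by (simp add: power2_eq_square field_simps)
      finally have "sqrt ((a - t)\<^sup>2 + (b - 1)\<^sup>2) \<le> (1 + e\<^sup>2) / 2" by (intro real_le_lsqrt) auto
      then show ?thesis using r2 by simp
    qed
  next
    case 4
    obtain t where t: "\<bar>t - a\<bar> \<le> e" "\<And>i. i \<le> n \<Longrightarrow> \<not> \<bar>t - (2 + real i / real n)\<bar> < e" by (rule wall_point[OF assms(1-3)]) blast
    have "(t,b) \<notin> H_pert e n"
    proof
      assume "(t,b) \<in> H_pert e n"
      then have "(t,b) \<in> H_pipe" using t(2) by (auto simp: mem_H_pert)
      then show False using H_pipe_snd[of "(t,b)"] 4 by simp
    qed
    from far[OF this] have "r \<le> \<bar>a - t\<bar>" by (simp add: x dist_Pair_Pair dist_real_def)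
    then show ?thesis using t(1) e by (intro e2) (simp add: abs_minus_commute)
  qed
qed

lemma H_pipe_subset_pert: "H_pipe \<subseteq> H_pert e n" by (auto simp: H_pert_def)

text \<open>A crude bound, read off from a perturbed pipe with e = 1/4. It makes the set under
  \<open>Sup\<close> in \<open>inradius\<close> bounded, so that a single ball of radius 1/2 gives a
  lower bound.\<close>

lemma ball_in_H_pipe: "x \<in> H_pipe \<Longrightarrow> ball x r \<subseteq> H_pipe \<Longrightarrow> r \<le> (1 + (1/4)\<^sup>2) / 2"
  using ball_in_H_pert[of 1 "1/4" x r] H_pipe_subset_pert[of "1/4" 1] by (auto dest: subset_trans)

lemma half_ball_in_H_pipe: "ball (1,1/2) (1/2) \<subseteq> H_pipe"
proof
  fix x :: pt assume "x \<in> ball (1,1/2) (1/2)"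
  then have "\<bar>fst x - 1\<bar> < 1/2" "\<bar>snd x - 1/2\<bar> < 1/2"
    using dist_fst_le[of "(1,1/2)" x] dist_snd_le[of "(1,1/2)" x] by (simp_all add: dist_real_def abs_minus_commute)
  then show "x \<in> H_pipe" unfolding mem_H_pipe by linarith
qed

lemma inradius_H_pipe: "inradius H_pipe \<ge> 1/2"
  unfolding inradius_def
proof (rule cSup_upper)
  have "(1,1/2) \<in> H_pipe" by (simp add: mem_H_pipe)
  then show "1/2 \<in> {r. r > 0 \<and> (\<exists>x\<in>H_pipe. ball x r \<subseteq> H_pipe)}" using half_ball_in_H_pipe by auto
  show "bdd_above {r. r > 0 \<and> (\<exists>x\<in>H_pipe. ball x r \<subseteq> H_pipe)}"
    by (rule bdd_aboveI[of _ "(1 + (1/4)\<^sup>2) / 2"]) (use ball_in_H_pipe in blast)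
qed

lemma inradius_H_pert:
  assumes "n \<ge> 1" "0 < e" "e < 1 / (2 * real n)"
  shows "0 \<le> inradius (H_pert e n)" "inradius (H_pert e n) \<le> (1 + e\<^sup>2) / 2" "finite_inradius (H_pert e n)"
proof -
  let ?S = "{r. r > 0 \<and> (\<exists>x\<in>H_pert e n. ball x r \<subseteq> H_pert e n)}"
  have "(1,1/2) \<in> H_pipe" by (simp add: mem_H_pipe)
  then have h: "1/2 \<in> ?S" using half_ball_in_H_pipe H_pipe_subset_pert[of e n] by auto
  have u: "r \<le> (1 + e\<^sup>2) / 2" if "r \<in> ?S" for r using that ball_in_H_pert[OF assms] by blast
  then have b: "bdd_above ?S" by (rule bdd_aboveI)
  then show "finite_inradius (H_pert e n)" by (simp add: finite_inradius_def)
  show "inradius (H_pert e n) \<le> (1 + e\<^sup>2) / 2" unfolding inradius_def by (rule cSup_least[OF _ u]) (use h in blast)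
  have "1/2 \<le> inradius (H_pert e n)" unfolding inradius_def by (rule cSup_upper[OF h b])
  then show "0 \<le> inradius (H_pert e n)" by simp
qed

text \<open>The ray is radial in the left half plane, vertical above and below the pipe, and
  horizontal along the slit. Hence no component of the complement is bounded.\<close>

lemma H_pert_escape:
  assumes "0 < e" "e < 1" "(a,b) \<notin> H_pert e n"
  obtains v :: pt where "v \<noteq> 0" "\<And>s. s \<ge> 0 \<Longrightarrow> (a,b) + s *\<^sub>R v \<notin> H_pert e n"
proof -
  have tubepos: "\<not> \<bar>s - (2 + real i / real n)\<bar> < e" if "s \<le> 0" for s i
  proof -
    have "real i / real n \<ge> 0" by simp
    then show ?thesis using that assms(2) by linarith
  qed
  consider "a < 0" | "a \<ge> 0" "b \<ge> 1" | "a \<ge> 0" "b \<le> -1" | "a \<ge> 0" "b = 0" | "a \<ge> 0" "0 < \<bar>b\<bar>" "\<bar>b\<bar> < 1" by linarith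
  then show thesis
  proof cases
    case 1
    then have n1: "a\<^sup>2 + b\<^sup>2 \<ge> 1" using assms(3) by (auto simp: mem_H_pert mem_H_pipe)
    show thesis
    proof (rule that[of "(a,b)"])
      show "(a,b) \<noteq> 0" using 1 by (simp add: zero_prod_def)
      fix s :: real assume s: "s \<ge> 0"
      have e: "(a,b) + s *\<^sub>R (a,b) = ((1 + s) * a, (1 + s) * b)" by (simp add: algebra_simps)
      have neg: "(1 + s) * a < 0" using 1 s by (simp add: mult_pos_neg)
      have "1 * 1 \<le> (1 + s)\<^sup>2 * (a\<^sup>2 + b\<^sup>2)" using s n1 by (intro mult_mono) auto
      then have "1 \<le> ((1 + s) * a)\<^sup>2 + ((1 + s) * b)\<^sup>2" by (simp add: power_mult_distrib distrib_left)
      then show "(a,b) + s *\<^sub>R (a,b) \<notin> H_pert e n" unfolding e mem_H_pert mem_H_pipe fst_conv snd_conv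
        using neg tubepos[of "(1 + s) * a"] by (meson less_imp_le not_le)
    qed
  next
    case 2
    show thesis
    proof (rule that[of "(0,1)"])
      fix s :: real assume s: "s \<ge> 0"
      show "(a,b) + s *\<^sub>R (0,1) \<notin> H_pert e n"
        using 2 s assms(3) by (auto simp: mem_H_pert mem_H_pipe)
    qed (simp add: zero_prod_def)
  next
    case 3
    show thesis
      by (rule that[of "(0,-1)"]) (use 3 in \<open>auto simp: zero_prod_def mem_H_pert mem_H_pipe\<close>)
  next
    case 4
    show thesis
      by (rule that[of "(1,0)"]) (use 4 in \<open>auto simp: zero_prod_def mem_H_pert mem_H_pipe\<close>)
  next
    case 5
    then have "(a,b) \<in> H_pert e n" by (simp add: mem_H_pert mem_H_pipe)
    then show thesis using assms(3) by simp
  qed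
qed

text \<open>In the complex plane an open connected set is simply connected if its complement has
  only unbounded components; the identification of the two planes is a homeomorphism.\<close>

lemma simply_connected_H_pert:
  assumes "0 < e" "e < 1" shows "simply_connected (H_pert e n)"
proof -
  let ?f = "\<lambda>z::complex. (Re z, Im z)" and ?g = "\<lambda>x::pt. Complex (fst x) (snd x)"
  define T where "T = ?f -` H_pert e n"
  have cf: "continuous_on UNIV ?f" by (intro continuous_intros)
  have cg: "continuous_on UNIV ?g" unfolding complex_eq by (intro continuous_intros)
  have h: "H_pert e n homeomorphic T"
  proof -
    have gT: "?g ` H_pert e n = T"
    proof safe
      show "Complex (fst (a,b)) (snd (a,b)) \<in> T" if "(a,b) \<in> H_pert e n" for a b using that by (simp add: T_def)
      show "z \<in> ?g ` H_pert e n" if "z \<in> T" for z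
        by (rule image_eqI[of _ _ "(Re z, Im z)"]) (use that in \<open>auto simp: T_def\<close>)
    qed
    have fT: "?f ` T = H_pert e n"
    proof safe
      show "(Re z, Im z) \<in> H_pert e n" if "z \<in> T" for z using that by (simp add: T_def)
      show "(a,b) \<in> ?f ` T" if "(a,b) \<in> H_pert e n" for a b
        by (rule image_eqI[of _ _ "Complex a b"]) (use that in \<open>auto simp: T_def\<close>)
    qed
    show ?thesis unfolding homeomorphic_def homeomorphism_def
      by (intro exI[of _ ?g] exI[of _ ?f] conjI gT fT continuous_on_subset[OF cf] continuous_on_subset[OF cg]) auto
  qed
  have oT: "open T" unfolding T_def using open_vimage[OF open_H_pert[OF assms(2)] cf] .
  have "connected T" using homeomorphic_connectedness[OF h] connected_H_pert[OF assms] by blast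
  moreover have "\<not> bounded C" if C: "C \<in> components (- T)" for C
  proof
    assume bC: "bounded C"
    obtain z where z: "z \<in> C" using in_components_nonempty[OF C] by blast
    then have "z \<notin> T" using in_components_subset[OF C] by blast
    then have "(Re z, Im z) \<notin> H_pert e n" by (simp add: T_def)
    then obtain v where v: "v \<noteq> 0" "\<And>s. s \<ge> 0 \<Longrightarrow> (Re z, Im z) + s *\<^sub>R v \<notin> H_pert e n"
      by (rule H_pert_escape[OF assms]) blast
    let ?w = "?g v"
    let ?r = "\<lambda>s::real. z + s *\<^sub>R ?w"
    have w: "?w \<noteq> 0" using v(1) by (cases v) (auto simp: complex_eq_iff zero_prod_def)
    have sub: "?r ` {0..} \<subseteq> - T" using v(2) by (cases v) (auto simp: T_def)
    have "connected (?r ` {0..})" by (intro connected_continuous_image continuous_intros connected_Ici)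
    moreover have "?r 0 \<in> ?r ` {0..}" by blast
    then have "C \<inter> ?r ` {0..} \<noteq> {}" using z by auto
    ultimately have "?r ` {0..} \<subseteq> C" using components_maximal[OF C _ sub] by blast
    then obtain B where B: "\<And>s. s \<ge> 0 \<Longrightarrow> norm (?r s) \<le> B"
      using bC unfolding bounded_iff by (metis atLeast_iff image_subset_iff)
    have B0: "norm z \<le> B" using B[of 0] by simp
    \<comment> \<open>Far enough along the ray to leave the ball of radius \<open>B\<close>.\<close>
    define s where "s = (2 * B + 1) / norm ?w"
    have nw: "norm ?w > 0" using w by simp
    have B1: "B \<ge> 0" using B0 norm_ge_zero[of z] by linarith
    have s0: "s \<ge> 0" using B1 nw by (simp add: s_def)
    have "norm (s *\<^sub>R ?w) = 2 * B + 1" using nw B1 by (simp add: s_def)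
    moreover have "norm (s *\<^sub>R ?w) \<le> norm (?r s) + norm z" using norm_triangle_ineq4[of "?r s" z] by simp
    ultimately show False using B[OF s0] B0 by linarith
  qed
  ultimately have "simply_connected T" using simply_connected_eq_unbounded_complement_components[OF oT] by blast
  then show ?thesis using homeomorphic_simply_connected_eq[OF h] by blast
qed

subsection \<open>Attaching many tubes\<close>

lemma sum_sq_disjoint:
  fixes a :: "'i \<Rightarrow> real"
  assumes "finite I" "\<And>i j. i \<in> I \<Longrightarrow> j \<in> I \<Longrightarrow> i \<noteq> j \<Longrightarrow> a i * a j = 0"
  shows "(\<Sum>i\<in>I. a i)\<^sup>2 = (\<Sum>i\<in>I. (a i)\<^sup>2)"
proof -
  have "(\<Sum>j\<in>I. a i * a j) = (a i)\<^sup>2" if "i \<in> I" for i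
  proof -
    have "(\<Sum>j\<in>I. a i * a j) = (\<Sum>j\<in>{i}. a i * a j)"
      by (rule sum.mono_neutral_right[OF assms(1)]) (use that assms(2) in auto)
    then show ?thesis by (simp add: power2_eq_square)
  qed
  then show ?thesis by (simp add: power2_eq_square sum_product)
qed

lemma dx_sum:
  assumes "finite I" "\<And>i. i \<in> I \<Longrightarrow> smoothOn UNIV (f i)"
  shows "pd (\<lambda>x. \<Sum>i\<in>I. f i x) (\<Sum>i\<in>I. dx1 (f i) x) (\<Sum>i\<in>I. dx2 (f i) x) x"
  using assms
proof (induction I rule: finite_induct)
  case empty
  then show ?case using pd_const[of 0 x] by simp
next
  case (insert i I)
  have "pd (\<lambda>x. f i x + (\<Sum>i\<in>I. f i x)) (dx1 (f i) x + (\<Sum>i\<in>I. dx1 (f i) x)) (dx2 (f i) x + (\<Sum>i\<in>I. dx2 (f i) x)) x"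
    using insert by (intro pd_add smoothOn_pd insert.IH) auto
  then show ?case using insert by simp
qed

lemma Bl_sum:
  assumes "finite I" "test_fun \<Omega> u" "\<And>i. i \<in> I \<Longrightarrow> test_fun \<Omega>' (f i)"
  shows "Bl l u (\<lambda>x. \<Sum>i\<in>I. f i x) = (\<Sum>i\<in>I. Bl l u (f i))"
proof -
  have d: "dotg u (\<lambda>x. \<Sum>i\<in>I. f i x) = (\<lambda>x. \<Sum>i\<in>I. dotg u (f i) x)"
    by (rule ext) (simp add: dotg_def pdD(1,2)[OF dx_sum[OF assms(1) test_fun_smooth[OF assms(3)]]] sum_distrib_left sum.distrib)
  have "(\<integral>x. dotg u (\<lambda>x. \<Sum>i\<in>I. f i x) x \<partial>lborel) = (\<Sum>i\<in>I. \<integral>x. dotg u (f i) x \<partial>lborel)"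
    unfolding d by (intro Bochner_Integration.integral_sum integrable_dotg[OF assms(2,3)])
  moreover have "(\<integral>x. u x * (\<Sum>i\<in>I. f i x) \<partial>lborel) = (\<Sum>i\<in>I. \<integral>x. u x * f i x \<partial>lborel)"
    unfolding sum_distrib_left by (intro Bochner_Integration.integral_sum integrable_test_prod[OF assms(2,3)])
  ultimately show ?thesis by (simp add: Bl_def sum_subtractf sum_distrib_left)
qed

lemma near_support:
  assumes "e > 0" "\<bar>fst x - p\<bar> \<ge> e"
  shows "near p e x = 0 \<and> dx1 (near p e) x = 0 \<and> dx2 (near p e) x = 0"
proof -
  let ?c = "(p, 1 + e/2)"
  have e2: "e\<^sup>2 > 0" using assms by simp
  have "e\<^sup>2 \<le> (fst x - p)\<^sup>2" using assms by (intro abs_le_square_iff[THEN iffD1]) auto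
  then have "e\<^sup>2/2 \<le> dsq ?c x" using e2 by (simp add: dsq_def) (smt (verit) zero_le_power2 field_sum_of_halves)
  then have "(e\<^sup>2/2 - dsq ?c x) / e\<^sup>2 \<le> 0" using e2 by (simp add: divide_nonpos_pos)
  then show ?thesis unfolding near_def dx_bump[OF e2] by (simp add: bump_def ee_0 ee1_def)
qed

lemma near_bounds:
  fixes e p :: real
  assumes "e > 0"
  defines "B \<equiv> cbox (p - e, 1 - e) (p + e, 1 + 2 * e)"
  shows "(near p e x)\<^sup>2 \<le> indicator B x" "dotg (near p e) (near p e) x \<le> 8 / e\<^sup>2 * indicator B x"
proof -
  let ?c = "(p, 1 + e/2)"
  define t where "t = (e\<^sup>2/2 - dsq ?c x) / e\<^sup>2"
  have e2: "e\<^sup>2 > 0" using assms by simp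
  have n: "near p e x = ee t" "dx1 (near p e) x = - ee1 t * 2 * (fst x - p) / e\<^sup>2" "dx2 (near p e) x = - ee1 t * 2 * (snd x - (1 + e/2)) / e\<^sup>2"
    unfolding near_def dx_bump[OF e2] t_def by (simp_all add: bump_def)
  have dg: "dotg (near p e) (near p e) x = (ee1 t)\<^sup>2 * 4 * dsq ?c x / e^4"
  proof -
    have "(- k * 2 * X / E) * (- k * 2 * X / E) + (- k * 2 * Y / E) * (- k * 2 * Y / E) = k\<^sup>2 * 4 * (X\<^sup>2 + Y\<^sup>2) / E\<^sup>2" for k X Y E :: real
      by (simp add: power2_eq_square add_divide_distrib distrib_left mult_ac)
    moreover have "e^4 = (e\<^sup>2)\<^sup>2" by simp
    ultimately show ?thesis unfolding dotg_def n dsq_def fst_conv snd_conv by (simp only:)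
  qed
  have "(near p e x)\<^sup>2 \<le> indicator B x \<and> dotg (near p e) (near p e) x \<le> 8 / e\<^sup>2 * indicator B x"
  proof -
    have "ee t = 0 \<and> ee1 t = 0 \<or> dsq ?c x \<le> e\<^sup>2/2 \<and> x \<in> B"
    proof (cases "t \<le> 0")
      case False
      have d: "dsq ?c x \<le> e\<^sup>2/2"
      proof (rule ccontr)
        assume "\<not> dsq ?c x \<le> e\<^sup>2/2"
        then have "t \<le> 0" unfolding t_def using e2 by (intro divide_nonpos_pos) auto
        then show False using False by simp
      qed
      have "(fst x - p)\<^sup>2 \<le> e\<^sup>2" "(snd x - (1 + e/2))\<^sup>2 \<le> e\<^sup>2"
        using d e2 zero_le_power2[of "fst x - p"] zero_le_power2[of "snd x - (1 + e/2)"] unfolding dsq_def fst_conv snd_conv by linarith+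
      then have "\<bar>fst x - p\<bar> \<le> e" "\<bar>snd x - (1 + e/2)\<bar> \<le> e"
        using abs_le_square_iff[of _ e] assms(1) by auto
      then have "p - e \<le> fst x \<and> fst x \<le> p + e \<and> 1 - e \<le> snd x \<and> snd x \<le> 1 + 2 * e" using assms(1) by linarith
      then have "x \<in> B" by (cases x) (simp add: B_def cbox_Pair_eq)
      then show ?thesis using d by simp
    qed (simp add: ee_def ee1_def)
    then consider "ee t = 0" "ee1 t = 0" | "dsq ?c x \<le> e\<^sup>2/2" "x \<in> B" by blast
    then show ?thesis
    proof cases
      case 1
      then show ?thesis unfolding dg n by simp
    next
      case 2
      have "(ee t)\<^sup>2 \<le> 1" using ee_nonneg[of t] ee_le_1[of t] by (simp add: abs_square_le_1)
      then have nb: "(near p e x)\<^sup>2 \<le> indicator B x" using 2 by (simp add: n)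
      have "ee1 t \<le> 2"
      proof (cases "t \<le> 0")
        case False
        then have t: "t > 0" by simp
        have "(1/t)\<^sup>2 / 2 \<le> exp (1/t)" using exp_lower_Taylor_quadratic[of "1/t"] t by (smt (verit) divide_nonneg_nonneg zero_le_one)
        then have "(1/t)\<^sup>2 \<le> 2 * exp (1/t)" by simp
        then have "exp (- (1/t)) * (1/t)\<^sup>2 \<le> exp (- (1/t)) * (2 * exp (1/t))" by (intro mult_left_mono) auto
        also have "\<dots> = 2" by (simp add: exp_minus)
        finally show ?thesis using t by (simp add: ee1_def power_divide)
      qed (simp add: ee1_def)
      then have "(ee1 t)\<^sup>2 \<le> 2\<^sup>2" using ee1_nonneg by (intro power_mono)
      then have "(ee1 t)\<^sup>2 * 4 * dsq ?c x \<le> 2\<^sup>2 * 4 * (e\<^sup>2/2)" using 2 dsq_nonneg by (intro mult_mono) auto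
      then have "(ee1 t)\<^sup>2 * 4 * dsq ?c x / e^4 \<le> (2\<^sup>2 * 4 * (e\<^sup>2/2)) / e^4" by (intro divide_right_mono) auto
      also have "\<dots> = 8 / e\<^sup>2" using assms(1) by (simp add: eval_nat_numeral)
      finally have "dotg (near p e) (near p e) x \<le> 8 / e\<^sup>2 * indicator B x" using 2 by (simp add: dg)
      with nb show ?thesis by blast
    qed
  qed
  then show "(near p e x)\<^sup>2 \<le> indicator B x" "dotg (near p e) (near p e) x \<le> 8 / e\<^sup>2 * indicator B x" by auto
qed

text \<open>The supporting box has area 6 e^2 and the squared gradient is at most 8 / e^2, so the
  energy bound 48 is free of e: Dirichlet energy is scale invariant in the plane.\<close>

lemma near_norms:
  assumes "e > 0" "test_fun \<Omega> (near p e)"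
  shows "nsq (near p e) \<le> 6 * e\<^sup>2" "dir (near p e) \<le> 48"
proof -
  let ?B = "cbox (p - e, 1 - e) (p + e, 1 + 2 * e) :: pt set"
  have m: "measure lborel ?B = 6 * e\<^sup>2" using assms(1) by (simp add: content_Pair power2_eq_square)
  have i: "integrable lborel (indicat_real ?B)"
    using emeasure_lborel_cbox_finite[of "(p - e, 1 - e)" "(p + e, 1 + 2 * e)"] by simp
  have "nsq (near p e) \<le> (\<integral>x. indicator ?B x \<partial>lborel)" unfolding nsq_def
    by (intro integral_mono integrable_test_sq[OF assms(2)] i near_bounds(1)[OF assms(1)])
  then show "nsq (near p e) \<le> 6 * e\<^sup>2" using m by simp
  have "dir (near p e) \<le> (\<integral>x. 8 / e\<^sup>2 * indicator ?B x \<partial>lborel)" unfolding dir_def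
    by (intro integral_mono integrable_dotg[OF assms(2,2)] integrable_mult_right i near_bounds(2)[OF assms(1)])
  also have "\<dots> = 8 / e\<^sup>2 * (6 * e\<^sup>2)" using m by simp
  also have "\<dots> = 48" using assms(1) by simp
  finally show "dir (near p e) \<le> 48" .
qed

lemma test_near:
  assumes "0 < e" "e < 1/2" "i \<le> n"
  shows "test_fun (H_pert e n) (near (2 + real i / real n) e)"
proof -
  let ?p = "2 + real i / real n"
  have p2: "real i / real n \<ge> 0" by simp
  let ?R = "e * sqrt (1/2)"
  have R2: "?R\<^sup>2 = e\<^sup>2/2" by (simp add: power_mult_distrib)
  have "cball (?p, 1 + e/2) ?R \<subseteq> H_pert e n"
  proof
    fix x assume x: "x \<in> cball (?p, 1 + e/2) ?R"
    have "dsq (?p, 1 + e/2) x \<le> ?R\<^sup>2" unfolding dsq_dist using x by (intro power_mono) auto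
    then have d: "(fst x - ?p)\<^sup>2 + (snd x - (1 + e/2))\<^sup>2 \<le> e\<^sup>2/2" unfolding R2 dsq_def by simp
    have e2: "e\<^sup>2 > 0" using assms(1) by simp
    have "(fst x - ?p)\<^sup>2 < e\<^sup>2" "(snd x - (1 + e/2))\<^sup>2 < e\<^sup>2"
      using d e2 zero_le_power2[of "fst x - ?p"] zero_le_power2[of "snd x - (1 + e/2)"] by linarith+
    then have b: "\<bar>fst x - ?p\<bar> < e" "\<bar>snd x - (1 + e/2)\<bar> < e"
      using power2_less_imp_less[of "\<bar>fst x - ?p\<bar>" e] power2_less_imp_less[of "\<bar>snd x - (1 + e/2)\<bar>" e] assms(1) by auto
    have "snd x < 2" "0 < snd x" "0 \<le> fst x" using b p2 assms by linarith+
    then show "x \<in> H_pert e n"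
      using b(1) assms(3) unfolding mem_H_pert mem_H_pipe by (cases "snd x < 1") auto
  qed
  then have "test_fun (H_pert e n) (bump (?p, 1 + e/2) (?R\<^sup>2) (e\<^sup>2))"
    using assms(1) by (intro test_bump) auto
  then show ?thesis unfolding near_def R2 .
qed

text \<open>Adding t times a sum of bumps changes the energy by a linear term of at most -2 t (N+1)
  A e and a quadratic one of at most 48 (N+1) t^2; the best t gains (N+1) A^2 e^2 / 48. Half of it
  pays for the defect \<eta>, and the squared norm, at most 4, costs another factor 4: 384 = 48 * 2
  * 4. Only the first N + 1 tubes carry bumps; 10 N <= n puts them over the segment from 2 to
  21/10.\<close>

lemma lambda1_H_pert_le:
  obtains A where "A > 0"
    "\<And>N n e. 10 * N \<le> n \<Longrightarrow> n \<ge> 1 \<Longrightarrow> 0 < e \<Longrightarrow> e < 1 / (2 * real n) \<Longrightarrow> A\<^sup>2 * real (N+1) * e \<le> 1 \<Longrightarrow>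
       lambda1 (H_pert e n) \<le> lambda1 H_pipe - real (N+1) * A\<^sup>2 * e\<^sup>2 / 384"
proof -
  let ?l = "lambda1 H_pipe"
  have l: "?l > 0" using lambda1_H_pos by linarith
  obtain \<theta> where \<theta>: "\<theta> > 0" "\<And>e p u \<eta>. 0 < e \<Longrightarrow> e \<le> 1/2 \<Longrightarrow> 2 \<le> p \<Longrightarrow> p \<le> 21/10 \<Longrightarrow> nearmin \<eta> u \<Longrightarrow>
      Bl ?l u (near p e) \<le> - (\<theta> * e * mass target u) + e * (sqrt (En ?l (far p (e/8))) * sqrt \<eta>)"
    by (rule near_gain) blast
  have "(41/20, 3/4) \<in> H_pipe" by (simp add: mem_H_pipe)
  then obtain c \<eta>0 where c: "c > 0" "\<eta>0 > 0" "\<And>u. nearmin \<eta>0 u \<Longrightarrow> c \<le> mass target u"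
    using mass_point[OF lambda1_H_less, of "(41/20, 3/4)" "1/20"] by (metis divide_pos_pos zero_less_numeral zero_less_one)
  \<comment> \<open>Half of the gain \<theta> c e per tube is kept; the other half absorbs the error
    from \<eta>.\<close>
  define A where "A = \<theta> * c / 2"
  have A: "A > 0" using \<theta> c by (simp add: A_def)
  show thesis
  proof (rule that[OF A])
    fix N n :: nat and e :: real
    assume Nn: "10 * N \<le> n" and n: "n \<ge> 1" and e: "0 < e" "e < 1 / (2 * real n)" and small: "A\<^sup>2 * real (N+1) * e \<le> 1"
    define p where "p i = 2 + real i / real n" for i
    have "1 / (2 * real n) \<le> 1/2" using n by (simp add: field_simps)
    then have e1: "e < 1/2" using e by linarith
    have pb: "2 \<le> p i" "p i \<le> 21/10" if "i \<le> N" for i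
    proof -
      have "10 * real i \<le> real n" using that Nn by linarith
      then show "2 \<le> p i" "p i \<le> 21/10" using n by (simp_all add: p_def field_simps)
    qed
    define I where "I = {0..N}"
    have I: "finite I" "card I = N + 1" "\<And>i. i \<in> I \<Longrightarrow> i \<le> N" by (auto simp: I_def)
    have inn: "i \<le> n" if "i \<in> I" for i using I(3)[OF that] Nn by linarith
    have tn: "test_fun (H_pert e n) (near (p i) e)" if "i \<in> I" for i
      unfolding p_def by (rule test_near[OF e(1) e1 inn[OF that]])
    define h where "h x = (\<Sum>i\<in>I. near (p i) e x)" for x
    have th: "test_fun (H_pert e n) h" unfolding h_def[abs_def] by (rule test_fun_sum[OF tn])
    have h0: "h x \<ge> 0" for x unfolding h_def by (intro sum_nonneg) (simp add: near_def bump_nonneg)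
    have disj: "\<bar>fst x - p i\<bar> \<ge> e \<or> \<bar>fst x - p j\<bar> \<ge> e" if "i \<noteq> j" for i j x
    proof -
      have "1 \<le> \<bar>real i - real j\<bar>" using that by linarith
      then have "1 / real n \<le> \<bar>real i - real j\<bar> / real n" by (intro divide_right_mono) auto
      also have "\<dots> = \<bar>p i - p j\<bar>" by (simp add: p_def abs_divide flip: diff_divide_distrib)
      finally have "1 / real n \<le> \<bar>p i - p j\<bar>" .
      moreover have "2 * e < 1 / real n" using e n by (simp add: field_simps)
      ultimately show ?thesis by linarith
    qed
    have z: "near (p i) e x * near (p j) e x = 0" "dx1 (near (p i) e) x * dx1 (near (p j) e) x = 0"
      "dx2 (near (p i) e) x * dx2 (near (p j) e) x = 0" if ij: "i \<noteq> j" for i j x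
    proof -
      have "near (p i) e x = 0 \<and> dx1 (near (p i) e) x = 0 \<and> dx2 (near (p i) e) x = 0 \<or>
        near (p j) e x = 0 \<and> dx1 (near (p j) e) x = 0 \<and> dx2 (near (p j) e) x = 0"
        using disj[OF ij, of x] near_support[OF e(1), of x "p i"] near_support[OF e(1), of x "p j"] by argo
      then show "near (p i) e x * near (p j) e x = 0" "dx1 (near (p i) e) x * dx1 (near (p j) e) x = 0"
        "dx2 (near (p i) e) x * dx2 (near (p j) e) x = 0" by auto
    qed
    have h2: "(h x)\<^sup>2 = (\<Sum>i\<in>I. (near (p i) e x)\<^sup>2)" for x
      unfolding h_def by (rule sum_sq_disjoint[OF I(1) z(1)])
    have hd: "dotg h h x = (\<Sum>i\<in>I. dotg (near (p i) e) (near (p i) e) x)" for x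
    proof -
      have "dx1 h x = (\<Sum>i\<in>I. dx1 (near (p i) e) x)" "dx2 h x = (\<Sum>i\<in>I. dx2 (near (p i) e) x)"
        using pdD(1,2)[OF dx_sum[OF I(1) smooth_near]] unfolding h_def[abs_def] by auto
      moreover have "(\<Sum>i\<in>I. dx1 (near (p i) e) x)\<^sup>2 = (\<Sum>i\<in>I. (dx1 (near (p i) e) x)\<^sup>2)"
        by (rule sum_sq_disjoint[OF I(1) z(2)])
      moreover have "(\<Sum>i\<in>I. dx2 (near (p i) e) x)\<^sup>2 = (\<Sum>i\<in>I. (dx2 (near (p i) e) x)\<^sup>2)"
        by (rule sum_sq_disjoint[OF I(1) z(3)])
      ultimately show ?thesis unfolding dotg_def by (simp add: power2_eq_square sum.distrib)
    qed
    have "nsq h = (\<Sum>i\<in>I. nsq (near (p i) e))"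
      unfolding nsq_def h2 by (intro Bochner_Integration.integral_sum integrable_test_sq[OF tn])
    also have "\<dots> \<le> (\<Sum>i\<in>I. 6 * e\<^sup>2)" by (intro sum_mono near_norms(1)[OF e(1) tn])
    finally have nh: "nsq h \<le> real (N+1) * (6 * e\<^sup>2)" using I(2) by simp
    have "dir h = (\<Sum>i\<in>I. dir (near (p i) e))"
      unfolding dir_def hd by (intro Bochner_Integration.integral_sum integrable_dotg[OF tn tn])
    also have "\<dots> \<le> (\<Sum>i\<in>I. 48)" by (intro sum_mono near_norms(2)[OF e(1) tn])
    finally have dh: "dir h \<le> real (N+1) * 48" using I(2) by simp
    have Eh: "En ?l h \<le> real (N+1) * 48" using dh mult_nonneg_nonneg[OF less_imp_le[OF l] nsq_nonneg[of h]] unfolding En_def by linarith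
    \<comment> \<open>A common bound for the square roots of the dipole energies. It may grow as e
      tends to 0, but \<eta> is chosen after it.\<close>
    define S where "S = (\<Sum>i\<in>I. sqrt (En ?l (far (p i) (e/8)))) + 1"
    have tf: "test_fun H_pipe (far (p i) (e/8))" if "i \<in> I" for i using pb[OF I(3)[OF that]] e by (intro test_far) auto
    have S0: "0 \<le> sqrt (En ?l (far (p i) (e/8)))" if "i \<in> I" for i using En_H_nonneg[OF tf[OF that]] by simp
    have S: "S > 0" "\<And>i. i \<in> I \<Longrightarrow> sqrt (En ?l (far (p i) (e/8))) \<le> S"
    proof -
      have "0 \<le> (\<Sum>i\<in>I. sqrt (En ?l (far (p i) (e/8))))" by (rule sum_nonneg[OF S0])
      then show "S > 0" unfolding S_def by linarith
      show "sqrt (En ?l (far (p i) (e/8))) \<le> S" if i: "i \<in> I" for i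
      proof -
        have "sqrt (En ?l (far (p i) (e/8))) \<le> (\<Sum>i\<in>I. sqrt (En ?l (far (p i) (e/8))))"
          by (rule member_le_sum[OF i S0 I(1)]) auto
        then show ?thesis unfolding S_def by linarith
      qed
    qed
    \<comment> \<open>In turn: the mass bound on \<open>target\<close> applies, the error per tube
      is at most A e, and at most half of the final gain is lost.\<close>
    define \<eta> where "\<eta> = min \<eta>0 (min ((A / S)\<^sup>2) (real (N+1) * A\<^sup>2 * e\<^sup>2 / 96))"
    have \<eta>: "\<eta> > 0" "\<eta> \<le> \<eta>0" "\<eta> \<le> (A / S)\<^sup>2" "\<eta> \<le> real (N+1) * A\<^sup>2 * e\<^sup>2 / 96" using c A S e by (auto simp: \<eta>_def)
    have s\<eta>: "S * sqrt \<eta> \<le> A"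
    proof -
      have "sqrt \<eta> \<le> sqrt ((A / S)\<^sup>2)" using \<eta>(3) by (rule real_sqrt_le_mono)
      also have "\<dots> = A / S" using A S by simp
      finally show ?thesis using S by (simp add: pos_le_divide_eq mult.commute)
    qed
    obtain u where nm: "nearmin \<eta> u" using nearmin_exists[OF \<eta>(1)] by blast
    have nm0: "nearmin \<eta>0 u" using nm \<eta>(2) unfolding nearmin_def by (meson add_left_mono order_trans)
    note u = nearminD(1,2)[OF nm]
    have tu: "test_fun (H_pert e n) u" by (rule test_fun_mono[OF u(1) H_pipe_subset_pert])
    have Bi: "Bl ?l u (near (p i) e) \<le> - (A * e)" if i: "i \<in> I" for i
    proof -
      have "Bl ?l u (near (p i) e) \<le> - (\<theta> * e * mass target u) + e * (sqrt (En ?l (far (p i) (e/8))) * sqrt \<eta>)"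
        using \<theta>(2)[OF e(1) _ pb[OF I(3)[OF i]] nm] e1 by simp
      moreover have "\<theta> * e * c \<le> \<theta> * e * mass target u" using \<theta> e c(3)[OF nm0] by (intro mult_left_mono) auto
      moreover have "sqrt (En ?l (far (p i) (e/8))) * sqrt \<eta> \<le> A"
        by (rule order_trans[OF mult_right_mono[OF S(2)[OF i]] s\<eta>]) (use \<eta>(1) in simp)
      then have "e * (sqrt (En ?l (far (p i) (e/8))) * sqrt \<eta>) \<le> e * A" using e by (intro mult_left_mono) auto
      moreover have "\<theta> * e * c = 2 * (A * e)" by (simp add: A_def)
      moreover have "e * A = A * e" by simp
      ultimately show ?thesis by linarith
    qed
    have "Bl ?l u h = (\<Sum>i\<in>I. Bl ?l u (near (p i) e))" unfolding h_def[abs_def] by (rule Bl_sum[OF I(1) u(1) tn])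
    also have "\<dots> \<le> (\<Sum>i\<in>I. - (A * e))" by (intro sum_mono Bi)
    finally have Bh: "Bl ?l u h \<le> - (real (N+1) * (A * e))" using I(2) by simp
    \<comment> \<open>The minimiser of -2 t (N+1) A e + 48 (N+1) t^2.\<close>
    define t where "t = A * e / 48"
    have t: "t > 0" using A e by (simp add: t_def)
    let ?v = "\<lambda>x. u x + t * h x"
    have tv: "test_fun (H_pert e n) ?v" by (intro test_fun_add test_fun_cmult tu th)
    have "En ?l ?v = En ?l u + 2 * t * Bl ?l u h + t\<^sup>2 * En ?l h" by (rule En_add(2)[OF tu th])
    also have "\<dots> \<le> \<eta> + 2 * t * (- (real (N+1) * (A * e))) + t\<^sup>2 * (real (N+1) * 48)"
      using nearminD(4)[OF nm] Bh Eh t by (intro add_mono mult_left_mono) auto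
    also have "\<dots> = \<eta> - real (N+1) * A\<^sup>2 * e\<^sup>2 / 48" unfolding t_def by (simp add: power2_eq_square field_simps)
    also have "\<dots> \<le> - (real (N+1) * A\<^sup>2 * e\<^sup>2 / 96)" using \<eta>(4) by linarith
    finally have Ev: "En ?l ?v \<le> - (real (N+1) * A\<^sup>2 * e\<^sup>2 / 96)" .
    have iu: "integrable lborel (\<lambda>x. (u x)\<^sup>2)" "integrable lborel (\<lambda>x. (h x)\<^sup>2)" "integrable lborel (\<lambda>x. (?v x)\<^sup>2)"
      using integrable_test_sq tu th tv by blast+
    \<comment> \<open>Non-negativity of \<open>u\<close> and \<open>h\<close> keeps the norm from
      dropping. This fixes the sign of the difference of the eigenvalues before the upper bound 4 is
      applied.\<close>
    have nv1: "1 \<le> nsq ?v"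
    proof -
      have "nsq u \<le> nsq ?v" unfolding nsq_def
        by (intro integral_mono iu power_mono) (use t h0 u(2) in auto)
      then show ?thesis using nearminD(3)[OF nm] by simp
    qed
    have nv4: "nsq ?v \<le> 4"
    proof -
      have "nsq ?v \<le> (\<integral>x. 2 * (u x)\<^sup>2 + 2 * t\<^sup>2 * (h x)\<^sup>2 \<partial>lborel)" unfolding nsq_def
      proof (intro integral_mono iu Bochner_Integration.integrable_add integrable_mult_right)
        fix x
        have "0 \<le> (u x - t * h x)\<^sup>2" by simp
        then show "(?v x)\<^sup>2 \<le> 2 * (u x)\<^sup>2 + 2 * t\<^sup>2 * (h x)\<^sup>2" by (simp add: power2_eq_square algebra_simps)
      qed
      also have "\<dots> = 2 * nsq u + 2 * t\<^sup>2 * nsq h" using iu unfolding nsq_def by simp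
      also have "\<dots> \<le> 2 * 1 + 2 * t\<^sup>2 * (real (N+1) * (6 * e\<^sup>2))"
        using nearminD(3)[OF nm] nh by (intro add_mono mult_left_mono) auto
      also have "2 * t\<^sup>2 * (real (N+1) * (6 * e\<^sup>2)) = (A\<^sup>2 * real (N+1) * e) * (e^3 / 192)"
        unfolding t_def by (simp add: power2_eq_square power3_eq_cube field_simps)
      also have "\<dots> \<le> 1 * (1 / 192)"
      proof (intro mult_mono small)
        have "e^3 \<le> 1" using e e1 by (intro power_le_one) auto
        then show "e^3 / 192 \<le> 1 / 192" by simp
      qed (use e in auto)
      finally show ?thesis by simp
    qed
    have "lambda1 (H_pert e n) * nsq ?v \<le> dir ?v" by (rule lambda1_le[OF tv])
    also have "\<dots> = En ?l ?v + ?l * nsq ?v" by (simp add: En_def)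
    finally have "(lambda1 (H_pert e n) - ?l) * nsq ?v \<le> - (real (N+1) * A\<^sup>2 * e\<^sup>2 / 96)" using Ev by (simp add: left_diff_distrib)
    then have k: "real (N+1) * A\<^sup>2 * e\<^sup>2 / 96 \<le> (?l - lambda1 (H_pert e n)) * nsq ?v" by (simp add: left_diff_distrib)
    have "0 \<le> real (N+1) * A\<^sup>2 * e\<^sup>2 / 96" by simp
    then have "0 \<le> (?l - lambda1 (H_pert e n)) * nsq ?v" using k by linarith
    then have "0 \<le> ?l - lambda1 (H_pert e n)" using nv1 by (simp add: zero_le_mult_iff)
    then have "(?l - lambda1 (H_pert e n)) * nsq ?v \<le> (?l - lambda1 (H_pert e n)) * 4" using nv4 by (intro mult_left_mono)
    then have "real (N+1) * A\<^sup>2 * e\<^sup>2 / 96 \<le> (?l - lambda1 (H_pert e n)) * 4" using k by linarith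
    moreover have "m \<le> l - a / 384" if "a / 96 \<le> (l - m) * 4" for a l m :: real using that by (simp add: field_simps)
    ultimately show "lambda1 (H_pert e n) \<le> ?l - real (N+1) * A\<^sup>2 * e\<^sup>2 / 384" by blast
  qed
qed

lemma rho_H_pert_le:
  obtains n e0 where "n \<ge> 1" "0 < e0" "e0 \<le> 1 / (2 * real n)"
    "\<And>e. 0 < e \<Longrightarrow> e < e0 \<Longrightarrow> rho (H_pert e n) \<le> (1 - e\<^sup>2) * rho H_pipe"
proof -
  let ?l = "lambda1 H_pipe"
  have l: "?l > 0" using lambda1_H_pos by linarith
  obtain A where A: "A > 0" "\<And>N n e. 10 * N \<le> n \<Longrightarrow> n \<ge> 1 \<Longrightarrow> 0 < e \<Longrightarrow> e < 1 / (2 * real n) \<Longrightarrow> A\<^sup>2 * real (N+1) * e \<le> 1 \<Longrightarrow>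
       lambda1 (H_pert e n) \<le> ?l - real (N+1) * A\<^sup>2 * e\<^sup>2 / 384" by (rule lambda1_H_pert_le) blast
  \<comment> \<open>The eigenvalue is to drop by at least \<open>4 * ?l * e\<^sup>2\<close>: with s
    = e^2 the inradius costs 2 s to first order, and (1 + s)^2 (1 - 4 s) <= 1 - s.\<close>
  obtain N :: nat where N: "4 * ?l * 384 / A\<^sup>2 \<le> real N" using real_arch_simple by blast
  have A2: "A\<^sup>2 > 0" using A by simp
  have N1: "4 * ?l \<le> real (N+1) * A\<^sup>2 / 384"
  proof -
    have "4 * ?l * 384 / A\<^sup>2 \<le> real (N+1)" using N by simp
    then show ?thesis using A2 by (simp add: pos_divide_le_eq)
  qed
  \<comment> \<open>The summand 1 keeps \<open>n\<close> positive when N = 0.\<close>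
  define n where "n = 10 * N + 1"
  define e0 where "e0 = min (1 / (2 * real n)) (1 / (A\<^sup>2 * real (N+1)))"
  have n: "n \<ge> 1" "10 * N \<le> n" by (auto simp: n_def)
  have e0: "0 < e0" "e0 \<le> 1 / (2 * real n)" "e0 \<le> 1 / (A\<^sup>2 * real (N+1))" using n A2 by (auto simp: e0_def)
  show thesis
  proof (rule that[OF n(1) e0(1,2)])
    fix e assume e: "0 < e" "e < e0"
    have en: "e < 1 / (2 * real n)" using e e0 by linarith
    have "e \<le> 1 / (A\<^sup>2 * real (N+1))" using e e0 by linarith
    then have sm: "A\<^sup>2 * real (N+1) * e \<le> 1" using A2 by (simp add: pos_le_divide_eq mult.commute)
    have "lambda1 (H_pert e n) \<le> ?l - real (N+1) * A\<^sup>2 * e\<^sup>2 / 384" by (rule A(2)[OF n(2,1) e(1) en sm])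
    also have "\<dots> \<le> ?l - 4 * ?l * e\<^sup>2" using mult_right_mono[OF N1, of "e\<^sup>2"] by simp
    finally have lp: "lambda1 (H_pert e n) \<le> ?l * (1 - 4 * e\<^sup>2)" by (simp add: algebra_simps)
    note ir = inradius_H_pert[OF n(1) e(1) en]
    have "1 / (2 * real n) \<le> 1/2" using n by (simp add: field_simps)
    then have "e \<le> 1/2" using en by linarith
    then have "e\<^sup>2 \<le> (1/2)\<^sup>2" using e by (intro power_mono) auto
    then have e2: "0 \<le> e\<^sup>2" "e\<^sup>2 \<le> 1/4" by (simp_all add: power2_eq_square)
    have "rho (H_pert e n) \<le> (inradius (H_pert e n))\<^sup>2 * (?l * (1 - 4 * e\<^sup>2))"
      unfolding rho_def using lp by (intro mult_left_mono) auto
    also have "\<dots> \<le> ((1 + e\<^sup>2) / 2)\<^sup>2 * (?l * (1 - 4 * e\<^sup>2))"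
      using ir l e2 by (intro mult_right_mono power_mono) auto
    also have "\<dots> = (1 + e\<^sup>2)\<^sup>2 * (1 - 4 * e\<^sup>2) * (?l / 4)" by (simp add: power_divide)
    also have "\<dots> \<le> (1 - e\<^sup>2) * (?l / 4)"
    proof (intro mult_right_mono)
      have "(1 - s) - (1 + s)\<^sup>2 * (1 - 4 * s) = s * (1 + 7 * s + 4 * s\<^sup>2)" for s :: real
        by (simp add: power2_eq_square algebra_simps)
      moreover have "0 \<le> e\<^sup>2 * (1 + 7 * e\<^sup>2 + 4 * (e\<^sup>2)\<^sup>2)" using e2 by (intro mult_nonneg_nonneg add_nonneg_nonneg) auto
      ultimately show "(1 + e\<^sup>2)\<^sup>2 * (1 - 4 * e\<^sup>2) \<le> 1 - e\<^sup>2" by (metis diff_ge_0_iff_ge)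
    qed (use l in simp)
    also have "\<dots> \<le> (1 - e\<^sup>2) * rho H_pipe"
    proof (intro mult_left_mono)
      have "(1/2)\<^sup>2 \<le> (inradius H_pipe)\<^sup>2" using inradius_H_pipe by (intro power_mono) auto
      then have "(1/2)\<^sup>2 * ?l \<le> rho H_pipe" unfolding rho_def using l by (intro mult_right_mono) auto
      then show "?l / 4 \<le> rho H_pipe" by (simp add: power2_eq_square)
    qed (use e2 in simp)
    finally show "rho (H_pert e n) \<le> (1 - e\<^sup>2) * rho H_pipe" .
  qed
qed

section \<open>Comparison with the infimum over all admissible domains\<close>

lemma lambda1_nonneg:
  assumes "test_fun \<Omega> w" "nsq w > 0" shows "lambda1 \<Omega> \<ge> 0"
proof (rule field_le_epsilon)
  fix \<eta> :: real assume "\<eta> > 0"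
  from near_minimiser[OF assms this] obtain u where "dir u < lambda1 \<Omega> + \<eta>" by blast
  then show "0 \<le> lambda1 \<Omega> + \<eta>" using dir_nonneg[of u] by linarith
qed

text \<open>A bump on a small disc inside \<open>\<Omega>\<close> makes the Rayleigh infimum a
  genuine one. The bound is what makes the real infimum \<open>C_MH\<close> a lower bound of its
  set.\<close>

lemma rho_nonneg:
  assumes "open \<Omega>" "\<Omega> \<noteq> {}" shows "rho \<Omega> \<ge> 0"
proof -
  obtain x where "x \<in> \<Omega>" using assms(2) by blast
  then obtain r where r: "r > 0" "cball x r \<subseteq> \<Omega>" using assms(1) open_contains_cball by blast
  have t: "test_fun \<Omega> (bump x (r\<^sup>2) 1)" using test_bump[of 1 r x \<Omega>] r by simp
  have "bump x (r\<^sup>2) 1 x > 0" using r by (intro bump_pos) (auto simp: dsq_def)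
  then have "lambda1 \<Omega> \<ge> 0" using lambda1_nonneg[OF t nsq_pos[OF t, of x]] by simp
  then show ?thesis by (simp add: rho_def)
qed

theorem mainTheorem13:
  shows "(\<exists>n0::nat. n0 \<ge> 1 \<and>
           (\<exists>f :: real \<Rightarrow> real. f \<in> o[at_right 0](\<lambda>\<epsilon>. \<epsilon>^2) \<and>
              (\<forall>\<epsilon>. 0 < \<epsilon> \<and> \<epsilon> < 1 / (2 * real n0) \<longrightarrow>
                 rho (H_pert \<epsilon> n0) \<le> (1 - \<epsilon>^2) * rho H_pipe + f \<epsilon>)))
         \<and> rho H_pipe \<noteq> C_MH"
proof -
  obtain n e0 where n: "n \<ge> 1" and e0: "0 < e0" "e0 \<le> 1 / (2 * real n)"
    and main: "\<And>e. 0 < e \<Longrightarrow> e < e0 \<Longrightarrow> rho (H_pert e n) \<le> (1 - e\<^sup>2) * rho H_pipe"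
    by (rule rho_H_pert_le) blast
  \<comment> \<open>Zero for small e, so trivially o(e^2); from \<open>e0\<close> on it is the
    defect itself, so that the inequality holds on the whole range of \<epsilon>.\<close>
  define f where "f e = (if e < e0 then 0 else rho (H_pert e n) - (1 - e\<^sup>2) * rho H_pipe)" for e
  have "\<forall>\<^sub>F e in at_right 0. f e = 0"
    using e0(1) unfolding eventually_at_right_field f_def by (intro exI[of _ e0]) auto
  then have "f \<in> o[at_right 0](\<lambda>\<epsilon>. \<epsilon>^2)" using landau_o.small.in_cong[of f "\<lambda>_. 0"] by simp
  moreover have "rho (H_pert e n) \<le> (1 - e^2) * rho H_pipe + f e" if "0 < e" for e
    using main[OF that] by (simp add: f_def)
  moreover have "rho H_pipe \<noteq> C_MH"
  proof -
    define e where "e = e0 / 2"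
    have e: "0 < e" "e < e0" using e0 by (auto simp: e_def)
    have en: "e < 1 / (2 * real n)" using e e0 by linarith
    have "1 / (2 * real n) \<le> 1/2" using n by (simp add: field_simps)
    then have e1: "e < 1" using en by linarith
    have "0 < (inradius H_pipe)\<^sup>2" "0 < lambda1 H_pipe" using inradius_H_pipe lambda1_H_pos by auto
    then have "rho H_pipe > 0" unfolding rho_def by (rule mult_pos_pos)
    moreover have "1 - e\<^sup>2 < 1" using e by simp
    ultimately have "(1 - e\<^sup>2) * rho H_pipe < rho H_pipe" by (simp add: mult_less_cancel_right1)
    then have lt: "rho (H_pert e n) < rho H_pipe" using main[OF e] by linarith
    have ne: "H_pert e n \<noteq> {}" using H_pipe_subset_pert[of e n] half_ball_in_H_pipe by force
    have "C_MH \<le> rho (H_pert e n)" unfolding C_MH_def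
    proof (rule cInf_lower)
      show "rho (H_pert e n) \<in> {rho \<Omega> |\<Omega>. open \<Omega> \<and> \<Omega> \<noteq> {} \<and> simply_connected \<Omega> \<and> finite_inradius \<Omega>}"
        using open_H_pert[OF e1] ne simply_connected_H_pert[OF e(1) e1] inradius_H_pert(3)[OF n e(1) en] by blast
      show "bdd_below {rho \<Omega> |\<Omega>. open \<Omega> \<and> \<Omega> \<noteq> {} \<and> simply_connected \<Omega> \<and> finite_inradius \<Omega>}"
        by (rule bdd_belowI[of _ 0]) (use rho_nonneg in blast)
    qed
    then show ?thesis using lt by linarith
  qed
  ultimately show ?thesis using n by blast
qed

end
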